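(* A Polish group $G$ admits a nontrivial probability preserving spatial action if it admits any of the following nontrivial actions: (1) a locally finite Polish (measure preserving) action; (2) a locally finite Polish nonsingular action with continuous Radon–Nikodym cocycle. In particular, Lévy groups admit no such nontrivial actions (neither of type (1) nor of type (2)).
   Context: A standard measure space $(X,\mathcal{B},\mu)$ is a standard Borel space with a non-atomic Borel measure that is either a probability measure or an infinite $\sigma$-finite measure. A Borel action of a Polish group $G$ on a standard Borel space $(X,\mathcal{B})$ is a jointly Borel map $G\times X\to X$, $(g,x)\mapsto T_g(x)$, with $T_e=\mathrm{Id}_X$ and $T_g\circ T_h=T_{gh}$ for all $g,h\in G$; it is $\tau$-Polish, for a Polish topology $\tau$ on $X$ generating $\mathcal{B}$, if this map is jointly continuous. A (measure preserving) spatial action on $(X,\mathcal{B},\mu)$ is a Borel action with $\mu\circ T_g^{-1}=\mu$ for every $g\in G$; it is probability preserving if $\mu(X)=1$. A nonsingular spatial action on $(X,\mathcal{B},\mu)$ is a Borel action such that $\mu\circ T_g^{-1}$ and $\mu$ are mutually absolutely continuous for every $g\in G$. A locally finite Polish action (respectively, locally finite Polish nonsingular action) is a measure preserving (respectively, nonsingular) action on $(X,\mathcal{B},\mu)$ with a Polish topology $\tau$ on $X$ (generating $\mathcal{B}$) for which, simultaneously, the action is $\tau$-Polish and $\mu$ is $\tau$-locally finite, i.e. every point of $X$ has a $\tau$-neighborhood of finite measure. The Radon–Nikodym cocycle of a nonsingular action is $\nabla_g=\frac{d\mu\circ T_g^{-1}}{d\mu}$, $g\in G$; it is said to be continuous (with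 respect to the topology $\tau$ of the locally finite Polish nonsingular action) if for each $g\in G$ the Radon–Nikodym derivative $x\mapsto\nabla_g(x)\in(0,\infty)$ is $\tau$-continuous. A (measure preserving or nonsingular) spatial action $(g,x)\mapsto T_g(x)$ of a Polish group $G$ on a standard measure space $(X,\mathcal{B},\mu)$, and in particular a locally finite Polish action or a locally finite Polish nonsingular action, is trivial if the set of its fixed points $\{x\in X:T_g(x)=x\ \forall g\in G\}$ has full measure (is conull), and nontrivial otherwise. A Polish group $G$ is a Lévy group if there is an increasing sequence $K_1\subset K_2\subset\cdots$ of compact subgroups of $G$ with dense union in $G$, with normalized Haar measures $m_n$ on $K_n$, such that for every neighborhood $U$ of the identity in $G$ and all Borel sets $A_n\subset K_n$ with $\liminf_n m_n(A_n)>0$ one has $m_n(K_n\cap A_nU)\to1$. *)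

theory Defs
  imports "HOL-Probability.Probability" "HOL-Algebra.Algebra"
begin

definition polish_topology :: "'a topology \<Rightarrow> bool" where
  "polish_topology \<tau> \<longleftrightarrow> completely_metrizable_space \<tau> \<and> separable_space \<tau>"

text \<open>Only the \<open>\<sigma>\<close>-algebra of \<open>borel_of \<tau>\<close> matters; as a measure it is zero.\<close>

definition borel_of :: "'a topology \<Rightarrow> 'a measure" where
  "borel_of \<tau> = sigma (topspace \<tau>) {U. openin \<tau> U}"

definition polish_group :: "('g, 'b) monoid_scheme \<Rightarrow> 'g topology \<Rightarrow> bool" where
  "polish_group G \<tau>\<^sub>G \<longleftrightarrow>
     group G \<and> topspace \<tau>\<^sub>G = carrier G \<and> polish_topology \<tau>\<^sub>G \<and>
     continuous_map (prod_topology \<tau>\<^sub>G \<tau>\<^sub>G) \<tau>\<^sub>G (\<lambda>(g, h). g \<otimes>\<^bsub>G\<^esub> h) \<and>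
     continuous_map \<tau>\<^sub>G \<tau>\<^sub>G (\<lambda>g. inv\<^bsub>G\<^esub> g)"


subsection \<open>Standard measure spaces\<close>

definition standard_borel_space :: "'x measure \<Rightarrow> bool" where
  "standard_borel_space M \<longleftrightarrow>
     (\<exists>\<tau>. polish_topology \<tau> \<and> topspace \<tau> = space M \<and> sets M = sets (borel_of \<tau>))"

definition is_atom :: "'x measure \<Rightarrow> 'x set \<Rightarrow> bool" where
  "is_atom M A \<longleftrightarrow> A \<in> sets M \<and> emeasure M A > 0 \<and>
     (\<forall>B\<in>sets M. B \<subseteq> A \<longrightarrow> emeasure M B = 0 \<or> emeasure M (A - B) = 0)"

definition standard_measure_space :: "'x measure \<Rightarrow> bool" where
  "standard_measure_space M \<longleftrightarrow>
     standard_borel_space M \<and> (\<nexists>A. is_atom M A) \<and>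
     (prob_space M \<or> sigma_finite_measure M \<and> emeasure M (space M) = \<infinity>)"


subsection \<open>Actions\<close>

text \<open>An action is given as \<open>T g x\<close>; only its values for \<open>g \<in> carrier G\<close> and
  \<open>x \<in> space M\<close> are relevant.\<close>

definition borel_action ::
  "('g, 'b) monoid_scheme \<Rightarrow> 'g topology \<Rightarrow> 'x measure \<Rightarrow> ('g \<Rightarrow> 'x \<Rightarrow> 'x) \<Rightarrow> bool" where
  "borel_action G \<tau>\<^sub>G M T \<longleftrightarrow>
     (\<lambda>(g, x). T g x) \<in> borel_of \<tau>\<^sub>G \<Otimes>\<^sub>M M \<rightarrow>\<^sub>M M \<and>
     (\<forall>x\<in>space M. T \<one>\<^bsub>G\<^esub> x = x) \<and>
     (\<forall>g\<in>carrier G. \<forall>h\<in>carrier G. \<forall>x\<in>space M. T g (T h x) = T (g \<otimes>\<^bsub>G\<^esub> h) x)"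

definition spatial_action ::
  "('g, 'b) monoid_scheme \<Rightarrow> 'g topology \<Rightarrow> 'x measure \<Rightarrow> ('g \<Rightarrow> 'x \<Rightarrow> 'x) \<Rightarrow> bool" where
  "spatial_action G \<tau>\<^sub>G M T \<longleftrightarrow>
     standard_measure_space M \<and> borel_action G \<tau>\<^sub>G M T \<and>
     (\<forall>g\<in>carrier G. distr M M (T g) = M)"

definition probability_preserving_spatial_action ::
  "('g, 'b) monoid_scheme \<Rightarrow> 'g topology \<Rightarrow> 'x measure \<Rightarrow> ('g \<Rightarrow> 'x \<Rightarrow> 'x) \<Rightarrow> bool" where
  "probability_preserving_spatial_action G \<tau>\<^sub>G M T \<longleftrightarrow>
     spatial_action G \<tau>\<^sub>G M T \<and> emeasure M (space M) = 1"

definition nonsingular_spatial_action ::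
  "('g, 'b) monoid_scheme \<Rightarrow> 'g topology \<Rightarrow> 'x measure \<Rightarrow> ('g \<Rightarrow> 'x \<Rightarrow> 'x) \<Rightarrow> bool" where
  "nonsingular_spatial_action G \<tau>\<^sub>G M T \<longleftrightarrow>
     standard_measure_space M \<and> borel_action G \<tau>\<^sub>G M T \<and>
     (\<forall>g\<in>carrier G. absolutely_continuous M (distr M M (T g)) \<and>
                     absolutely_continuous (distr M M (T g)) M)"

text \<open>Joint \<open>\<tau>\<close>-continuity of a Borel action, for a Polish topology \<open>\<tau>\<close> generating the
  \<open>\<sigma>\<close>-algebra, together with \<open>\<tau>\<close>-local finiteness of the measure.\<close>

definition locally_finite_polish ::
  "'g topology \<Rightarrow> 'x measure \<Rightarrow> 'x topology \<Rightarrow> ('g \<Rightarrow> 'x \<Rightarrow> 'x) \<Rightarrow> bool" where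
  "locally_finite_polish \<tau>\<^sub>G M \<tau> T \<longleftrightarrow>
     polish_topology \<tau> \<and> topspace \<tau> = space M \<and> sets M = sets (borel_of \<tau>) \<and>
     continuous_map (prod_topology \<tau>\<^sub>G \<tau>) \<tau> (\<lambda>(g, x). T g x) \<and>
     (\<forall>x\<in>space M. \<exists>U. openin \<tau> U \<and> x \<in> U \<and> emeasure M U < \<infinity>)"

definition locally_finite_polish_action ::
  "('g, 'b) monoid_scheme \<Rightarrow> 'g topology \<Rightarrow> 'x measure \<Rightarrow> 'x topology \<Rightarrow> ('g \<Rightarrow> 'x \<Rightarrow> 'x) \<Rightarrow> bool"
  where
  "locally_finite_polish_action G \<tau>\<^sub>G M \<tau> T \<longleftrightarrow>
     spatial_action G \<tau>\<^sub>G M T \<and> locally_finite_polish \<tau>\<^sub>G M \<tau> T"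

definition locally_finite_polish_nonsingular_action ::
  "('g, 'b) monoid_scheme \<Rightarrow> 'g topology \<Rightarrow> 'x measure \<Rightarrow> 'x topology \<Rightarrow> ('g \<Rightarrow> 'x \<Rightarrow> 'x) \<Rightarrow> bool"
  where
  "locally_finite_polish_nonsingular_action G \<tau>\<^sub>G M \<tau> T \<longleftrightarrow>
     nonsingular_spatial_action G \<tau>\<^sub>G M T \<and> locally_finite_polish \<tau>\<^sub>G M \<tau> T"

definition rn_cocycle :: "'x measure \<Rightarrow> ('g \<Rightarrow> 'x \<Rightarrow> 'x) \<Rightarrow> 'g \<Rightarrow> 'x \<Rightarrow> ennreal" where
  "rn_cocycle M T g = RN_deriv M (distr M M (T g))"

text \<open>A Radon--Nikodym derivative is determined only up to null sets (and \<^const>\<open>RN_deriv\<close> is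
  an arbitrary version), so its continuity means that it has a continuous version with values
  in the open half-line.\<close>

definition continuous_rn_cocycle ::
  "('g, 'b) monoid_scheme \<Rightarrow> 'x measure \<Rightarrow> 'x topology \<Rightarrow> ('g \<Rightarrow> 'x \<Rightarrow> 'x) \<Rightarrow> bool" where
  "continuous_rn_cocycle G M \<tau> T \<longleftrightarrow>
     (\<forall>g\<in>carrier G. \<exists>f::'x \<Rightarrow> real. continuous_map \<tau> (top_of_set {0<..}) f \<and>
        (AE x in M. rn_cocycle M T g x = ennreal (f x)))"

definition fixed_points ::
  "('g, 'b) monoid_scheme \<Rightarrow> 'x measure \<Rightarrow> ('g \<Rightarrow> 'x \<Rightarrow> 'x) \<Rightarrow> 'x set" where
  "fixed_points G M T = {x \<in> space M. \<forall>g\<in>carrier G. T g x = x}"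

definition trivial_action ::
  "('g, 'b) monoid_scheme \<Rightarrow> 'x measure \<Rightarrow> ('g \<Rightarrow> 'x \<Rightarrow> 'x) \<Rightarrow> bool" where
  "trivial_action G M T \<longleftrightarrow> (AE x in M. x \<in> fixed_points G M T)"


subsection \<open>Levy groups\<close>

definition normalized_haar_measure ::
  "('g, 'b) monoid_scheme \<Rightarrow> 'g topology \<Rightarrow> 'g set \<Rightarrow> 'g measure \<Rightarrow> bool" where
  "normalized_haar_measure G \<tau>\<^sub>G K m \<longleftrightarrow>
     prob_space m \<and> space m = K \<and> sets m = sets (borel_of (subtopology \<tau>\<^sub>G K)) \<and>
     (\<forall>k\<in>K. \<forall>A\<in>sets m. emeasure m (k <#\<^bsub>G\<^esub> A) = emeasure m A)"

text \<open>\<open>U\<close> ranges over open neighbourhoods of the identity, so that \<open>A n <#> U\<close> is open and hence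
  its trace on \<open>K n\<close> is measurable.\<close>

definition levy_group :: "('g, 'b) monoid_scheme \<Rightarrow> 'g topology \<Rightarrow> bool" where
  "levy_group G \<tau>\<^sub>G \<longleftrightarrow>
     polish_group G \<tau>\<^sub>G \<and>
     (\<exists>(K :: nat \<Rightarrow> 'g set) (m :: nat \<Rightarrow> 'g measure).
        (\<forall>n. subgroup (K n) G \<and> compactin \<tau>\<^sub>G (K n)) \<and> incseq K \<and>
        \<tau>\<^sub>G closure_of (\<Union>n. K n) = topspace \<tau>\<^sub>G \<and>
        (\<forall>n. normalized_haar_measure G \<tau>\<^sub>G (K n) (m n)) \<and>
        (\<forall>U A. openin \<tau>\<^sub>G U \<and> \<one>\<^bsub>G\<^esub> \<in> U \<and> (\<forall>n. A n \<in> sets (m n)) \<and>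
               liminf (\<lambda>n. emeasure (m n) (A n)) > 0 \<longrightarrow>
               (\<lambda>n. emeasure (m n) (K n \<inter> (A n <#>\<^bsub>G\<^esub> U))) \<longlonglongrightarrow> 1))"


subsection \<open>Existence of nontrivial actions\<close>

text \<open>HOL cannot quantify existentially over the underlying type of the space, so it is a type
  parameter in the following predicates. Since \<^const>\<open>standard_borel_space\<close> refers to an arbitrary
  Polish topology on an arbitrary carrier set, and Polish spaces have at most the cardinality of
  the continuum, any action can be transported along an injection to one on a space whose
  points are reals. Hence the carrier type \<^typ>\<open>real\<close> is fully general.\<close>

definition admits_nontrivial_probability_preserving_action ::
  "'x itself \<Rightarrow> ('g, 'b) monoid_scheme \<Rightarrow> 'g topology \<Rightarrow> bool" where
  "admits_nontrivial_probability_preserving_action _ G \<tau>\<^sub>G \<longleftrightarrow>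
     (\<exists>(M :: 'x measure) T.
        probability_preserving_spatial_action G \<tau>\<^sub>G M T \<and> \<not> trivial_action G M T)"

definition admits_nontrivial_lf_polish_action ::
  "'x itself \<Rightarrow> ('g, 'b) monoid_scheme \<Rightarrow> 'g topology \<Rightarrow> bool" where
  "admits_nontrivial_lf_polish_action _ G \<tau>\<^sub>G \<longleftrightarrow>
     (\<exists>(M :: 'x measure) \<tau> T.
        locally_finite_polish_action G \<tau>\<^sub>G M \<tau> T \<and> \<not> trivial_action G M T)"

definition admits_nontrivial_lf_polish_nonsingular_action_continuous_rn ::
  "'x itself \<Rightarrow> ('g, 'b) monoid_scheme \<Rightarrow> 'g topology \<Rightarrow> bool" where
  "admits_nontrivial_lf_polish_nonsingular_action_continuous_rn _ G \<tau>\<^sub>G \<longleftrightarrow>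
     (\<exists>(M :: 'x measure) \<tau> T.
        locally_finite_polish_nonsingular_action G \<tau>\<^sub>G M \<tau> T \<and>
        continuous_rn_cocycle G M \<tau> T \<and> \<not> trivial_action G M T)"

end

theory Submission
  imports Defs
begin

text \<open>
  A measure preserving action is a nonsingular one with Radon--Nikodym cocycle \<open>1\<close>, so only the
  nonsingular case needs an argument. Three steps lead from a nontrivial locally finite
  Polish nonsingular action of \<open>G\<close> on \<open>(X, \<mu>)\<close> with continuous cocycle to the conclusions.

  The first is the Maharam extension. On the closed support \<open>S\<close> of \<open>\<mu>\<close> the continuous density \<open>D g\<close> of
  \<open>\<mu> \<circ> T g\<close> with respect to \<open>\<mu>\<close> is unique, hence an exact cocycle. It is assumed to be continuous
  in \<open>x\<close> for each \<open>g\<close> only, but a Baire category argument in \<open>G\<close> shows that it is jointly continuous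
  (\<open>D_jointly_continuous\<close>): the sets \<open>{g. \<forall>x\<in>W \<inter> S. D g x \<le> q}\<close> are closed because
  \<open>g \<mapsto> \<mu>(g W)\<close> is lower semicontinuous for open \<open>W\<close>, so \<open>D\<close> is nearly constant on some product of
  nonempty open sets, and the cocycle identity carries this to the identity of \<open>G\<close>. Therefore
  \<open>(x, t) \<mapsto> (T g x, t / D g x)\<close> is a jointly continuous action on \<open>S \<times> {0<..}\<close> that preserves
  \<open>\<nu> = \<mu> \<times> Lebesgue\<close>. This measure is infinite and locally finite, has full support and
  has no point masses (\<open>maharam_extension\<close>).

  The second is a random closed set. Let \<open>P\<close> be the law of the closure \<open>F\<close> of a Poisson process with intensity
  \<open>\<nu>\<close>, a probability on the closed subsets of \<open>Y = S \<times> {0<..}\<close>. It is determined by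
  \<open>P(F \<inter> U = {}) = exp (- \<nu> U)\<close> for \<open>U\<close> open, so it inherits the invariance of \<open>\<nu>\<close>. Passing to
  closures is what makes the action pointwise: \<open>F \<mapsto> T g ` F\<close> is defined for every closed set, it
  is Borel in \<open>(g, F)\<close>, and the space of closed sets is standard Borel, so no invariant set of
  configurations has to be selected. If \<open>T g y \<noteq> y\<close>, a small neighbourhood \<open>C\<close> of \<open>y\<close> is disjoint
  from its preimage under \<open>T g\<close>, and with positive probability \<open>F\<close> hits \<open>C\<close> and misses that preimage;
  such an \<open>F\<close> is moved. As closed sets inject into the reals, this gives the required action
  (\<open>admits_probability_preserving_action\<close>).

  The third is an argument by concentration of measure. Suppose that an action on a probability space \<open>(Z, P)\<close> is given and that \<open>A\<close> and
  \<open>B\<close> are separated, that is, no element of some neighbourhood of the identity carries a point of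
  \<open>A\<close> into \<open>B\<close>. For a point \<open>z\<close>, concentration on the compact subgroups \<open>K n\<close> of a Levy group forbids
  that \<open>inv k\<close> carries \<open>z\<close> into \<open>A\<close> for a substantial proportion of the \<open>k \<in> K n\<close> and into \<open>B\<close> for
  another substantial proportion.
  Averaging over \<open>z\<close> and using that Haar measure is also right invariant, one finds that
  \<open>A\<close> is almost surely not carried into \<open>B\<close> by any fixed element of any \<open>K n\<close>
  (\<open>concentration_prevents_separation\<close>). For the Poisson
  closed set and \<open>A = {F hits W}\<close>, \<open>B = {F misses C}\<close>, with \<open>W\<close> a small neighbourhood of a moved point
  inside \<open>C\<close>, the formula for \<open>P\<close> contradicts this (\<open>levy_group_acts_trivially\<close>). The argument runs on
  closed sets rather than on \<open>Y\<close> because it needs a finite invariant measure.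
\<close>

section \<open>Polish spaces and their Borel sets\<close>

text \<open>A base of a second countable topology, enumerated with possible repetitions and possibly including the
  empty set, so that the enumeration can always be indexed by all natural numbers.\<close>

definition countable_base :: "'a topology \<Rightarrow> (nat \<Rightarrow> 'a set) \<Rightarrow> bool" where
  "countable_base \<tau> B \<longleftrightarrow>
     (\<forall>n. openin \<tau> (B n)) \<and> (\<forall>U x. openin \<tau> U \<and> x \<in> U \<longrightarrow> (\<exists>n. x \<in> B n \<and> B n \<subseteq> U))"

lemma countable_base_openin: "countable_base \<tau> B \<Longrightarrow> openin \<tau> (B n)"
  by (simp add: countable_base_def)

lemma countable_baseE:
  assumes "countable_base \<tau> B" "openin \<tau> U" "x \<in> U"
  obtains n where "x \<in> B n" "B n \<subseteq> U"
  using assms unfolding countable_base_def by meson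

lemma countable_base_Union:
  assumes "countable_base \<tau> B" "openin \<tau> U"
  shows "U = (\<Union>n\<in>{n. B n \<subseteq> U}. B n)"
  using assms by (auto simp: countable_base_def) blast

lemma second_countableI:
  assumes "countable \<B>" "\<And>V. V \<in> \<B> \<Longrightarrow> openin \<tau> V"
    "\<And>U x. openin \<tau> U \<Longrightarrow> x \<in> U \<Longrightarrow> \<exists>V\<in>\<B>. x \<in> V \<and> V \<subseteq> U"
  shows "second_countable \<tau>"
  using assms unfolding second_countable_def by (intro exI[of _ \<B>]) simp

lemma second_countable_imp_countable_base:
  assumes "second_countable \<tau>"
  obtains B where "countable_base \<tau> B"
proof -
  obtain \<B> where \<B>: "countable \<B>" "\<And>V. V \<in> \<B> \<Longrightarrow> openin \<tau> V"
    "\<And>U x. openin \<tau> U \<Longrightarrow> x \<in> U \<Longrightarrow> \<exists>V \<in> \<B>. x \<in> V \<and> V \<subseteq> U"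
    using assms unfolding second_countable_def by metis
  define B where "B = from_nat_into (insert {} \<B>)"
  have r: "range B = insert {} \<B>"
    unfolding B_def using \<B>(1) by (intro range_from_nat_into) auto
  have "countable_base \<tau> B"
    unfolding countable_base_def
  proof (intro conjI allI impI)
    fix n show "openin \<tau> (B n)"
      using r \<B>(2) openin_empty by (metis insertE rangeI)
  next
    fix U x assume "openin \<tau> U \<and> x \<in> U"
    then obtain V where "V \<in> \<B>" "x \<in> V" "V \<subseteq> U" using \<B>(3) by blast
    moreover then obtain n where "V = B n" using r by (metis imageE insertI2)
    ultimately show "\<exists>n. x \<in> B n \<and> B n \<subseteq> U" by blast
  qed
  then show ?thesis using that by blast
qed

lemma polish_topology_second_countable:
  assumes "polish_topology \<tau>"
  shows "second_countable \<tau>"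
proof -
  obtain M d where Md: "Metric_space M d" "\<tau> = Metric_space.mtopology M d"
    using assms unfolding polish_topology_def completely_metrizable_space_def by blast
  interpret Metric_space M d by fact
  obtain C where C: "countable C" "C \<subseteq> M" "mtopology closure_of C = M"
    using assms unfolding polish_topology_def separable_space_def Md(2) by auto
  let ?\<B> = "(\<lambda>(c, n::nat). mball c (inverse (Suc n))) ` (C \<times> UNIV)"
  have "\<exists>V\<in>?\<B>. x \<in> V \<and> V \<subseteq> U" if U: "openin mtopology U" "x \<in> U" for U x
  proof -
    have "U \<subseteq> M" using U(1) openin_mtopology by blast
    then have x: "x \<in> M" using U by auto
    obtain r where r: "r > 0" "mball x r \<subseteq> U" using U openin_mtopology by blast
    obtain n where n: "inverse (real (Suc n)) < r / 2"
      using reals_Archimedean[of "r/2"] r by auto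
    have "x \<in> mtopology closure_of C" using C x by simp
    then obtain c where c: "c \<in> C" "c \<in> mball x (inverse (Suc n))"
    proof -
      have "0 < inverse (real (Suc n))" by simp
      with \<open>x \<in> mtopology closure_of C\<close> show ?thesis
        unfolding metric_closure_of using that by blast
    qed
    have "mball c (inverse (Suc n)) \<subseteq> mball x r"
      using c n x C(2) by (intro mball_subset) (auto simp: commute)
    moreover have "x \<in> mball c (inverse (Suc n))" using c x C(2) by (auto simp: commute)
    ultimately show ?thesis using c(1) r(2) by auto
  qed
  moreover have "countable ?\<B>" using C(1) by auto
  moreover have "openin mtopology V" if "V \<in> ?\<B>" for V using that by auto
  ultimately show ?thesis unfolding Md(2) by (intro second_countableI[of ?\<B>])
qed

lemma polish_topology_iff:
  "polish_topology \<tau> \<longleftrightarrow> completely_metrizable_space \<tau> \<and> second_countable \<tau>"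
  using polish_topology_second_countable second_countable_imp_separable_space
  unfolding polish_topology_def by blast

lemma polish_countable_base:
  assumes "polish_topology \<tau>" obtains B where "countable_base \<tau> B"
  using assms polish_topology_second_countable second_countable_imp_countable_base by blast

lemma polish_topology_Hausdorff: "polish_topology \<tau> \<Longrightarrow> Hausdorff_space \<tau>"
  unfolding polish_topology_def
  using completely_metrizable_imp_metrizable_space metrizable_imp_Hausdorff_space by blast

lemma polish_topology_regular: "polish_topology \<tau> \<Longrightarrow> regular_space \<tau>"
  unfolding polish_topology_def
  using completely_metrizable_imp_metrizable_space metrizable_imp_regular_space by blast

lemma homeomorphic_polish_topology:
  "\<sigma> homeomorphic_space \<tau> \<Longrightarrow> polish_topology \<sigma> \<Longrightarrow> polish_topology \<tau>"
  unfolding polish_topology_def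
  using homeomorphic_completely_metrizable_space homeomorphic_separable_space by blast

lemma second_countable_prod_topology:
  assumes "second_countable \<sigma>" "second_countable \<tau>"
  shows "second_countable (prod_topology \<sigma> \<tau>)"
proof -
  obtain \<A> where A: "countable \<A>" "\<And>V. V \<in> \<A> \<Longrightarrow> openin \<sigma> V"
    "\<And>U x. openin \<sigma> U \<Longrightarrow> x \<in> U \<Longrightarrow> \<exists>V \<in> \<A>. x \<in> V \<and> V \<subseteq> U"
    using assms(1) unfolding second_countable_def by metis
  obtain \<B> where B: "countable \<B>" "\<And>V. V \<in> \<B> \<Longrightarrow> openin \<tau> V"
    "\<And>U x. openin \<tau> U \<Longrightarrow> x \<in> U \<Longrightarrow> \<exists>V \<in> \<B>. x \<in> V \<and> V \<subseteq> U"
    using assms(2) unfolding second_countable_def by metis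
  let ?C = "(\<lambda>(U, V). U \<times> V) ` (\<A> \<times> \<B>)"
  have "\<exists>V\<in>?C. z \<in> V \<and> V \<subseteq> W" if W: "openin (prod_topology \<sigma> \<tau>) W" "z \<in> W" for W z
  proof -
    obtain x y where z: "z = (x, y)" by (cases z)
    obtain U V where UV: "openin \<sigma> U" "openin \<tau> V" "x \<in> U" "y \<in> V" "U \<times> V \<subseteq> W"
      using W unfolding z openin_prod_topology_alt by meson
    obtain U' V' where "U' \<in> \<A>" "x \<in> U'" "U' \<subseteq> U" "V' \<in> \<B>" "y \<in> V'" "V' \<subseteq> V"
      using A(3)[OF UV(1,3)] B(3)[OF UV(2,4)] by blast
    then have "U' \<times> V' \<in> ?C" "z \<in> U' \<times> V'" "U' \<times> V' \<subseteq> W" using UV(5) z by auto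
    then show ?thesis by blast
  qed
  moreover have "countable ?C" using A(1) B(1) by auto
  moreover have "openin (prod_topology \<sigma> \<tau>) V" if "V \<in> ?C" for V
    using that A(2) B(2) by (auto simp: openin_prod_Times_iff)
  ultimately show ?thesis by (intro second_countableI[of ?C])
qed

lemma polish_topology_prod:
  "polish_topology \<sigma> \<Longrightarrow> polish_topology \<tau> \<Longrightarrow> polish_topology (prod_topology \<sigma> \<tau>)"
  by (simp add: polish_topology_iff completely_metrizable_space_prod_topology
      second_countable_prod_topology)

lemma polish_topology_subtopology_gdelta:
  "polish_topology \<sigma> \<Longrightarrow> gdelta_in \<sigma> S \<Longrightarrow> polish_topology (subtopology \<sigma> S)"
  by (simp add: polish_topology_iff completely_metrizable_space_gdelta_in
      second_countable_subtopology)

lemma polish_topology_subtopology_closed: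
  "polish_topology \<sigma> \<Longrightarrow> closedin \<sigma> S \<Longrightarrow> polish_topology (subtopology \<sigma> S)"
  by (simp add: polish_topology_iff completely_metrizable_space_closedin
      second_countable_subtopology)

lemma polish_topology_subtopology_open:
  "polish_topology \<sigma> \<Longrightarrow> openin \<sigma> S \<Longrightarrow> polish_topology (subtopology \<sigma> S)"
  by (simp add: polish_topology_iff completely_metrizable_space_openin
      second_countable_subtopology)

lemma polish_topology_euclidean:
  "polish_topology (euclidean :: 'a::polish_space topology)"
proof -
  obtain \<B> :: "'a set set" where B: "countable \<B>" "topological_basis \<B>"
    using ex_countable_basis by blast
  have "second_countable (euclidean :: 'a topology)"
  proof (rule second_countableI[OF B(1)])
    show "openin euclidean V" if "V \<in> \<B>" for V
      using that B(2) by (simp add: topological_basis_open)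
    show "\<exists>V\<in>\<B>. x \<in> V \<and> V \<subseteq> U" if "openin euclidean U" "x \<in> U" for U x
    proof -
      have "open U" using that(1) by simp
      from B(2) this that(2) obtain V where "V \<in> \<B>" "x \<in> V" "V \<subseteq> U"
        by (rule topological_basisE)
      then show ?thesis by blast
    qed
  qed
  then show ?thesis
    by (simp add: polish_topology_iff completely_metrizable_space_euclidean)
qed

lemma space_borel_of [simp]: "space (borel_of \<tau>) = topspace \<tau>"
  unfolding borel_of_def by (auto simp: space_measure_of_conv)

lemma sets_borel_of: "sets (borel_of \<tau>) = sigma_sets (topspace \<tau>) {U. openin \<tau> U}"
  unfolding borel_of_def by (intro sets_measure_of) (auto dest: openin_subset)

lemma borel_of_openin [intro]: "openin \<tau> U \<Longrightarrow> U \<in> sets (borel_of \<tau>)"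
  by (auto simp: sets_borel_of)

lemma sets_borel_of_euclidean: "sets (borel_of euclidean) = sets borel"
  by (simp add: sets_borel_of borel_def)

lemma measurable_borel_of_continuous:
  assumes "continuous_map \<sigma> \<tau> f"
  shows "f \<in> borel_of \<sigma> \<rightarrow>\<^sub>M borel_of \<tau>"
  unfolding borel_of_def[of \<tau>]
proof (rule measurable_measure_of)
  show "f \<in> space (borel_of \<sigma>) \<rightarrow> topspace \<tau>"
    using assms by (auto simp: continuous_map_def)
  fix U assume "U \<in> {U. openin \<tau> U}"
  then have "openin \<sigma> (f -` U \<inter> topspace \<sigma>)"
    using openin_continuous_map_preimage[OF assms, of U] by (simp add: vimage_def Int_def conj_commute)
  then show "f -` U \<inter> space (borel_of \<sigma>) \<in> sets (borel_of \<sigma>)" by auto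
qed (auto dest: openin_subset)

text \<open>Rectangles of basic open sets suffice, and there are countably many of them. This is where second
  countability enters the comparison of Borel sets of a product with the product of the Borel sets.\<close>

lemma openin_prod_in_sets_pair:
  assumes "second_countable \<sigma>" "second_countable \<tau>" and W: "openin (prod_topology \<sigma> \<tau>) W"
  shows "W \<in> sets (borel_of \<sigma> \<Otimes>\<^sub>M borel_of \<tau>)"
proof -
  obtain A where A: "countable_base \<sigma> A" using assms(1) by (rule second_countable_imp_countable_base)
  obtain B where B: "countable_base \<tau> B" using assms(2) by (rule second_countable_imp_countable_base)
  let ?I = "{(i, j). A i \<times> B j \<subseteq> W}"
  have "W = (\<Union>(i, j)\<in>?I. A i \<times> B j)"
  proof (intro equalityI subsetI)
    fix p assume "p \<in> W"
    obtain x y where p: "p = (x, y)" by (cases p)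
    obtain V V' where V: "openin \<sigma> V" "openin \<tau> V'" "x \<in> V" "y \<in> V'" "V \<times> V' \<subseteq> W"
      using W \<open>p \<in> W\<close> unfolding p openin_prod_topology_alt by meson
    obtain i where i: "x \<in> A i" "A i \<subseteq> V" using A V(1,3) by (rule countable_baseE)
    obtain j where j: "y \<in> B j" "B j \<subseteq> V'" using B V(2,4) by (rule countable_baseE)
    have "A i \<times> B j \<subseteq> W" using Sigma_mono[OF i(2)] j(2) V(5) by (meson order_trans)
    then show "p \<in> (\<Union>(i, j)\<in>?I. A i \<times> B j)" using i j p by auto
  qed auto
  also have "\<dots> \<in> sets (borel_of \<sigma> \<Otimes>\<^sub>M borel_of \<tau>)"
  proof (rule sets.countable_UN'')
    fix q assume "q \<in> ?I"
    have "A i \<times> B j \<in> sets (borel_of \<sigma> \<Otimes>\<^sub>M borel_of \<tau>)" for i j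
      using countable_base_openin[OF A] countable_base_openin[OF B] by (intro pair_measureI) auto
    then show "(case q of (i, j) \<Rightarrow> A i \<times> B j) \<in> sets (borel_of \<sigma> \<Otimes>\<^sub>M borel_of \<tau>)" by (cases q) simp
  qed simp
  finally show ?thesis .
qed

lemma measurable_pair_continuous:
  assumes "second_countable \<sigma>" "second_countable \<tau>"
    and f: "continuous_map (prod_topology \<sigma> \<tau>) \<rho> f"
  shows "f \<in> borel_of \<sigma> \<Otimes>\<^sub>M borel_of \<tau> \<rightarrow>\<^sub>M borel_of \<rho>"
  unfolding borel_of_def[of \<rho>]
proof (rule measurable_measure_of)
  show "f \<in> space (borel_of \<sigma> \<Otimes>\<^sub>M borel_of \<tau>) \<rightarrow> topspace \<rho>"
    using continuous_map_image_subset_topspace[OF f] by (auto simp: space_pair_measure)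
  fix U assume "U \<in> {U. openin \<rho> U}"
  then have "openin (prod_topology \<sigma> \<tau>) {p \<in> topspace (prod_topology \<sigma> \<tau>). f p \<in> U}"
    using openin_continuous_map_preimage[OF f] by simp
  from openin_prod_in_sets_pair[OF assms(1,2) this]
  show "f -` U \<inter> space (borel_of \<sigma> \<Otimes>\<^sub>M borel_of \<tau>) \<in> sets (borel_of \<sigma> \<Otimes>\<^sub>M borel_of \<tau>)"
    by (simp add: space_pair_measure vimage_def Int_def conj_commute)
qed (auto dest: openin_subset)

abbreviation cantor_space :: "(nat \<Rightarrow> bool) topology" where
  "cantor_space \<equiv> product_topology (\<lambda>_. discrete_topology UNIV) UNIV"

lemma topspace_cantor [simp]: "topspace cantor_space = UNIV"
  by simp

definition cylinder :: "bool list \<Rightarrow> (nat \<Rightarrow> bool) set" where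
  "cylinder l = {H. \<forall>i<length l. H i = l ! i}"

lemma openin_cantor_coordinate: "openin cantor_space {H. Q (H n)}"
proof -
  have "continuous_map cantor_space (discrete_topology UNIV) (\<lambda>H. H n)"
    by (rule continuous_map_product_projection) simp
  from openin_continuous_map_preimage[OF this, of "Collect Q"] show ?thesis by simp
qed

lemma openin_cantor_cylinder: "openin cantor_space (cylinder l)"
proof -
  have op: "openin cantor_space {H. H i = l ! i}" for i
    using openin_cantor_coordinate[of "\<lambda>b. b = l ! i" i] .
  show ?thesis
  proof (cases "l = []")
    case True
    then have "cylinder l = topspace cantor_space" by (simp add: cylinder_def)
    then show ?thesis by (metis openin_topspace)
  next
    case False
    then have "openin cantor_space (\<Inter>((\<lambda>i. {H. H i = l ! i}) ` {..<length l}))"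
      using op by (intro openin_Inter) auto
    moreover have "cylinder l = (\<Inter>((\<lambda>i. {H. H i = l ! i}) ` {..<length l}))"
      by (auto simp: cylinder_def)
    ultimately show ?thesis by simp
  qed
qed

lemma cantor_cylinder_base:
  assumes W: "openin cantor_space W" "x \<in> W"
  shows "\<exists>l. x \<in> cylinder l \<and> cylinder l \<subseteq> W"
proof -
  have "\<exists>U. finite {i \<in> UNIV. U i \<noteq> topspace (discrete_topology (UNIV::bool set))} \<and>
           (\<forall>i\<in>UNIV. openin (discrete_topology UNIV) (U i)) \<and> x \<in> Pi\<^sub>E UNIV U \<and> Pi\<^sub>E UNIV U \<subseteq> W"
    using W unfolding openin_product_topology_alt by blast
  then obtain U where U: "finite {i. U i \<noteq> (UNIV::bool set)}" "x \<in> Pi\<^sub>E UNIV U" "Pi\<^sub>E UNIV U \<subseteq> W"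
    by auto
  obtain k where k: "{i. U i \<noteq> (UNIV::bool set)} \<subseteq> {..<k}"
    using U(1) finite_nat_iff_bounded by blast
  have "cylinder (map x [0..<k]) \<subseteq> Pi\<^sub>E UNIV U"
  proof
    fix H assume H: "H \<in> cylinder (map x [0..<k])"
    have "H i \<in> U i" for i
    proof (cases "i < k")
      case True
      then have "H i = x i" using H by (simp add: cylinder_def)
      then show ?thesis using U(2) by (simp add: PiE_iff)
    next
      case False
      then have "U i = UNIV" using k by auto
      then show ?thesis by simp
    qed
    then show "H \<in> Pi\<^sub>E UNIV U" by (simp add: PiE_iff)
  qed
  moreover have "x \<in> cylinder (map x [0..<k])" by (simp add: cylinder_def)
  ultimately show ?thesis using U(3) by (intro exI[of _ "map x [0..<k]"]) auto
qed

lemma polish_topology_cantor: "polish_topology cantor_space"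
proof -
  have "completely_metrizable_space cantor_space"
    by (simp add: completely_metrizable_space_product_topology completely_metrizable_space_discrete_topology)
  moreover have "second_countable cantor_space"
  proof (rule second_countableI[of "range cylinder"])
    show "openin cantor_space V" if "V \<in> range cylinder" for V
      using that openin_cantor_cylinder by auto
    show "\<exists>V\<in>range cylinder. x \<in> V \<and> V \<subseteq> U" if "openin cantor_space U" "x \<in> U" for U x
      using cantor_cylinder_base[OF that] by auto
  qed auto
  ultimately show ?thesis by (simp add: polish_topology_iff)
qed

text \<open>The tool for moving a Polish topology to a set that is coded injectively in a known space.\<close>

lemma pullback_topology_homeomorphic:
  assumes inj: "inj_on f A" and sub: "f ` A \<subseteq> topspace T"
  shows "pullback_topology A f T homeomorphic_space subtopology T (f ` A)"
proof -
  have "homeomorphic_map (pullback_topology A f T) (subtopology T (f ` A)) f"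
  proof (rule bijective_open_imp_homeomorphic_map)
    have ts: "topspace (pullback_topology A f T) = A"
      using sub by (auto simp: topspace_pullback_topology)
    show "continuous_map (pullback_topology A f T) (subtopology T (f ` A)) f"
      unfolding continuous_map_alt
    proof (intro conjI allI impI)
      fix U assume "openin (subtopology T (f ` A)) U"
      then obtain V where "openin T V" "U = V \<inter> f ` A" unfolding openin_subtopology by blast
      moreover from this have "f -` U \<inter> A = f -` V \<inter> A" by auto
      ultimately show "openin (pullback_topology A f T) (f -` U \<inter> topspace (pullback_topology A f T))"
        unfolding ts openin_pullback_topology by blast
    qed (use sub ts in auto)
    show "open_map (pullback_topology A f T) (subtopology T (f ` A)) f"
      unfolding open_map_def openin_pullback_topology openin_subtopology by blast
    show "f ` topspace (pullback_topology A f T) = topspace (subtopology T (f ` A))"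
      using sub by (auto simp: ts)
    show "inj_on f (topspace (pullback_topology A f T))" using inj ts by simp
  qed
  then show ?thesis by (rule homeomorphic_map_imp_homeomorphic_space)
qed

section \<open>The Effros Borel space of closed sets\<close>

definition hits :: "'y topology \<Rightarrow> 'y set \<Rightarrow> 'y set set" where
  "hits \<tau> U = {F. closedin \<tau> F \<and> F \<inter> U \<noteq> {}}"

text \<open>These sets generate the Borel structure on closed sets. They are stable under intersection, because
  missing \<open>U\<close> and missing \<open>V\<close> is missing \<open>U \<union> V\<close>, so a law on closed sets is determined by its values
  on them.\<close>

definition misses :: "'y topology \<Rightarrow> 'y set \<Rightarrow> 'y set set" where
  "misses \<tau> U = {F. closedin \<tau> F \<and> F \<inter> U = {}}"

definition effros :: "'y topology \<Rightarrow> 'y set measure" where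
  "effros \<tau> = sigma {F. closedin \<tau> F} {misses \<tau> U |U. openin \<tau> U}"

lemma space_effros [simp]: "space (effros \<tau>) = {F. closedin \<tau> F}"
  by (auto simp: effros_def space_measure_of_conv)

lemma sets_effros: "sets (effros \<tau>) = sigma_sets {F. closedin \<tau> F} {misses \<tau> U |U. openin \<tau> U}"
  unfolding effros_def by (intro sets_measure_of) (auto simp: misses_def)

lemma sets_effros_misses [intro]: "openin \<tau> U \<Longrightarrow> misses \<tau> U \<in> sets (effros \<tau>)"
  by (auto simp: sets_effros)

lemma hits_eq: "hits \<tau> U = {F. closedin \<tau> F} - misses \<tau> U"
  by (auto simp: hits_def misses_def)

lemma sets_effros_hits [intro]: "openin \<tau> U \<Longrightarrow> hits \<tau> U \<in> sets (effros \<tau>)"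
  by (metis hits_eq sets.compl_sets sets_effros_misses space_effros)

definition trace_code :: "(nat \<Rightarrow> 'y set) \<Rightarrow> 'y set \<Rightarrow> nat \<Rightarrow> bool" where
  "trace_code B F n \<longleftrightarrow> F \<inter> B n \<noteq> {}"

lemma closed_eq_trace_code:
  assumes B: "countable_base \<tau> B" and F: "closedin \<tau> F"
  shows "F = {x \<in> topspace \<tau>. \<forall>n. x \<in> B n \<longrightarrow> trace_code B F n}"
proof (intro equalityI subsetI)
  fix x assume "x \<in> F"
  then show "x \<in> {x \<in> topspace \<tau>. \<forall>n. x \<in> B n \<longrightarrow> trace_code B F n}"
    using closedin_subset[OF F] by (auto simp: trace_code_def)
next
  fix x assume x: "x \<in> {x \<in> topspace \<tau>. \<forall>n. x \<in> B n \<longrightarrow> trace_code B F n}"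
  show "x \<in> F"
  proof (rule ccontr)
    assume "x \<notin> F"
    then have "openin \<tau> (topspace \<tau> - F)" "x \<in> topspace \<tau> - F" using F x by auto
    then obtain n where "x \<in> B n" "B n \<subseteq> topspace \<tau> - F" using B by (auto elim: countable_baseE)
    then show False using x by (auto simp: trace_code_def)
  qed
qed

lemma inj_on_trace_code:
  assumes "countable_base \<tau> B" shows "inj_on (trace_code B) {F. closedin \<tau> F}"
proof (rule inj_onI)
  fix F F' assume "F \<in> {F. closedin \<tau> F}" "F' \<in> {F. closedin \<tau> F}" "trace_code B F = trace_code B F'"
  then show "F = F'"
    using closed_eq_trace_code[OF assms, of F] closed_eq_trace_code[OF assms, of F'] by simp
qed

text \<open>A set \<open>H\<close> of indices codes a closed set iff it is closed under passing to larger basic sets and every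
  \<open>B n\<close> with \<open>n \<in> H\<close> contains the closure of a nonempty \<open>B m\<close> with \<open>m \<in> H\<close> of arbitrarily small diameter.
  Necessity is regularity of the space. For sufficiency, iterating the second condition gives a nested
  sequence that by completeness shrinks to a point of \<open>B n\<close> all of whose basic neighbourhoods are in \<open>H\<close>.
  Both conditions are countable intersections of open conditions on \<open>H\<close>.\<close>

lemma gdelta_trace_codes:
  assumes \<tau>: "polish_topology \<tau>" and B: "countable_base \<tau> B"
  shows "gdelta_in cantor_space (trace_code B ` {F. closedin \<tau> F})"
proof -
  obtain M d where Md: "Metric_space M d" "Metric_space.mcomplete M d" "\<tau> = Metric_space.mtopology M d"
    using \<tau> unfolding polish_topology_def completely_metrizable_space_def by blast
  interpret Metric_space M d by fact
  note [simp] = Md(3)[symmetric]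
  have ts: "topspace \<tau> = M" by (metis Md(3) topspace_mtopology)
  \<comment> \<open>Nonemptiness is part of the condition: an index of the empty set would otherwise refine itself.\<close>
  define good where "good n k m \<longleftrightarrow> B m \<noteq> {} \<and> \<tau> closure_of B m \<subseteq> B n \<and>
      (\<exists>a\<in>M. B m \<subseteq> mball a (inverse (Suc k)))" for n m k :: nat
  \<comment> \<open>The two conditions on \<open>H\<close>, indexed so that each instance is an open set of codes.\<close>
  define A1 where "A1 = (\<lambda>(n, m). if B n \<subseteq> B m then {H. \<not> H n \<or> H m} else (UNIV :: (nat \<Rightarrow> bool) set))"
  define A2 where "A2 = (\<lambda>(n, k). {H. \<not> H n \<or> (\<exists>m. good n k m \<and> H m)})"
  have opI: "openin cantor_space {H. \<not> H n \<or> Q H}" if "openin cantor_space {H. Q H}" for n Q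
  proof -
    have "{H. \<not> H n \<or> Q H} = {H. \<not> H n} \<union> {H. Q H}" by auto
    then show ?thesis using that openin_cantor_coordinate[of Not n] by auto
  qed
  have "openin cantor_space (A1 p)" for p
  proof -
    have "openin cantor_space {H. \<not> H n \<or> H m}" for n m
      using opI[OF openin_cantor_coordinate[of "\<lambda>b. b" m]] .
    moreover have "openin cantor_space UNIV" using openin_topspace[of cantor_space] by (simp only: topspace_cantor)
    ultimately show ?thesis unfolding A1_def by (cases p) (simp only: prod.case split: if_split, blast)
  qed
  moreover have "openin cantor_space (A2 p)" for p
  proof -
    have op: "openin cantor_space {H. \<exists>m. good n k m \<and> H m}" for n k
    proof -
      have "{H. \<exists>m. good n k m \<and> H m} = (\<Union>m\<in>{m. good n k m}. {H. H m})" by auto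
      moreover have "openin cantor_space (\<Union>m\<in>{m. good n k m}. {H. H m})"
      proof (rule openin_Union)
        fix S assume "S \<in> (\<lambda>m. {H. H m}) ` {m. good n k m}"
        then obtain m where "S = {H. H m}" by blast
        then show "openin cantor_space S" using openin_cantor_coordinate[of "\<lambda>b. b" m] by (simp only:)
      qed
      ultimately show ?thesis by (simp only:)
    qed
    have "openin cantor_space {H. \<not> H n \<or> (\<exists>m. good n k m \<and> H m)}" for n k
      by (rule opI[OF op])
    then show ?thesis unfolding A2_def by (cases p) (simp only: prod.case)
  qed
  ultimately have gd: "gdelta_in cantor_space (\<Inter>(range A1 \<union> range A2))"
    by (intro gdelta_in_Inter) (auto intro: open_imp_gdelta_in)
  have "trace_code B ` {F. closedin \<tau> F} = \<Inter>(range A1 \<union> range A2)"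
  proof (intro equalityI subsetI)
    fix H assume "H \<in> trace_code B ` {F. closedin \<tau> F}"
    then obtain F where F: "closedin \<tau> F" "H = trace_code B F" by auto
    have "H \<in> A1 p" for p by (cases p) (auto simp: A1_def F(2) trace_code_def)
    moreover have "\<exists>m. good n k m \<and> H m" if n: "H n" for n k
    proof -
      obtain x where x: "x \<in> F" "x \<in> B n" using n by (auto simp: F(2) trace_code_def)
      have xM: "x \<in> M" using x(1) closedin_subset[OF F(1)] ts by auto
      let ?U = "B n \<inter> mball x (inverse (Suc k))"
      have "openin \<tau> ?U" using countable_base_openin[OF B] openin_mball unfolding Md(3) by blast
      moreover have "x \<in> ?U" using x xM by simp
      ultimately obtain V C where V: "openin \<tau> V" "closedin \<tau> C" "x \<in> V" "V \<subseteq> C" "C \<subseteq> ?U"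
        using polish_topology_regular[OF \<tau>] 
        unfolding neighbourhood_base_of_closedin[symmetric] neighbourhood_base_of by metis
      obtain m where m: "x \<in> B m" "B m \<subseteq> V" using B V(1,3) by (rule countable_baseE)
      have "\<tau> closure_of B m \<subseteq> C" using m V by (intro closure_of_minimal) auto
      then have "good n k m" unfolding good_def using V(4,5) m xM by (intro conjI bexI[of _ x]) auto
      moreover have "H m" using m(1) x(1) by (auto simp: F(2) trace_code_def)
      ultimately show ?thesis by blast
    qed
    then have "H \<in> A2 p" for p by (cases p) (simp add: A2_def)
    ultimately show "H \<in> \<Inter>(range A1 \<union> range A2)" by blast
  next
    fix H assume H: "H \<in> \<Inter>(range A1 \<union> range A2)"
    have up: "H m" if "H n" "B n \<subseteq> B m" for n m
    proof -
      have "H \<in> A1 (n, m)" using H by blast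
      then show ?thesis using that by (simp add: A1_def)
    qed
    have ex: "\<exists>m. good n k m \<and> H m" if "H n" for n k
    proof -
      have "H \<in> A2 (n, k)" using H by blast
      then show ?thesis using that by (simp add: A2_def)
    qed
    define F where "F = {x \<in> topspace \<tau>. \<forall>n. x \<in> B n \<longrightarrow> H n}"
    have "topspace \<tau> - F = (\<Union>n\<in>{n. \<not> H n}. B n)"
      using openin_subset[OF countable_base_openin[OF B]] by (auto simp: F_def)
    then have "openin \<tau> (topspace \<tau> - F)" using countable_base_openin[OF B] by auto
    then have F: "closedin \<tau> F" by (simp add: closedin_def F_def)
    have "F \<inter> B n \<noteq> {}" if "H n" for n
    proof -
      have "\<exists>f. f 0 = n \<and> (\<forall>k. H (f k)) \<and> (\<forall>k. good (f k) k (f (Suc k)))"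
      proof -
        have "\<exists>f. \<forall>k. (H (f k) \<and> (k = 0 \<longrightarrow> f k = n)) \<and> good (f k) k (f (Suc k))"
          by (rule dependent_nat_choice) (use \<open>H n\<close> ex in auto)
        then show ?thesis by blast
      qed
      then obtain f where f: "f 0 = n" "\<And>k. H (f k)" "\<And>k. good (f k) k (f (Suc k))" by blast
      \<comment> \<open>The shift makes \<open>C k\<close> lie inside \<open>B (f k)\<close>.\<close>
      define C where "C k = \<tau> closure_of B (f (Suc k))" for k
      have sub: "B (f (Suc k)) \<subseteq> C k" for k
        unfolding C_def using countable_base_openin[OF B] by (simp add: closure_of_subset openin_subset)
      have CB: "C k \<subseteq> B (f k)" for k using f(3)[of k] unfolding C_def good_def by blast
      have "\<Inter>(range C) \<noteq> {}"
      proof (rule Md(2)[unfolded mcomplete_nest, rule_format], intro conjI allI impI)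
        show "closedin mtopology (C k)" for k by (simp add: C_def)
        show "C k \<noteq> {}" for k using f(3)[of k] sub[of k] unfolding good_def by blast
        show "decseq C" using CB sub by (intro decseq_SucI) blast
        fix e :: real assume "e > 0"
        then obtain k where k: "inverse (Suc k) < e" using reals_Archimedean by blast
        obtain a where a: "a \<in> M" "B (f (Suc k)) \<subseteq> mball a (inverse (Suc k))"
          using f(3)[of k] unfolding good_def by blast
        have "C (Suc k) \<subseteq> mball a (inverse (Suc k))" using CB[of "Suc k"] a(2) by blast
        also have "\<dots> \<subseteq> mcball a e" using k by (auto simp: in_mball in_mcball)
        finally show "\<exists>n a. C n \<subseteq> mcball a e" by blast
      qed
      then obtain x where x: "\<And>k. x \<in> C k" by blast
      then have xB: "x \<in> B (f k)" for k using CB by blast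
      then have xM: "x \<in> M" using openin_subset[OF countable_base_openin[OF B]] ts by blast
      have "H i" if i: "x \<in> B i" for i
      proof -
        have "openin mtopology (B i)" using countable_base_openin[OF B] by simp
        then obtain r where r: "r > 0" "mball x r \<subseteq> B i" using i openin_mtopology by blast
        obtain k where k: "inverse (Suc k) < r / 2" using reals_Archimedean[of "r/2"] r(1) by auto
        obtain a where a: "a \<in> M" "B (f (Suc k)) \<subseteq> mball a (inverse (Suc k))"
          using f(3)[of k] unfolding good_def by blast
        have "x \<in> mball a (inverse (Suc k))" using a xB by blast
        then have "mball a (inverse (Suc k)) \<subseteq> mball x r"
          using a(1) xM k by (intro mball_subset) (auto simp: commute)
        then have "B (f (Suc k)) \<subseteq> B i" using a r by blast
        then show ?thesis using up f(2) by blast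
      qed
      then have "x \<in> F" using xM ts by (simp add: F_def)
      then show ?thesis using xB[of 0] f(1) by blast
    qed
    moreover have "H n" if "F \<inter> B n \<noteq> {}" for n using that by (auto simp: F_def)
    ultimately have "H = trace_code B F" by (auto simp: trace_code_def fun_eq_iff)
    then show "H \<in> trace_code B ` {F. closedin \<tau> F}" using F by blast
  qed
  then show ?thesis using gd by simp
qed

text \<open>The codes form a \<open>G\<^sub>\<delta>\<close> set in the Cantor space, whose topology is pulled back. Closed sets missing
  an open set correspond to codes avoiding the indices of its basic subsets, hence to a closed set of
  codes; conversely cylinders of codes are finite Boolean combinations of hitting conditions.\<close>

lemma standard_borel_space_effros:
  assumes \<tau>: "polish_topology \<tau>" and P: "space P = {F. closedin \<tau> F}" "sets P = sets (effros \<tau>)"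
  shows "standard_borel_space P"
proof -
  obtain B where B: "countable_base \<tau> B" using \<tau> by (rule polish_countable_base)
  let ?S = "{F. closedin \<tau> F}" and ?c = "trace_code B"
  define \<sigma> where "\<sigma> = pullback_topology ?S ?c cantor_space"
  have ts: "topspace \<sigma> = ?S" by (simp add: \<sigma>_def topspace_pullback_topology)
  have "polish_topology (subtopology cantor_space (?c ` ?S))"
    by (intro polish_topology_subtopology_gdelta polish_topology_cantor gdelta_trace_codes \<tau> B)
  then have pol: "polish_topology \<sigma>"
    unfolding \<sigma>_def
    using pullback_topology_homeomorphic[OF inj_on_trace_code[OF B], of cantor_space]
      homeomorphic_polish_topology homeomorphic_space_sym by (metis subset_UNIV topspace_cantor)
  have "sets (borel_of \<sigma>) = sets (effros \<tau>)"
  proof (rule antisym)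
    have co: "{F. closedin \<tau> F \<and> ?c F n} \<in> sets (effros \<tau>)" for n
    proof -
      have "{F. closedin \<tau> F \<and> ?c F n} = hits \<tau> (B n)" by (auto simp: hits_def trace_code_def)
      then show ?thesis using countable_base_openin[OF B] by auto
    qed
    have co': "{F \<in> space (effros \<tau>). ?c F n = b} \<in> sets (effros \<tau>)" for n b
    proof (cases b)
      case False
      then have "{F \<in> space (effros \<tau>). ?c F n = b} = misses \<tau> (B n)"
        by (auto simp: misses_def trace_code_def)
      then show ?thesis using countable_base_openin[OF B] by auto
    qed (use co in simp)
    have cyl: "?c -` cylinder l \<inter> ?S \<in> sets (effros \<tau>)" for l
    proof -
      have "?c -` cylinder l \<inter> ?S = {F \<in> space (effros \<tau>). \<forall>i\<in>{..<length l}. ?c F i = l ! i}"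
        by (auto simp: cylinder_def)
      also have "\<dots> \<in> sets (effros \<tau>)" using co' by (intro sets.sets_Collect_finite_All) auto
      finally show ?thesis .
    qed
    have "U \<in> sets (effros \<tau>)" if "openin \<sigma> U" for U
    proof -
      from that obtain W where W: "openin cantor_space W" "U = ?c -` W \<inter> ?S"
        unfolding \<sigma>_def openin_pullback_topology by (elim exE conjE)
      have "W \<subseteq> (\<Union>l\<in>{l. cylinder l \<subseteq> W}. cylinder l)"
        using cantor_cylinder_base[OF W(1)] by auto
      then have "W = (\<Union>l\<in>{l. cylinder l \<subseteq> W}. cylinder l)" by auto
      then have "U = ?c -` (\<Union>l\<in>{l. cylinder l \<subseteq> W}. cylinder l) \<inter> ?S" using W(2) by simp
      also have "\<dots> = (\<Union>l\<in>{l. cylinder l \<subseteq> W}. ?c -` cylinder l \<inter> ?S)"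
        by (simp add: vimage_UN)
      also have "\<dots> \<in> sets (effros \<tau>)" using cyl by (intro sets.countable_UN'') auto
      finally show ?thesis .
    qed
    then have "{U. openin \<sigma> U} \<subseteq> sets (effros \<tau>)" by blast
    from sets.sigma_sets_subset[OF this]
    show "sets (borel_of \<sigma>) \<subseteq> sets (effros \<tau>)"
      unfolding sets_borel_of ts by simp
    have "misses \<tau> U \<in> sets (borel_of \<sigma>)" if "openin \<tau> U" for U
    proof -
      let ?W = "(\<Union>n\<in>{n. B n \<subseteq> U}. {H. H n})"
      have "openin cantor_space ?W" using openin_cantor_coordinate[of "\<lambda>b. b"] by (intro openin_Union) auto
      then have "openin \<sigma> (?c -` ?W \<inter> ?S)" unfolding \<sigma>_def openin_pullback_topology by blast
      moreover have "misses \<tau> U = topspace \<sigma> - (?c -` ?W \<inter> ?S)"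
        by (subst countable_base_Union[OF B that]) (auto simp: misses_def trace_code_def ts disjoint_iff)
      ultimately show ?thesis by (metis borel_of_openin sets.compl_sets space_borel_of)
    qed
    then have "{misses \<tau> U |U. openin \<tau> U} \<subseteq> sets (borel_of \<sigma>)" by auto
    from sets.sigma_sets_subset[OF this]
    show "sets (effros \<tau>) \<subseteq> sets (borel_of \<sigma>)" unfolding sets_effros by (simp add: ts)
  qed
  then show ?thesis unfolding standard_borel_space_def using pol ts P by metis
qed

section \<open>Poisson random closed sets\<close>

text \<open>The function \<open>exp (- a)\<close> extended continuously by \<open>0\<close> at infinity, the probability that a Poisson
  process has no point in a set of measure \<open>a\<close>.\<close>

definition void_prob :: "ennreal \<Rightarrow> ennreal" where
  "void_prob a = (if a = \<infinity> then 0 else ennreal (exp (- enn2real a)))"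

lemma void_prob_tendsto:
  assumes a: "a \<longlonglongrightarrow> b" and fin: "\<And>n::nat. a n \<noteq> \<infinity>"
  shows "(\<lambda>n. void_prob (a n)) \<longlonglongrightarrow> void_prob b"
proof (cases "b = \<infinity>")
  case False
  have "(\<lambda>n. enn2real (a n)) \<longlonglongrightarrow> enn2real b"
    using a False by (intro tendsto_enn2real) (auto simp: less_top)
  then have "(\<lambda>n. ennreal (exp (- enn2real (a n)))) \<longlonglongrightarrow> ennreal (exp (- enn2real b))"
    by (intro tendsto_ennrealI tendsto_exp tendsto_minus)
  then show ?thesis using False fin by (simp add: void_prob_def)
next
  case True
  have "filterlim (\<lambda>n. enn2real (a n)) at_top sequentially"
    unfolding filterlim_at_top
  proof
    fix Z :: real
    have "eventually (\<lambda>n. ennreal Z < a n) sequentially"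
      using a True by (intro order_tendstoD) (auto simp: less_top[symmetric])
    then show "eventually (\<lambda>n. Z \<le> enn2real (a n)) sequentially"
    proof eventually_elim
      case (elim n)
      then have "ennreal Z \<le> ennreal (enn2real (a n))" using fin[of n] by (simp add: less_top)
      then show ?case by (metis enn2real_nonneg ennreal_le_iff)
    qed
  qed
  then have "filterlim (\<lambda>n. - enn2real (a n)) at_bot sequentially"
    by (simp add: filterlim_uminus_at_bot)
  then have "(\<lambda>n. exp (- enn2real (a n))) \<longlonglongrightarrow> 0"
    by (rule filterlim_compose[OF exp_at_bot])
  then have "(\<lambda>n. ennreal (exp (- enn2real (a n)))) \<longlonglongrightarrow> ennreal 0"
    by (rule tendsto_ennrealI)
  then show ?thesis using True fin by (simp add: void_prob_def)
qed

lemma void_prob_sum: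
  assumes "finite I" "\<And>i. i \<in> I \<Longrightarrow> a i \<noteq> \<infinity>"
  shows "(\<Prod>i\<in>I. void_prob (a i)) = void_prob (\<Sum>i\<in>I. a i)"
  using assms
proof (induction I)
  case (insert i I)
  have "(\<Sum>i\<in>I. a i) \<noteq> \<infinity>" using insert by (simp add: less_top[symmetric])
  then have "void_prob (a i) * void_prob (\<Sum>i\<in>I. a i) = void_prob (a i + (\<Sum>i\<in>I. a i))"
    using insert.prems[of i]
    by (simp add: void_prob_def ennreal_mult[symmetric] exp_add[symmetric] enn2real_plus less_top[symmetric] add.commute)
  then show ?case using insert by simp
qed (simp add: void_prob_def)

lemma poisson_generating_function:
  assumes "0 < l" "0 \<le> q"
  shows "(\<integral>\<^sup>+n. ennreal (q ^ n) \<partial>measure_pmf (poisson_pmf l)) = ennreal (exp (- (l * (1 - q))))"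
proof -
  have "(\<lambda>n. (l * q) ^ n /\<^sub>R fact n) sums exp (l * q)" by (rule exp_converges)
  then have "(\<lambda>n. exp (- l) * ((l * q) ^ n /\<^sub>R fact n)) sums (exp (- l) * exp (l * q))"
    by (rule sums_mult)
  moreover have "exp (- l) * exp (l * q) = exp (- (l * (1 - q)))"
    by (simp add: mult_exp_exp algebra_simps)
  moreover have "exp (- l) * ((l * q) ^ n /\<^sub>R fact n) = pmf (poisson_pmf l) n * q ^ n" for n
    using assms by (simp add: field_simps)
  ultimately have s: "(\<lambda>n. pmf (poisson_pmf l) n * q ^ n) sums exp (- (l * (1 - q)))" by simp
  have "(\<integral>\<^sup>+n. ennreal (q ^ n) \<partial>measure_pmf (poisson_pmf l)) =
      suminf (\<lambda>n. ennreal (pmf (poisson_pmf l) n * q ^ n))"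
    using assms by (simp add: nn_integral_measure_pmf nn_integral_count_space_nat ennreal_mult'
        pmf_nonneg del: pmf_poisson)
  also have "\<dots> = ennreal (exp (- (l * (1 - q))))"
    using assms by (intro suminf_ennreal_eq[OF _ s] mult_nonneg_nonneg pmf_nonneg zero_le_power)
  finally show ?thesis .
qed

text \<open>A Poisson process on a set of finite measure is an independent sequence of points with the normalised
  measure, cut off after a Poisson number of terms. If \<open>q\<close> is the probability that one point avoids \<open>B\<close>,
  then all points avoid \<open>B\<close> with the probability given by the generating function of the Poisson
  distribution at \<open>q\<close>.\<close>

lemma ex_block_process:
  assumes A: "A \<in> sets \<nu>" "emeasure \<nu> A \<noteq> \<infinity>" and ne: "space \<nu> \<noteq> {}"
  obtains Q :: "(nat \<times> (nat \<Rightarrow> 'y)) measure"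
  where "prob_space Q" "sets Q = sets (count_space UNIV \<Otimes>\<^sub>M (\<Pi>\<^sub>M j\<in>UNIV. \<nu>))"
    "\<And>B. B \<in> sets \<nu> \<Longrightarrow>
       emeasure Q {\<omega>\<in>space Q. \<forall>j<fst \<omega>. snd \<omega> j \<notin> B} = void_prob (emeasure \<nu> (A \<inter> B))"
proof -
  define l where "l = measure \<nu> A"
  have l: "emeasure \<nu> A = ennreal l" "0 \<le> l"
    using A(2) by (auto simp: l_def emeasure_eq_ennreal_measure)
  \<comment> \<open>If \<open>A\<close> is null, no points are drawn and any probability serves as the law of a single point.\<close>
  obtain \<rho> where \<rho>: "prob_space \<rho>" "sets \<rho> = sets \<nu>"
    "\<And>B. B \<in> sets \<nu> \<Longrightarrow> measure \<nu> (A \<inter> B) = l * measure \<rho> B"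
  proof (cases "l = 0")
    case True
    obtain y where y: "y \<in> space \<nu>" using ne by auto
    have "measure \<nu> (A \<inter> B) = 0" if "B \<in> sets \<nu>" for B
    proof -
      have "emeasure \<nu> (A \<inter> B) \<le> 0" using emeasure_mono[of "A \<inter> B" A \<nu>] A l True by auto
      then show ?thesis by (simp add: measure_def)
    qed
    then show ?thesis using y True by (intro that[of "return \<nu> y"] prob_space_return) auto
  next
    case False
    have "measure \<nu> (A \<inter> B) = l * measure (uniform_measure \<nu> A) B" if "B \<in> sets \<nu>" for B
    proof -
      have "emeasure (uniform_measure \<nu> A) B = emeasure \<nu> (A \<inter> B) / ennreal l"
        using A that l by simp
      moreover have "emeasure \<nu> (A \<inter> B) \<noteq> \<infinity>"
        using emeasure_mono[of "A \<inter> B" A \<nu>] A by (auto simp: top_unique)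
      then have "emeasure \<nu> (A \<inter> B) = ennreal (measure \<nu> (A \<inter> B))"
        by (simp add: emeasure_eq_ennreal_measure)
      ultimately have "emeasure (uniform_measure \<nu> A) B = ennreal (measure \<nu> (A \<inter> B) / l)"
        using False l by (simp add: divide_ennreal)
      then have "measure (uniform_measure \<nu> A) B = measure \<nu> (A \<inter> B) / l"
        using l by (intro measure_eq_emeasure_eq_ennreal) auto
      then show ?thesis using False by simp
    qed
    moreover have "prob_space (uniform_measure \<nu> A)"
      using False l A by (intro prob_space_uniform_measure) auto
    moreover have "sets (uniform_measure \<nu> A) = sets \<nu>" by simp
    ultimately show ?thesis using that by blast
  qed
  interpret \<rho>: prob_space \<rho> by fact
  interpret R: product_prob_space "\<lambda>_. \<rho>" "UNIV :: nat set" by unfold_locales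
  let ?R = "\<Pi>\<^sub>M j\<in>(UNIV::nat set). \<rho>"
  have spR: "space \<rho> = space \<nu>" using \<rho>(2) by (rule sets_eq_imp_space_eq)
  define N where "N = (if l = 0 then return_pmf 0 else poisson_pmf l)"
  have gen: "(\<integral>\<^sup>+n. ennreal (q ^ n) \<partial>measure_pmf N) = ennreal (exp (- (l * (1 - q))))" if "0 \<le> q" for q
    using l(2) poisson_generating_function[of l q] that by (auto simp: N_def)
  have setsR: "sets ?R = sets (\<Pi>\<^sub>M j\<in>UNIV. \<nu>)" using \<rho>(2) by (intro sets_PiM_cong) auto
  have cyl: "{f \<in> space ?R. \<forall>j<n. f j \<notin> B} = prod_emb UNIV (\<lambda>_. \<rho>) {..<n} (\<Pi>\<^sub>E j\<in>{..<n}. space \<rho> - B)"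
    for n :: nat and B
    by (auto simp: prod_emb_def space_PiM PiE_iff restrict_def extensional_def)
  interpret NR: pair_prob_space "measure_pmf N" ?R ..
  have "emeasure (measure_pmf N \<Otimes>\<^sub>M ?R) {\<omega>\<in>space (measure_pmf N \<Otimes>\<^sub>M ?R). \<forall>j<fst \<omega>. snd \<omega> j \<notin> B}
      = void_prob (emeasure \<nu> (A \<inter> B))" (is "emeasure _ ?E = _") if B: "B \<in> sets \<nu>" for B
  proof -
    have B': "space \<rho> - B \<in> sets \<rho>" using B \<rho>(2) by auto
    have slice: "Pair n -` ?E = {f \<in> space ?R. \<forall>j<n. f j \<notin> B}" for n
      by (auto simp: space_pair_measure)
    have meas: "{f \<in> space ?R. \<forall>j<n. f j \<notin> B} \<in> sets ?R" for n
      unfolding cyl using B' by (intro sets_PiM_I) auto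
    have "?E = (\<Union>n. {n} \<times> {f \<in> space ?R. \<forall>j<n. f j \<notin> B})" by (auto simp: space_pair_measure)
    also have "\<dots> \<in> sets (measure_pmf N \<Otimes>\<^sub>M ?R)"
    proof (rule sets.countable_UN'')
      show "{n} \<times> {f \<in> space ?R. \<forall>j<n. f j \<notin> B} \<in> sets (measure_pmf N \<Otimes>\<^sub>M ?R)" for n
        by (rule pair_measureI[OF _ meas]) simp
    qed simp
    finally have "?E \<in> sets (measure_pmf N \<Otimes>\<^sub>M ?R)" .
    then have "emeasure (measure_pmf N \<Otimes>\<^sub>M ?R) ?E
        = (\<integral>\<^sup>+n. emeasure ?R {f \<in> space ?R. \<forall>j<n. f j \<notin> B} \<partial>measure_pmf N)"
      by (simp only: R.emeasure_pair_measure_alt slice)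
    also have "\<dots> = (\<integral>\<^sup>+n. ennreal (measure \<rho> (space \<rho> - B) ^ n) \<partial>measure_pmf N)"
    proof (rule nn_integral_cong)
      fix n
      have "emeasure ?R {f \<in> space ?R. \<forall>j<n. f j \<notin> B} = (\<Prod>j<n. emeasure \<rho> (space \<rho> - B))"
        unfolding cyl using B' by (subst R.emeasure_PiM_emb) auto
      then show "emeasure ?R {f \<in> space ?R. \<forall>j<n. f j \<notin> B} = ennreal (measure \<rho> (space \<rho> - B) ^ n)"
        by (simp add: \<rho>.emeasure_eq_measure ennreal_power)
    qed
    also have "\<dots> = ennreal (exp (- (l * (1 - measure \<rho> (space \<rho> - B)))))" by (simp add: gen)
    also have "l * (1 - measure \<rho> (space \<rho> - B)) = measure \<nu> (A \<inter> B)"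
      using \<rho>(3)[OF B] B \<rho>(2) by (simp add: \<rho>.prob_compl)
    also have "emeasure \<nu> (A \<inter> B) \<noteq> \<infinity>"
      using emeasure_mono[of "A \<inter> B" A \<nu>] A by (auto simp: top_unique)
    then have "ennreal (exp (- measure \<nu> (A \<inter> B))) = void_prob (emeasure \<nu> (A \<inter> B))"
      by (simp add: void_prob_def measure_def)
    finally show ?thesis .
  qed
  moreover have "sets (measure_pmf N \<Otimes>\<^sub>M ?R) = sets (count_space UNIV \<Otimes>\<^sub>M (\<Pi>\<^sub>M j\<in>UNIV. \<nu>))"
    using setsR by (intro sets_pair_measure_cong) auto
  ultimately show thesis using that NR.prob_space_axioms by blast
qed

text \<open>Independent blocks on a partition into sets of finite measure are superposed, and the closure of all
  their points is taken. An open set avoids the closure iff it avoids the points, so the probabilities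
  of the blocks multiply. The product over infinitely many blocks is a limit, which by continuity of
  \<^const>\<open>void_prob\<close> equals \<open>void_prob (\<nu> U)\<close> also when \<open>U\<close> has infinite measure.\<close>

theorem ex_poisson_closed_set:
  assumes \<nu>: "sigma_finite_measure \<nu>" "space \<nu> = topspace \<tau>" "topspace \<tau> \<noteq> {}"
    and opn: "\<And>U. openin \<tau> U \<Longrightarrow> U \<in> sets \<nu>"
  obtains P where "prob_space P" "sets P = sets (effros \<tau>)"
    "\<And>U. openin \<tau> U \<Longrightarrow> emeasure P (misses \<tau> U) = void_prob (emeasure \<nu> U)"
proof -
  obtain A :: "nat \<Rightarrow> 'a set" where A: "range A \<subseteq> sets \<nu>" "(\<Union>i. A i) = space \<nu>"
    "\<And>i. emeasure \<nu> (A i) \<noteq> \<infinity>" "disjoint_family A"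
    using sigma_finite_measure.sigma_finite_disjoint[OF \<nu>(1)] by metis
  let ?B = "count_space UNIV \<Otimes>\<^sub>M (\<Pi>\<^sub>M j\<in>(UNIV::nat set). \<nu>)"
  let ?E = "\<lambda>Q B. {\<omega>\<in>space Q. \<forall>j<fst \<omega>. snd \<omega> j \<notin> B}"
  have ex: "\<exists>Q. prob_space Q \<and> sets Q = sets ?B \<and>
      (\<forall>B\<in>sets \<nu>. emeasure Q (?E Q B) = void_prob (emeasure \<nu> (A i \<inter> B)))" for i
  proof -
    have "A i \<in> sets \<nu>" "space \<nu> \<noteq> {}" using A(1) \<nu> by auto
    from ex_block_process[OF this(1) A(3) this(2)] obtain Q' where
      "prob_space Q'" "sets Q' = sets ?B"
      "\<And>B. B \<in> sets \<nu> \<Longrightarrow> emeasure Q' (?E Q' B) = void_prob (emeasure \<nu> (A i \<inter> B))"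
      by blast
    then show ?thesis by blast
  qed
  have "\<forall>i. \<exists>Q. prob_space Q \<and> sets Q = sets ?B \<and>
      (\<forall>B\<in>sets \<nu>. emeasure Q (?E Q B) = void_prob (emeasure \<nu> (A i \<inter> B)))"
    using ex by (intro allI)
  from choice[OF this] obtain Q where "\<forall>i. prob_space (Q i) \<and> sets (Q i) = sets ?B \<and>
      (\<forall>B\<in>sets \<nu>. emeasure (Q i) (?E (Q i) B) = void_prob (emeasure \<nu> (A i \<inter> B)))" by (elim exE)
  then have Q: "\<And>i. prob_space (Q i)" "\<And>i. sets (Q i) = sets ?B"
      "\<And>i B. B \<in> sets \<nu> \<Longrightarrow> emeasure (Q i) (?E (Q i) B) = void_prob (emeasure \<nu> (A i \<inter> B))"
    by simp_all
  interpret Q: product_prob_space Q UNIV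
    using Q(1) by (simp add: product_prob_space_def product_sigma_finite_def product_prob_space_axioms_def
      prob_space_imp_sigma_finite)
  let ?\<Omega> = "\<Pi>\<^sub>M i\<in>UNIV. Q i"
  define pts where "pts \<omega> = {snd (\<omega> i) j | i j. j < fst (\<omega> i)}" for \<omega> :: "nat \<Rightarrow> nat \<times> (nat \<Rightarrow> 'a)"
  define F where "F \<omega> = \<tau> closure_of pts \<omega>" for \<omega>
  \<comment> \<open>The event has positive measure, so it cannot be one of the nonmeasurable sets, which have measure \<open>0\<close>.\<close>
  have Emeas: "?E (Q i) B \<in> sets (Q i)" if "B \<in> sets \<nu>" for i B
  proof (rule ccontr)
    assume "?E (Q i) B \<notin> sets (Q i)"
    then have "void_prob (emeasure \<nu> (A i \<inter> B)) = 0" using Q(3)[OF that, of i] by (simp add: emeasure_notin_sets)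
    moreover have "emeasure \<nu> (A i \<inter> B) \<noteq> \<infinity>"
      using emeasure_mono[of "A i \<inter> B" "A i" \<nu>] A(1) A(3)[of i] by (auto simp: top_unique)
    ultimately show False by (simp add: void_prob_def)
  qed
  have eq: "F -` misses \<tau> U \<inter> space ?\<Omega> = (\<Inter>n. Q.emb UNIV {..<n} (\<Pi>\<^sub>E i\<in>{..<n}. ?E (Q i) U))"
    if U: "openin \<tau> U" for U
  proof -
    have "F \<omega> \<in> misses \<tau> U \<longleftrightarrow> (\<forall>i. \<omega> i \<in> ?E (Q i) U)" if \<omega>: "\<omega> \<in> space ?\<Omega>" for \<omega>
    proof -
      have "U \<inter> F \<omega> = {} \<longleftrightarrow> U \<inter> pts \<omega> = {}"
        unfolding F_def by (rule openin_Int_closure_of_eq_empty[OF U])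
      moreover have "\<omega> i \<in> space (Q i)" for i using \<omega> by (auto simp: space_PiM)
      moreover have "U \<inter> pts \<omega> = {} \<longleftrightarrow> (\<forall>i. \<forall>j<fst (\<omega> i). snd (\<omega> i) j \<notin> U)"
        by (auto simp: pts_def disjoint_iff)
      moreover have "F \<omega> \<in> misses \<tau> U \<longleftrightarrow> U \<inter> F \<omega> = {}"
        by (auto simp: misses_def F_def)
      ultimately show ?thesis by simp
    qed
    moreover have "Q.emb UNIV {..<n} (\<Pi>\<^sub>E i\<in>{..<n}. ?E (Q i) U)
        = {\<omega> \<in> space ?\<Omega>. \<forall>i<n. \<omega> i \<in> ?E (Q i) U}" for n :: nat
      by (auto simp: prod_emb_def space_PiM PiE_iff restrict_def extensional_def)
    moreover have "(\<forall>n. \<forall>i<n. R i) \<longleftrightarrow> (\<forall>i. R i)" for R :: "nat \<Rightarrow> bool" by auto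
    ultimately show ?thesis by (simp add: set_eq_iff) blast
  qed
  have emb: "Q.emb UNIV {..<n} (\<Pi>\<^sub>E i\<in>{..<n}. ?E (Q i) U) \<in> sets ?\<Omega>" if "openin \<tau> U" for U and n :: nat
    using Emeas[OF opn[OF that]] by (intro sets_PiM_I) auto
  have Fmeas: "F \<in> ?\<Omega> \<rightarrow>\<^sub>M effros \<tau>"
    unfolding effros_def
  proof (rule measurable_measure_of)
    fix B assume "B \<in> {misses \<tau> U |U. openin \<tau> U}"
    then obtain U where "B = misses \<tau> U" "openin \<tau> U" by blast
    then show "F -` B \<inter> space ?\<Omega> \<in> sets ?\<Omega>" using eq emb by (auto intro!: sets.countable_INT'')
  qed (auto simp: misses_def F_def)
  define P where "P = distr ?\<Omega> (effros \<tau>) F"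
  show thesis
  proof
    show "prob_space P" unfolding P_def by (intro Q.P.prob_space_distr Fmeas)
    show "sets P = sets (effros \<tau>)" by (simp add: P_def)
    fix U assume U: "openin \<tau> U"
    note U' = opn[OF U]
    let ?e = "\<lambda>n. Q.emb UNIV {..<n} (\<Pi>\<^sub>E i\<in>{..<n}. ?E (Q i) U)"
    have fin: "emeasure \<nu> (A i \<inter> U) \<noteq> \<infinity>" for i
      using emeasure_mono[of "A i \<inter> U" "A i" \<nu>] A(1) A(3)[of i] by (auto simp: top_unique)
    have e1: "emeasure P (misses \<tau> U) = emeasure ?\<Omega> (\<Inter>n. ?e n)"
      unfolding P_def using U by (subst emeasure_distr[OF Fmeas]) (auto simp: eq)
    have lim: "(\<lambda>n. emeasure ?\<Omega> (?e n)) \<longlonglongrightarrow> emeasure ?\<Omega> (\<Inter>n. ?e n)"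
    proof (rule Lim_emeasure_decseq)
      show "range ?e \<subseteq> sets ?\<Omega>" using emb[OF U] by auto
      show "decseq ?e" by (auto simp: decseq_def prod_emb_def PiE_iff)
    qed simp
    have e2: "emeasure ?\<Omega> (?e n) = void_prob (\<Sum>i<n. emeasure \<nu> (A i \<inter> U))" for n
    proof -
      have "emeasure ?\<Omega> (?e n) = (\<Prod>i<n. emeasure (Q i) (?E (Q i) U))"
        using Emeas[OF U'] by (intro Q.emeasure_PiM_emb) auto
      also have "\<dots> = void_prob (\<Sum>i<n. emeasure \<nu> (A i \<inter> U))"
        using Q(3)[OF U'] fin by (simp add: void_prob_sum)
      finally show ?thesis .
    qed
    have lim2: "(\<lambda>n. void_prob (\<Sum>i<n. emeasure \<nu> (A i \<inter> U))) \<longlonglongrightarrow> void_prob (emeasure \<nu> U)"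
    proof (rule void_prob_tendsto)
      have "(\<lambda>i. emeasure \<nu> (A i \<inter> U)) sums emeasure \<nu> (\<Union>i. A i \<inter> U)"
        using A U' by (intro sums_emeasure) (auto simp: disjoint_family_on_def disjoint_iff)
      moreover have "(\<Union>i. A i \<inter> U) = U" using A(2) sets.sets_into_space[OF U'] by auto
      ultimately show "(\<lambda>n. \<Sum>i<n. emeasure \<nu> (A i \<inter> U)) \<longlonglongrightarrow> emeasure \<nu> U" by (simp add: sums_def)
      show "(\<Sum>i<n. emeasure \<nu> (A i \<inter> U)) \<noteq> \<infinity>" for n
        using fin by (simp add: less_top[symmetric])
    qed
    show "emeasure P (misses \<tau> U) = void_prob (emeasure \<nu> U)"
      unfolding e1 using lim lim2 unfolding e2 by (rule LIMSEQ_unique)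
  qed
qed

section \<open>Transport of actions along injections\<close>

lemma standard_borel_space_embed_measure:
  assumes M: "standard_borel_space M" and inj: "inj_on f (space M)"
  shows "standard_borel_space (embed_measure M f)"
proof -
  let ?S = "space M" and ?h = "the_inv_into (space M) f"
  obtain \<tau> where \<tau>: "polish_topology \<tau>" "topspace \<tau> = ?S" "sets M = sets (borel_of \<tau>)"
    using M unfolding standard_borel_space_def by blast
  define \<sigma> where "\<sigma> = pullback_topology (f ` ?S) ?h \<tau>"
  have h: "?h (f x) = x" if "x \<in> ?S" for x using inj that by (rule the_inv_into_f_f)
  have injh: "inj_on ?h (f ` ?S)" by (rule inj_onI) (auto simp: h)
  have imh: "?h ` f ` ?S = ?S" by (auto simp: h image_iff)
  have ts: "topspace \<sigma> = f ` ?S"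
    using imh \<tau>(2) unfolding \<sigma>_def topspace_pullback_topology by auto
  have "\<sigma> homeomorphic_space subtopology \<tau> (?h ` f ` ?S)"
    unfolding \<sigma>_def by (rule pullback_topology_homeomorphic[OF injh]) (simp add: imh \<tau>(2))
  then have "\<sigma> homeomorphic_space \<tau>"
    unfolding imh using \<tau>(2) by (metis subtopology_topspace)
  then have pol: "polish_topology \<sigma>"
    using \<tau>(1) homeomorphic_polish_topology homeomorphic_space_sym by blast
  have "sets (embed_measure M f) = sets (borel_of \<sigma>)"
  proof (rule antisym)
    have "continuous_map \<sigma> \<tau> (id \<circ> ?h)"
      unfolding \<sigma>_def by (rule continuous_map_pullback) simp
    then have "?h \<in> borel_of \<sigma> \<rightarrow>\<^sub>M borel_of \<tau>" by (simp add: measurable_borel_of_continuous)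
    then have m: "?h -` A \<inter> f ` ?S \<in> sets (borel_of \<sigma>)" if "A \<in> sets M" for A
      using measurable_sets[of ?h "borel_of \<sigma>" "borel_of \<tau>" A] that \<tau>(3) by (simp add: ts)
    show "sets (embed_measure M f) \<subseteq> sets (borel_of \<sigma>)"
    proof
      fix B assume "B \<in> sets (embed_measure M f)"
      then obtain A where A: "A \<in> sets M" "B = f ` A"
        unfolding sets_embed_measure'[OF inj] by blast
      then have "B = ?h -` A \<inter> f ` ?S"
        using the_inv_into_vimage[OF inj, of A] sets.sets_into_space by metis
      then show "B \<in> sets (borel_of \<sigma>)" using m A(1) by simp
    qed
    have "U \<in> sets (embed_measure M f)" if "openin \<sigma> U" for U
    proof -
      from that obtain V where V: "openin \<tau> V" "U = ?h -` V \<inter> f ` ?S"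
        unfolding \<sigma>_def openin_pullback_topology by (elim exE conjE)
      then have "U = f ` V" using the_inv_into_vimage[OF inj] openin_subset[OF V(1)] \<tau>(2) by simp
      then show ?thesis using V(1) \<tau>(3) by (auto intro!: in_sets_embed_measure)
    qed
    then have "{U. openin \<sigma> U} \<subseteq> sets (embed_measure M f)" by blast
    from sets.sigma_sets_subset[OF this]
    show "sets (borel_of \<sigma>) \<subseteq> sets (embed_measure M f)"
      unfolding sets_borel_of ts by (simp add: space_embed_measure)
  qed
  then show ?thesis
    unfolding standard_borel_space_def using pol ts by (metis space_embed_measure)
qed

text \<open>The image of an injection carries the transported topology, measure and action. Thus an action that
  arises on another type can be given on the reals.\<close>

lemma transport_action_along_injection:
  fixes f :: "'z \<Rightarrow> 'r"
  assumes act: "probability_preserving_spatial_action G \<tau>\<^sub>G M T"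
    and nontriv: "\<not> trivial_action G M T"
    and G: "polish_group G \<tau>\<^sub>G" and inj: "inj_on f (space M)"
  shows "admits_nontrivial_probability_preserving_action TYPE('r) G \<tau>\<^sub>G"
proof -
  have std: "standard_borel_space M" "\<nexists>A. is_atom M A"
    and meas: "(\<lambda>(g, x). T g x) \<in> borel_of \<tau>\<^sub>G \<Otimes>\<^sub>M M \<rightarrow>\<^sub>M M"
    and one: "\<And>x. x \<in> space M \<Longrightarrow> T \<one>\<^bsub>G\<^esub> x = x"
    and mult: "\<And>g h x. g \<in> carrier G \<Longrightarrow> h \<in> carrier G \<Longrightarrow> x \<in> space M \<Longrightarrow> T g (T h x) = T (g \<otimes>\<^bsub>G\<^esub> h) x"
    and pres: "\<And>g. g \<in> carrier G \<Longrightarrow> distr M M (T g) = M"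
    and prob: "emeasure M (space M) = 1"
    using act unfolding probability_preserving_spatial_action_def spatial_action_def
      standard_measure_space_def borel_action_def by auto
  interpret G: group G using G by (simp add: polish_group_def)
  have tsG: "topspace \<tau>\<^sub>G = carrier G" using G by (simp add: polish_group_def)
  let ?h = "the_inv_into (space M) f" and ?M = "embed_measure M f"
  have h [simp]: "?h (f x) = x" if "x \<in> space M" for x using inj that by (rule the_inv_into_f_f)
  define T' where "T' g s = f (T g (?h s))" for g s
  have spM': "space ?M = f ` space M" by (rule space_embed_measure)
  have Tm: "T g \<in> M \<rightarrow>\<^sub>M M" if "g \<in> carrier G" for g
    using measurable_compose[OF measurable_Pair1' meas, of g] that tsG by simp
  have Tin: "T g x \<in> space M" if "g \<in> carrier G" "x \<in> space M" for g x
    using measurable_space[OF Tm] that by blast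
  have fm: "f \<in> M \<rightarrow>\<^sub>M ?M" by (rule measurable_embed_measure2'[OF inj])
  have hm: "?h \<in> ?M \<rightarrow>\<^sub>M M"
  proof (rule measurable_embed_measure1)
    have "(\<lambda>x. x) \<in> M \<rightarrow>\<^sub>M M" by simp
    then show "(\<lambda>x. ?h (f x)) \<in> M \<rightarrow>\<^sub>M M" by (rule measurable_cong[THEN iffD2, rotated]) simp
  qed
  have T'm: "(\<lambda>(g, s). T' g s) \<in> borel_of \<tau>\<^sub>G \<Otimes>\<^sub>M ?M \<rightarrow>\<^sub>M ?M"
  proof -
    have "(\<lambda>p. (fst p, ?h (snd p))) \<in> borel_of \<tau>\<^sub>G \<Otimes>\<^sub>M ?M \<rightarrow>\<^sub>M borel_of \<tau>\<^sub>G \<Otimes>\<^sub>M M"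
      using hm by measurable
    from measurable_compose[OF measurable_compose[OF this meas] fm]
    show ?thesis by (simp add: T'_def split_def)
  qed
  have "T' \<one>\<^bsub>G\<^esub> s = s" if "s \<in> space ?M" for s using that one by (auto simp: T'_def spM')
  moreover have "T' g (T' k s) = T' (g \<otimes>\<^bsub>G\<^esub> k) s"
    if "g \<in> carrier G" "k \<in> carrier G" "s \<in> space ?M" for g k s
    using that mult Tin by (auto simp: T'_def spM')
  ultimately have ba: "borel_action G \<tau>\<^sub>G ?M T'" using T'm by (simp add: borel_action_def)
  have "distr ?M ?M (T' g) = ?M" if g: "g \<in> carrier G" for g
  proof -
    have T'g: "T' g \<in> ?M \<rightarrow>\<^sub>M ?M" unfolding T'_def using hm Tm[OF g] fm by measurable
    have "distr ?M ?M (T' g) = distr (distr M ?M f) ?M (T' g)"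
      using embed_measure_eq_distr'[OF inj] by simp
    also have "\<dots> = distr M ?M (T' g \<circ> f)" by (rule distr_distr[OF T'g fm])
    also have "\<dots> = distr M ?M (f \<circ> T g)" by (rule distr_cong) (auto simp: T'_def)
    also have "\<dots> = distr (distr M M (T g)) ?M f" by (rule distr_distr[OF fm Tm[OF g], symmetric])
    also have "\<dots> = ?M" using pres[OF g] embed_measure_eq_distr'[OF inj] by simp
    finally show ?thesis .
  qed
  moreover have "\<nexists>A. is_atom ?M A"
  proof
    assume "\<exists>A. is_atom ?M A"
    then obtain A' where A': "is_atom ?M A'" by blast
    then obtain A where A: "A \<in> sets M" "A' = f ` A"
      unfolding is_atom_def sets_embed_measure'[OF inj] by blast
    have em: "emeasure ?M (f ` B) = emeasure M B" if "B \<in> sets M" for B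
      by (rule emeasure_embed_measure_image'[OF inj that])
    have "is_atom M A"
      unfolding is_atom_def
    proof (intro conjI ballI impI)
      show "A \<in> sets M" by fact
      show "0 < emeasure M A" using A' em A by (simp add: is_atom_def)
      fix B assume B: "B \<in> sets M" "B \<subseteq> A"
      then have "f ` A - f ` B = f ` (A - B)"
        using inj_on_image_set_diff[OF inj] sets.sets_into_space[OF A(1)] by (metis Diff_subset order_trans)
      moreover have "emeasure ?M (f ` B) = 0 \<or> emeasure ?M (f ` A - f ` B) = 0"
      proof -
        have "f ` B \<in> sets ?M" "f ` B \<subseteq> f ` A" using B by (auto intro: in_sets_embed_measure)
        then show ?thesis using A' A(2) unfolding is_atom_def by simp
      qed
      ultimately show "emeasure M B = 0 \<or> emeasure M (A - B) = 0"
        using em[OF B(1)] em[of "A - B"] A(1) B(1) by auto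
    qed
    then show False using std(2) by blast
  qed
  moreover have p: "emeasure ?M (space ?M) = 1"
    using prob emeasure_embed_measure_image'[OF inj sets.top] by (simp add: spM')
  moreover have "\<not> trivial_action G ?M T'"
  proof
    assume "trivial_action G ?M T'"
    then have "AE x in M. f x \<in> fixed_points G ?M T'"
      unfolding trivial_action_def AE_embed_measure'[OF inj] .
    then have "AE x in M. x \<in> fixed_points G M T"
    proof (rule AE_mp, intro AE_I2 impI)
      fix x assume x: "x \<in> space M" "f x \<in> fixed_points G ?M T'"
      have "T g x = x" if "g \<in> carrier G" for g
        using x that inj_onD[OF inj, of "T g x" x] Tin[OF that] by (simp add: fixed_points_def T'_def)
      then show "x \<in> fixed_points G M T" using x(1) by (simp add: fixed_points_def)
    qed
    then show False using nontriv by (simp add: trivial_action_def)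
  qed
  ultimately show ?thesis
    unfolding admits_nontrivial_probability_preserving_action_def
      probability_preserving_spatial_action_def spatial_action_def standard_measure_space_def
    using ba standard_borel_space_embed_measure[OF std(1) inj] prob_spaceI[OF p] by blast
qed

lemma ex_inj_closed_sets_real:
  assumes "polish_topology \<tau>"
  obtains f :: "'y set \<Rightarrow> real" where "inj_on f {F. closedin \<tau> F}"
proof -
  obtain B where B: "countable_base \<tau> B" using assms by (rule polish_countable_base)
  obtain e :: "nat set \<Rightarrow> real" where e: "bij e"
    using nat_sets_eqpoll_reals unfolding eqpoll_def by blast
  have "inj_on (\<lambda>F. e (Collect (trace_code B F))) {F. closedin \<tau> F}"
  proof (rule inj_onI)
    fix F F' assume F: "F \<in> {F. closedin \<tau> F}" "F' \<in> {F. closedin \<tau> F}"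
      and "e (Collect (trace_code B F)) = e (Collect (trace_code B F'))"
    then have "Collect (trace_code B F) = Collect (trace_code B F')"
      using e by (simp add: bij_def inj_eq)
    then have "trace_code B F = trace_code B F'" by (metis Collect_inj)
    then show "F = F'" using inj_onD[OF inj_on_trace_code[OF B]] F by blast
  qed
  then show thesis by (rule that)
qed

section \<open>The action on closed sets\<close>

text \<open>The part of the setting that does not refer to a measure; it is shared by the action on \<open>X\<close> and its
  Maharam extension.\<close>

locale polish_action =
  fixes G :: "('g, 'b) monoid_scheme" and \<tau>\<^sub>G :: "'g topology"
    and \<tau> :: "'y topology" and T :: "'g \<Rightarrow> 'y \<Rightarrow> 'y"
  assumes polish_G: "polish_group G \<tau>\<^sub>G" and polish: "polish_topology \<tau>"
    and T_one: "\<And>y. y \<in> topspace \<tau> \<Longrightarrow> T \<one>\<^bsub>G\<^esub> y = y"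
    and T_mult: "\<And>g h y. g \<in> carrier G \<Longrightarrow> h \<in> carrier G \<Longrightarrow> y \<in> topspace \<tau> \<Longrightarrow>
      T g (T h y) = T (g \<otimes>\<^bsub>G\<^esub> h) y"
    and T_cont: "continuous_map (prod_topology \<tau>\<^sub>G \<tau>) \<tau> (\<lambda>(g, y). T g y)"
begin

sublocale G: group G using polish_G by (simp add: polish_group_def)

lemma topspace_G: "topspace \<tau>\<^sub>G = carrier G" using polish_G by (simp add: polish_group_def)

lemma T_cont_at: "g \<in> carrier G \<Longrightarrow> continuous_map \<tau> \<tau> (T g)"
proof -
  assume g: "g \<in> carrier G"
  have "continuous_map \<tau> (prod_topology \<tau>\<^sub>G \<tau>) (\<lambda>y. (g, y))"
    using g topspace_G by (intro continuous_map_pairedI) auto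
  from continuous_map_compose[OF this T_cont] show ?thesis by (simp add: o_def)
qed

lemma orbit_continuous:
  assumes y: "y \<in> topspace \<tau>" shows "continuous_map \<tau>\<^sub>G \<tau> (\<lambda>g. T g y)"
proof -
  have "continuous_map \<tau>\<^sub>G (prod_topology \<tau>\<^sub>G \<tau>) (\<lambda>g. (g, y))"
    using y by (intro continuous_map_pairedI) auto
  from continuous_map_compose[OF this T_cont] show ?thesis by (simp add: o_def)
qed

lemma T_in: "g \<in> carrier G \<Longrightarrow> y \<in> topspace \<tau> \<Longrightarrow> T g y \<in> topspace \<tau>"
  using T_cont_at continuous_map_image_subset_topspace by blast

lemma T_inv [simp]:
  assumes "g \<in> carrier G" "y \<in> topspace \<tau>"
  shows "T (inv\<^bsub>G\<^esub> g) (T g y) = y" "T g (T (inv\<^bsub>G\<^esub> g) y) = y"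
  using assms by (simp_all add: T_mult T_one)

lemma openin_preimage:
  assumes "g \<in> carrier G" "openin \<tau> U" shows "openin \<tau> (T g -` U \<inter> topspace \<tau>)"
  using openin_continuous_map_preimage[OF T_cont_at[OF assms(1)] assms(2)]
  by (simp add: vimage_def Int_def conj_commute)

lemma closedin_image:
  assumes g: "g \<in> carrier G" and F: "closedin \<tau> F"
  shows "closedin \<tau> (T g ` F)"
proof -
  have F': "F \<subseteq> topspace \<tau>" by (rule closedin_subset[OF F])
  have "T g ` F = {y \<in> topspace \<tau>. T (inv\<^bsub>G\<^esub> g) y \<in> F}"
  proof (intro equalityI subsetI)
    fix y assume "y \<in> T g ` F"
    then obtain z where "z \<in> F" "y = T g z" by blast
    then show "y \<in> {y \<in> topspace \<tau>. T (inv\<^bsub>G\<^esub> g) y \<in> F}" using g F' T_in by auto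
  next
    fix y assume y: "y \<in> {y \<in> topspace \<tau>. T (inv\<^bsub>G\<^esub> g) y \<in> F}"
    then have "y = T g (T (inv\<^bsub>G\<^esub> g) y)" using g by simp
    then show "y \<in> T g ` F" using y by blast
  qed
  then show ?thesis
    using closedin_continuous_map_preimage[OF T_cont_at F, of "inv\<^bsub>G\<^esub> g"] g by simp
qed

lemma image_misses_iff:
  assumes "g \<in> carrier G" "closedin \<tau> F"
  shows "T g ` F \<in> misses \<tau> U \<longleftrightarrow> F \<in> misses \<tau> (T g -` U \<inter> topspace \<tau>)"
  using closedin_subset[OF assms(2)] closedin_image[OF assms] assms(2)
  by (auto simp: misses_def disjoint_iff)

text \<open>Joint continuity in the form in which it is used: a rectangle around \<open>(g, y)\<close> is mapped into \<open>U\<close>.\<close>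

lemma joint_neighbourhoods:
  assumes U: "openin \<tau> U" "T g y \<in> U" and gy: "g \<in> carrier G" "y \<in> topspace \<tau>"
  obtains V W where "openin \<tau>\<^sub>G V" "openin \<tau> W" "g \<in> V" "y \<in> W"
    "\<And>v w. v \<in> V \<Longrightarrow> w \<in> W \<Longrightarrow> T v w \<in> U"
proof -
  let ?Q = "{q \<in> topspace (prod_topology \<tau>\<^sub>G \<tau>). (\<lambda>(g, y). T g y) q \<in> U}"
  have "openin (prod_topology \<tau>\<^sub>G \<tau>) ?Q"
    by (rule openin_continuous_map_preimage[OF T_cont U(1)])
  moreover have "(g, y) \<in> ?Q" using U(2) gy topspace_G by simp
  ultimately obtain V W where VW: "openin \<tau>\<^sub>G V" "openin \<tau> W" "g \<in> V" "y \<in> W" "V \<times> W \<subseteq> ?Q"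
    unfolding openin_prod_topology_alt by meson
  have "T v w \<in> U" if "v \<in> V" "w \<in> W" for v w
    using subsetD[OF VW(5), of "(v, w)"] that by simp
  then show thesis using that VW by blast
qed

end

text \<open>Full support makes every nonempty open set visible to the Poisson process, local finiteness makes
  it avoid small sets with positive probability, and infinite mass without point masses makes the law
  of the process nonatomic. Measurability and invariance are asked for open sets only, since the
  probabilities of \<^const>\<open>misses\<close> events involve no others.\<close>

locale infinite_polish_action = polish_action G \<tau>\<^sub>G \<tau> T
  for G :: "('g, 'b) monoid_scheme" and \<tau>\<^sub>G :: "'g topology"
    and \<tau> :: "'y topology" and T :: "'g \<Rightarrow> 'y \<Rightarrow> 'y" +
  fixes \<nu> :: "'y measure"
  assumes sigma_finite: "sigma_finite_measure \<nu>" and space_\<nu>: "space \<nu> = topspace \<tau>"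
    and open_sets: "\<And>U. openin \<tau> U \<Longrightarrow> U \<in> sets \<nu>"
    and locally_finite: "\<And>y. y \<in> topspace \<tau> \<Longrightarrow> \<exists>U. openin \<tau> U \<and> y \<in> U \<and> emeasure \<nu> U < \<infinity>"
    and points_null: "\<And>y. y \<in> topspace \<tau> \<Longrightarrow> emeasure \<nu> {y} = 0"
    and full_support: "\<And>U. openin \<tau> U \<Longrightarrow> U \<noteq> {} \<Longrightarrow> emeasure \<nu> U \<noteq> 0"
    and infinite: "emeasure \<nu> (topspace \<tau>) = \<infinity>"
    and invariant: "\<And>g U. g \<in> carrier G \<Longrightarrow> openin \<tau> U \<Longrightarrow>
      emeasure \<nu> (T g -` U \<inter> topspace \<tau>) = emeasure \<nu> U"
begin

lemma displaced_neighbourhood: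
  assumes g: "g \<in> carrier G" and y: "y \<in> topspace \<tau>" "T g y \<noteq> y"
  obtains C where "openin \<tau> C" "y \<in> C" "emeasure \<nu> C < \<infinity>" "C \<inter> (T g -` C \<inter> topspace \<tau>) = {}"
proof -
  have "\<exists>A B. openin \<tau> A \<and> openin \<tau> B \<and> y \<in> A \<and> T g y \<in> B \<and> disjnt A B"
    using polish_topology_Hausdorff[OF polish] y T_in[OF g y(1)] unfolding Hausdorff_space_def
    by (simp add: eq_commute)
  then obtain A B where AB: "openin \<tau> A" "openin \<tau> B" "y \<in> A" "T g y \<in> B" "disjnt A B"
    by blast
  obtain U where U: "openin \<tau> U" "y \<in> U" "emeasure \<nu> U < \<infinity>" using locally_finite[OF y(1)] by blast
  let ?C = "A \<inter> (T g -` B \<inter> topspace \<tau>) \<inter> U"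
  have "openin \<tau> ?C" by (intro openin_Int AB(1) U(1) openin_preimage[OF g AB(2)])
  moreover have "emeasure \<nu> ?C < \<infinity>"
    using emeasure_mono[of ?C U \<nu>] open_sets[OF U(1)] U(3) by (auto intro: le_less_trans)
  moreover have "?C \<inter> (T g -` ?C \<inter> topspace \<tau>) = {}" using AB(5) by (auto simp: disjnt_iff)
  ultimately show thesis using that AB U y by blast
qed

text \<open>Continuity from above along the finite intersections of basic neighbourhoods, whose intersection is
  the null set \<open>{y}\<close>.\<close>

lemma shrinking_neighbourhoods:
  assumes y: "y \<in> topspace \<tau>"
  obtains V :: "nat \<Rightarrow> 'y set" where "\<And>k. openin \<tau> (V k)" "\<And>k. y \<in> V k"
    "\<And>k. emeasure \<nu> (V k) \<noteq> \<infinity>" "(\<lambda>k. emeasure \<nu> (V k)) \<longlonglongrightarrow> 0"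
proof -
  obtain B where B: "countable_base \<tau> B" using polish by (rule polish_countable_base)
  obtain U where U: "openin \<tau> U" "y \<in> U" "emeasure \<nu> U < \<infinity>" using locally_finite[OF y(1)] by blast
  define C where "C i = (if y \<in> B i then B i else topspace \<tau>)" for i
  define V where "V k = U \<inter> (\<Inter>i\<in>{..k}. C i)" for k :: nat
  have C: "openin \<tau> (C i)" "y \<in> C i" for i using countable_base_openin[OF B] y by (auto simp: C_def)
  have V: "openin \<tau> (V k)" "y \<in> V k" for k
    using C U unfolding V_def by (auto intro!: openin_Int openin_Inter)
  have fin: "emeasure \<nu> (V k) \<noteq> \<infinity>" for k
    using emeasure_mono[of "V k" U \<nu>] open_sets[OF U(1)] U(3) by (auto simp: V_def top_unique)
  have "(\<Inter>k. V k) = {y}"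
  proof (intro equalityI subsetI)
    fix z assume z: "z \<in> (\<Inter>k. V k)"
    have "z = y"
    proof (rule ccontr)
      assume "z \<noteq> y"
      have "z \<in> topspace \<tau>" using z openin_subset[OF V(1)[of 0]] by blast
      then have "\<exists>A D. openin \<tau> A \<and> openin \<tau> D \<and> y \<in> A \<and> z \<in> D \<and> disjnt A D"
        using polish_topology_Hausdorff[OF polish] y \<open>z \<noteq> y\<close> unfolding Hausdorff_space_def
        by (simp add: eq_commute)
      then obtain A D where A: "openin \<tau> A" "openin \<tau> D" "y \<in> A" "z \<in> D" "disjnt A D"
        by blast
      obtain i where "y \<in> B i" "B i \<subseteq> A" using B A(1,3) by (rule countable_baseE)
      moreover have "z \<in> C i" using z by (auto simp: V_def)
      ultimately show False using A(4,5) by (auto simp: C_def disjnt_iff)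
    qed
    then show "z \<in> {y}" by simp
  qed (use V in auto)
  moreover have "(\<lambda>k. emeasure \<nu> (V k)) \<longlonglongrightarrow> emeasure \<nu> (\<Inter>k. V k)"
    using open_sets[OF V(1)] fin by (intro Lim_emeasure_decseq) (auto simp: decseq_def V_def)
  ultimately have "(\<lambda>k. emeasure \<nu> (V k)) \<longlonglongrightarrow> 0" using points_null[OF y] by simp
  then show thesis using that V fin by blast
qed

end

locale poisson_closed_set = infinite_polish_action G \<tau>\<^sub>G \<tau> T \<nu> + prob_space P
  for G :: "('g, 'b) monoid_scheme" and \<tau>\<^sub>G :: "'g topology"
    and \<tau> :: "'y topology" and T :: "'g \<Rightarrow> 'y \<Rightarrow> 'y" and \<nu> :: "'y measure" and P :: "'y set measure" +
  assumes sets_P: "sets P = sets (effros \<tau>)"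
    and void: "\<And>U. openin \<tau> U \<Longrightarrow> emeasure P (misses \<tau> U) = void_prob (emeasure \<nu> U)"
begin

lemma space_P: "space P = {F. closedin \<tau> F}"
  using sets_eq_imp_space_eq[OF sets_P] by simp

lemma misses_in_P: "openin \<tau> U \<Longrightarrow> misses \<tau> U \<in> sets P"
  and hits_in_P: "openin \<tau> U \<Longrightarrow> hits \<tau> U \<in> sets P"
  by (auto simp: sets_P)

lemma emeasure_hits: "openin \<tau> U \<Longrightarrow> emeasure P (hits \<tau> U) = 1 - void_prob (emeasure \<nu> U)"
  unfolding hits_eq space_P[symmetric]
  using emeasure_compl[OF misses_in_P] emeasure_space_1 by (simp add: void[symmetric])

text \<open>By the void probabilities, the event has probability \<open>exp (- \<nu> C) - exp (- \<nu> W - \<nu> C)\<close>.\<close>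

lemma hits_and_misses_pos:
  assumes W: "openin \<tau> W" "W \<noteq> {}" "emeasure \<nu> W < \<infinity>"
    and C: "openin \<tau> C" "emeasure \<nu> C < \<infinity>" and disj: "W \<inter> C = {}"
  shows "emeasure P (hits \<tau> W \<inter> misses \<tau> C) > 0"
proof -
  have WC: "openin \<tau> (W \<union> C)" using W C by auto
  have "hits \<tau> W \<inter> misses \<tau> C = misses \<tau> C - misses \<tau> (W \<union> C)"
    by (auto simp: hits_def misses_def)
  then have "emeasure P (hits \<tau> W \<inter> misses \<tau> C) = emeasure P (misses \<tau> C) - emeasure P (misses \<tau> (W \<union> C))"
    using emeasure_Diff[OF _ misses_in_P[OF C(1)] misses_in_P[OF WC]]
    by (auto simp: misses_def Int_Un_distrib)
  also have "\<dots> = void_prob (emeasure \<nu> C) - void_prob (emeasure \<nu> W + emeasure \<nu> C)"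
    using C WC open_sets W disj by (simp add: void plus_emeasure)
  also have "\<dots> > 0"
  proof -
    obtain w c where wc: "emeasure \<nu> W = ennreal w" "emeasure \<nu> C = ennreal c" "0 \<le> w" "0 \<le> c"
      using W(3) C(2) by (metis ennreal_cases infinity_ennreal_def less_irrefl)
    have "w > 0" using full_support[OF W(1,2)] wc by (cases "w = 0") auto
    then have "exp (- c) - exp (- (w + c)) > 0" by simp
    then show ?thesis
      using wc by (simp add: void_prob_def ennreal_plus[symmetric] ennreal_minus del: ennreal_plus)
  qed
  finally show ?thesis .
qed

text \<open>By joint continuity \<open>{(g, y). T g y \<in> U}\<close> is a countable union of basic open rectangles \<open>V \<times> W\<close>, and
  \<open>T g ` F\<close> hits \<open>U\<close> iff \<open>g \<in> V\<close> and \<open>F\<close> hits \<open>W\<close> for one of them.\<close>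

lemma image_measurable:
  "(\<lambda>(g, F). T g ` F) \<in> borel_of \<tau>\<^sub>G \<Otimes>\<^sub>M P \<rightarrow>\<^sub>M P"
proof -
  let ?N = "borel_of \<tau>\<^sub>G \<Otimes>\<^sub>M P"
  have sp: "space ?N = carrier G \<times> {F. closedin \<tau> F}" by (simp add: space_pair_measure topspace_G space_P)
  obtain BG where BG: "countable_base \<tau>\<^sub>G BG"
    using polish_G polish_countable_base unfolding polish_group_def by metis
  obtain B where B: "countable_base \<tau> B" using polish by (rule polish_countable_base)
  have "(\<lambda>(g, F). T g ` F) \<in> ?N \<rightarrow>\<^sub>M effros \<tau>"
    unfolding effros_def
  proof (rule measurable_measure_of)
    show "(\<lambda>(g, F). T g ` F) \<in> space ?N \<rightarrow> {F. closedin \<tau> F}" using closedin_image by (auto simp: sp)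
    fix S assume "S \<in> {misses \<tau> U |U. openin \<tau> U}"
    then obtain U where U: "openin \<tau> U" "S = misses \<tau> U" by blast
    let ?I = "{(i, j). \<forall>g\<in>BG i. \<forall>y\<in>B j. T g y \<in> U}"
    have "(\<lambda>(g, F). T g ` F) -` S \<inter> space ?N = space ?N - (\<Union>(i, j)\<in>?I. BG i \<times> hits \<tau> (B j))"
    proof (intro equalityI subsetI)
      fix p assume "p \<in> (\<lambda>(g, F). T g ` F) -` S \<inter> space ?N"
      then show "p \<in> space ?N - (\<Union>(i, j)\<in>?I. BG i \<times> hits \<tau> (B j))"
        by (auto simp: sp U(2) misses_def hits_def disjoint_iff)
    next
      fix p assume p: "p \<in> space ?N - (\<Union>(i, j)\<in>?I. BG i \<times> hits \<tau> (B j))"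
      obtain g F where gF: "p = (g, F)" "g \<in> carrier G" "closedin \<tau> F" using p sp by auto
      have "T g y \<notin> U" if y: "y \<in> F" for y
      proof
        assume Ty: "T g y \<in> U"
        have "y \<in> topspace \<tau>" using y closedin_subset[OF gF(3)] by blast
        then obtain V W where VW: "openin \<tau>\<^sub>G V" "openin \<tau> W" "g \<in> V" "y \<in> W"
          "\<And>v w. v \<in> V \<Longrightarrow> w \<in> W \<Longrightarrow> T v w \<in> U"
          using joint_neighbourhoods[OF U(1) Ty gF(2)] by blast
        obtain i where i: "g \<in> BG i" "BG i \<subseteq> V" using BG VW(1,3) by (rule countable_baseE)
        obtain j where j: "y \<in> B j" "B j \<subseteq> W" using B VW(2,4) by (rule countable_baseE)
        have "(i, j) \<in> ?I" using VW(5) i(2) j(2) by (simp add: subset_iff)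
        moreover have "p \<in> BG i \<times> hits \<tau> (B j)" using gF i(1) j(1) y by (auto simp: hits_def)
        ultimately show False using p by blast
      qed
      then show "p \<in> (\<lambda>(g, F). T g ` F) -` S \<inter> space ?N"
        using gF closedin_image by (auto simp: sp U(2) misses_def)
    qed
    also have "\<dots> \<in> sets ?N"
    proof (intro sets.Diff sets.top sets.countable_UN'')
      fix q assume "q \<in> ?I"
      have "BG i \<times> hits \<tau> (B j) \<in> sets ?N" for i j
        using countable_base_openin[OF BG] countable_base_openin[OF B] hits_in_P
        by (intro pair_measureI) auto
      then show "(case q of (i, j) \<Rightarrow> BG i \<times> hits \<tau> (B j)) \<in> sets ?N" by (cases q) simp
    qed simp
    finally show "(\<lambda>(g, F). T g ` F) -` S \<inter> space ?N \<in> sets ?N" .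
  qed (auto simp: misses_def)
  then show ?thesis using measurable_cong_sets[OF refl sets_P] by blast
qed

lemma image_measurable_at: "g \<in> carrier G \<Longrightarrow> (\<lambda>F. T g ` F) \<in> P \<rightarrow>\<^sub>M P"
  using measurable_compose[OF measurable_Pair1' image_measurable, of g] by (simp add: topspace_G)

lemma image_preserves:
  assumes g: "g \<in> carrier G" shows "distr P P (\<lambda>F. T g ` F) = P"
proof (rule sym, rule measure_eqI_generator_eq)
  let ?E = "{misses \<tau> U |U. openin \<tau> U}" and ?\<Omega> = "{F. closedin \<tau> F}"
  show "Int_stable ?E"
  proof (rule Int_stableI)
    fix a b assume "a \<in> ?E" "b \<in> ?E"
    then obtain U V where "openin \<tau> U" "openin \<tau> V" "a = misses \<tau> U" "b = misses \<tau> V" by blast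
    moreover have "misses \<tau> U \<inter> misses \<tau> V = misses \<tau> (U \<union> V)" by (auto simp: misses_def)
    ultimately show "a \<inter> b \<in> ?E" by blast
  qed
  show "?E \<subseteq> Pow ?\<Omega>" by (auto simp: misses_def)
  show "sets P = sigma_sets ?\<Omega> ?E" "sets (distr P P (\<lambda>F. T g ` F)) = sigma_sets ?\<Omega> ?E"
    by (simp_all add: sets_P sets_effros)
  show "range (\<lambda>_::nat. misses \<tau> {}) \<subseteq> ?E" by auto
  show "(\<Union>i::nat. misses \<tau> {}) = ?\<Omega>" by (auto simp: misses_def)
  show "emeasure P (misses \<tau> {}) \<noteq> \<infinity>" by simp
  fix S assume "S \<in> ?E"
  then obtain U where U: "openin \<tau> U" "S = misses \<tau> U" by blast
  have "(\<lambda>F. T g ` F) -` S \<inter> space P = misses \<tau> (T g -` U \<inter> topspace \<tau>)"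
  proof (intro equalityI subsetI)
    fix F assume "F \<in> (\<lambda>F. T g ` F) -` S \<inter> space P"
    then have "closedin \<tau> F" "T g ` F \<in> misses \<tau> U" by (simp_all add: U(2) space_P)
    then show "F \<in> misses \<tau> (T g -` U \<inter> topspace \<tau>)" using image_misses_iff[OF g] by blast
  next
    fix F assume F: "F \<in> misses \<tau> (T g -` U \<inter> topspace \<tau>)"
    then have "closedin \<tau> F" by (simp add: misses_def)
    then show "F \<in> (\<lambda>F. T g ` F) -` S \<inter> space P"
      using image_misses_iff[OF g, of F U] F by (simp add: U(2) space_P)
  qed
  then have "emeasure (distr P P (\<lambda>F. T g ` F)) S = emeasure P (misses \<tau> (T g -` U \<inter> topspace \<tau>))"
    using emeasure_distr[OF image_measurable_at[OF g], of S] misses_in_P U by simp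
  also have "\<dots> = emeasure P S"
    using void[OF openin_preimage[OF g U(1)]] void[OF U(1)] invariant[OF g U(1)] U(2) by simp
  finally show "emeasure P S = emeasure (distr P P (\<lambda>F. T g ` F)) S" ..
qed

lemma borel_action_image: "borel_action G \<tau>\<^sub>G P (\<lambda>g F. T g ` F)"
  unfolding borel_action_def
proof (intro conjI ballI image_measurable)
  show "T \<one>\<^bsub>G\<^esub> ` F = F" if "F \<in> space P" for F
    using that closedin_subset[of \<tau> F] T_one by (force simp: space_P)
  show "T g ` T h ` F = T (g \<otimes>\<^bsub>G\<^esub> h) ` F" if "g \<in> carrier G" "h \<in> carrier G" "F \<in> space P" for g h F
    unfolding image_image
    using that closedin_subset[of \<tau> F] T_mult by (intro image_cong) (auto simp: space_P)
qed

text \<open>The empty set has probability \<open>exp (- \<infinity>)\<close>. A nonempty closed set containing \<open>y\<close> hits all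
  neighbourhoods of \<open>y\<close>, which happens with probability at most \<open>1 - exp (- \<nu> V)\<close> for \<open>V\<close> arbitrarily
  small. Quantifying over subsets of a singleton avoids a separate proof that singletons are measurable.\<close>

lemma singleton_null:
  assumes S: "S \<in> sets P" "S \<subseteq> {F}"
  shows "emeasure P S = 0"
proof (cases "S = {}")
  case False
  then have SF: "S = {F}" and F: "closedin \<tau> F" using S sets.sets_into_space[OF S(1)] by (auto simp: space_P)
  show ?thesis
  proof (cases "F = {}")
    case True
    then have "S \<subseteq> misses \<tau> (topspace \<tau>)" using SF by (auto simp: misses_def)
    then have "emeasure P S \<le> emeasure P (misses \<tau> (topspace \<tau>))"
      by (intro emeasure_mono misses_in_P) auto
    then show ?thesis by (simp add: void infinite void_prob_def)
  next
    case False
    then obtain y where y: "y \<in> F" by blast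
    then obtain V where V: "\<And>k::nat. openin \<tau> (V k)" "\<And>k. y \<in> V k"
      "\<And>k. emeasure \<nu> (V k) \<noteq> \<infinity>" "(\<lambda>k. emeasure \<nu> (V k)) \<longlonglongrightarrow> 0"
      using shrinking_neighbourhoods[of y] closedin_subset[OF F] by blast
    have le: "emeasure P S \<le> 1 - void_prob (emeasure \<nu> (V k))" for k
    proof -
      have "S \<subseteq> hits \<tau> (V k)" using SF F y V(2) by (auto simp: hits_def)
      then show ?thesis using emeasure_mono[OF _ hits_in_P[OF V(1)]] emeasure_hits[OF V(1)] by metis
    qed
    have "(\<lambda>k. 1 - void_prob (emeasure \<nu> (V k))) \<longlonglongrightarrow> 1 - void_prob 0"
      by (intro tendsto_diff_ennreal tendsto_const void_prob_tendsto V)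
        (auto simp: void_prob_def)
    then have "(\<lambda>k. 1 - void_prob (emeasure \<nu> (V k))) \<longlonglongrightarrow> 0" by (simp add: void_prob_def)
    then have "emeasure P S \<le> 0" using le by (intro LIMSEQ_le_const) auto
    then show ?thesis by simp
  qed
qed simp

text \<open>Countably many sets, the \<^const>\<open>hits\<close> events of basic open sets, separate points. An atom lies almost
  entirely on one side of each of them, hence almost entirely in a singleton.\<close>

lemma no_atoms: "\<not> is_atom P A"
proof
  assume A: "is_atom P A"
  obtain B where B: "countable_base \<tau> B" using polish by (rule polish_countable_base)
  define N where "N n = (if emeasure P (A \<inter> hits \<tau> (B n)) = 0 then misses \<tau> (B n) else hits \<tau> (B n))" for n
  have As: "A \<in> sets P" "emeasure P A > 0" using A by (auto simp: is_atom_def)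
  have hB: "hits \<tau> (B n) \<in> sets P" "misses \<tau> (B n) \<in> sets P" for n
    using countable_base_openin[OF B] hits_in_P misses_in_P by auto
  have Ac: "A \<subseteq> {F. closedin \<tau> F}" using sets.sets_into_space[OF As(1)] space_P by simp
  have N: "N n \<in> sets P" for n using hB by (simp add: N_def)
  have null: "A - N n \<in> null_sets P" for n
  proof (cases "emeasure P (A \<inter> hits \<tau> (B n)) = 0")
    case True
    then have "A - N n = A \<inter> hits \<tau> (B n)" using Ac by (auto simp: N_def hits_eq)
    then show ?thesis using True As hB by (auto intro!: null_setsI)
  next
    case False
    have "emeasure P (A \<inter> hits \<tau> (B n)) = 0 \<or> emeasure P (A - A \<inter> hits \<tau> (B n)) = 0"
      using A As hB unfolding is_atom_def by (meson inf_le1 sets.Int)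
    moreover have "A - N n = A - A \<inter> hits \<tau> (B n)" using False by (auto simp: N_def)
    ultimately show ?thesis using False As hB by (auto intro!: null_setsI)
  qed
  have D: "A \<inter> (\<Inter>n. N n) \<in> sets P" using As N by auto
  have "\<exists>F. A \<inter> (\<Inter>n. N n) \<subseteq> {F}"
  proof -
    have "F = F'" if F: "F \<in> A \<inter> (\<Inter>n. N n)" "F' \<in> A \<inter> (\<Inter>n. N n)" for F F'
    proof -
      have cl: "closedin \<tau> F" "closedin \<tau> F'" using F Ac by auto
      have "trace_code B F n = trace_code B F' n" for n
      proof -
        have "F \<in> N n" "F' \<in> N n" using F by auto
        then show ?thesis by (auto simp: N_def trace_code_def hits_def misses_def split: if_splits)
      qed
      then have "trace_code B F = trace_code B F'" by blast
      then show ?thesis using inj_onD[OF inj_on_trace_code[OF B]] cl by blast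
    qed
    then have "A \<inter> (\<Inter>n. N n) \<subseteq> {SOME F. F \<in> A \<inter> (\<Inter>n. N n)}"
      by (metis (no_types, lifting) insertCI someI subsetI)
    then show ?thesis ..
  qed
  then have "A \<inter> (\<Inter>n. N n) \<in> null_sets P" using singleton_null D by (auto intro!: null_setsI)
  moreover have "(\<Union>n. A - N n) \<in> null_sets P" using null by (intro null_sets_UN) auto
  ultimately have "(A \<inter> (\<Inter>n. N n)) \<union> (\<Union>n. A - N n) \<in> null_sets P" by auto
  moreover have "A = (A \<inter> (\<Inter>n. N n)) \<union> (\<Union>n. A - N n)" by auto
  ultimately show False using As(2) by (metis less_irrefl null_setsD1)
qed

lemma spatial: "probability_preserving_spatial_action G \<tau>\<^sub>G P (\<lambda>g F. T g ` F)"
  unfolding probability_preserving_spatial_action_def spatial_action_def standard_measure_space_def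
  using standard_borel_space_effros[OF polish space_P sets_P] no_atoms prob_space_axioms
    borel_action_image image_preserves emeasure_space_1 by blast

lemma nontrivial:
  assumes "g \<in> carrier G" "y \<in> topspace \<tau>" "T g y \<noteq> y"
  shows "\<not> trivial_action G P (\<lambda>g F. T g ` F)"
proof
  assume triv: "trivial_action G P (\<lambda>g F. T g ` F)"
  obtain C where C: "openin \<tau> C" "y \<in> C" "emeasure \<nu> C < \<infinity>" "C \<inter> (T g -` C \<inter> topspace \<tau>) = {}"
    using assms by (rule displaced_neighbourhood)
  let ?C' = "T g -` C \<inter> topspace \<tau>"
  have C': "openin \<tau> ?C'" "emeasure \<nu> ?C' < \<infinity>"
    using openin_preimage[OF assms(1) C(1)] invariant[OF assms(1) C(1)] C(3) by auto
  have pos: "emeasure P (hits \<tau> C \<inter> misses \<tau> ?C') > 0"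
    using C C' by (intro hits_and_misses_pos) auto
  have "AE F in P. \<not> (F \<in> hits \<tau> C \<and> F \<in> misses \<tau> ?C')"
    using triv unfolding trivial_action_def
  proof (rule AE_mp, intro AE_I2 impI notI)
    fix F assume F: "F \<in> fixed_points G P (\<lambda>g F. T g ` F)" "F \<in> hits \<tau> C \<and> F \<in> misses \<tau> ?C'"
    then have "closedin \<tau> F" "T g ` F = F" using assms(1) by (simp_all add: fixed_points_def space_P)
    then have "F \<in> misses \<tau> C" using image_misses_iff[OF assms(1), of F C] F(2) by simp
    then show False using F(2) by (simp add: hits_def misses_def)
  qed
  then have "AE F in P. F \<notin> hits \<tau> C \<inter> misses \<tau> ?C'" by simp
  moreover have "hits \<tau> C \<inter> misses \<tau> ?C' \<in> sets P"
    by (intro sets.Int hits_in_P misses_in_P C(1) C'(1))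
  ultimately have "emeasure P (hits \<tau> C \<inter> misses \<tau> ?C') = 0"
    using AE_iff_null_sets null_setsD1 by blast
  then show False using pos by simp
qed

end

context infinite_polish_action
begin

lemma ex_poisson_closed_set_law: obtains P where "poisson_closed_set G \<tau>\<^sub>G \<tau> T \<nu> P"
proof -
  have "topspace \<tau> \<noteq> {}" using infinite by auto
  then obtain P where "prob_space P" "sets P = sets (effros \<tau>)"
    "\<And>U. openin \<tau> U \<Longrightarrow> emeasure P (misses \<tau> U) = void_prob (emeasure \<nu> U)"
    using ex_poisson_closed_set[OF sigma_finite space_\<nu> _ open_sets] by blast
  then have "poisson_closed_set G \<tau>\<^sub>G \<tau> T \<nu> P"
    by (intro poisson_closed_set.intro infinite_polish_action_axioms poisson_closed_set_axioms.intro)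
  then show thesis by (rule that)
qed

theorem admits_probability_preserving_action:
  assumes "g \<in> carrier G" "y \<in> topspace \<tau>" "T g y \<noteq> y"
  shows "admits_nontrivial_probability_preserving_action TYPE(real) G \<tau>\<^sub>G"
proof -
  obtain P where "poisson_closed_set G \<tau>\<^sub>G \<tau> T \<nu> P" by (rule ex_poisson_closed_set_law)
  then interpret poisson_closed_set G \<tau>\<^sub>G \<tau> T \<nu> P .
  obtain f :: "'y set \<Rightarrow> real" where "inj_on f {F. closedin \<tau> F}"
    using polish by (rule ex_inj_closed_sets_real)
  then show ?thesis
    using transport_action_along_injection[OF spatial nontrivial[OF assms] polish_G] by (simp add: space_P)
qed

end

section \<open>Concentration of measure\<close>

lemma haar_left_invariant:
  assumes G: "polish_group G \<tau>\<^sub>G" and K: "subgroup K G"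
    and m: "normalized_haar_measure G \<tau>\<^sub>G K m" and k: "k \<in> K" and A: "A \<in> sets m"
  shows "emeasure m {l \<in> K. k \<otimes>\<^bsub>G\<^esub> l \<in> A} = emeasure m A"
proof -
  interpret group G using G by (simp add: polish_group_def)
  interpret K: subgroup K G by fact
  have AK: "A \<subseteq> K" using sets.sets_into_space[OF A] m by (simp add: normalized_haar_measure_def)
  have "{l \<in> K. k \<otimes>\<^bsub>G\<^esub> l \<in> A} = inv\<^bsub>G\<^esub> k <#\<^bsub>G\<^esub> A"
  proof (intro equalityI subsetI)
    fix l assume l: "l \<in> {l \<in> K. k \<otimes>\<^bsub>G\<^esub> l \<in> A}"
    then have "l = inv\<^bsub>G\<^esub> k \<otimes>\<^bsub>G\<^esub> (k \<otimes>\<^bsub>G\<^esub> l)"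
      using k K.mem_carrier by (simp add: m_assoc[symmetric])
    then show "l \<in> inv\<^bsub>G\<^esub> k <#\<^bsub>G\<^esub> A" using l unfolding l_coset_def by blast
  next
    fix l assume "l \<in> inv\<^bsub>G\<^esub> k <#\<^bsub>G\<^esub> A"
    then obtain a where a: "a \<in> A" "l = inv\<^bsub>G\<^esub> k \<otimes>\<^bsub>G\<^esub> a" unfolding l_coset_def by blast
    then have "a \<in> K" using AK by blast
    then show "l \<in> {l \<in> K. k \<otimes>\<^bsub>G\<^esub> l \<in> A}"
      using a k K.mem_carrier by (simp add: m_assoc[symmetric])
  qed
  then show ?thesis using m A k by (simp add: normalized_haar_measure_def)
qed

lemma haar_measurable:
  assumes G: "polish_group G \<tau>\<^sub>G" and K: "subgroup K G"
    and m: "normalized_haar_measure G \<tau>\<^sub>G K m"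
  shows "(\<lambda>(k, l). k \<otimes>\<^bsub>G\<^esub> l) \<in> m \<Otimes>\<^sub>M m \<rightarrow>\<^sub>M m" "(\<lambda>k. inv\<^bsub>G\<^esub> k) \<in> m \<rightarrow>\<^sub>M m"
    "(\<lambda>k. inv\<^bsub>G\<^esub> k) \<in> m \<rightarrow>\<^sub>M borel_of \<tau>\<^sub>G"
proof -
  interpret group G using G by (simp add: polish_group_def)
  interpret K: subgroup K G by fact
  let ?s = "subtopology \<tau>\<^sub>G K"
  have G': "continuous_map (prod_topology \<tau>\<^sub>G \<tau>\<^sub>G) \<tau>\<^sub>G (\<lambda>(g, h). g \<otimes>\<^bsub>G\<^esub> h)"
    "continuous_map \<tau>\<^sub>G \<tau>\<^sub>G (\<lambda>g. inv\<^bsub>G\<^esub> g)" "topspace \<tau>\<^sub>G = carrier G" "polish_topology \<tau>\<^sub>G"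
    using G by (simp_all add: polish_group_def)
  have sc: "second_countable ?s"
    by (intro second_countable_subtopology polish_topology_second_countable G')
  have sm: "sets m = sets (borel_of ?s)" using m by (simp add: normalized_haar_measure_def)
  have "continuous_map (prod_topology ?s ?s) ?s (\<lambda>(g, h). g \<otimes>\<^bsub>G\<^esub> h)"
    unfolding subtopology_Times[symmetric] continuous_map_in_subtopology
    using continuous_map_from_subtopology[OF G'(1)] by auto
  from measurable_pair_continuous[OF sc sc this]
  show "(\<lambda>(k, l). k \<otimes>\<^bsub>G\<^esub> l) \<in> m \<Otimes>\<^sub>M m \<rightarrow>\<^sub>M m"
    using measurable_cong_sets[OF sets_pair_measure_cong[OF sm sm] sm] by blast
  have "continuous_map ?s ?s (\<lambda>g. inv\<^bsub>G\<^esub> g)"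
    unfolding continuous_map_in_subtopology
    using continuous_map_from_subtopology[OF G'(2)] by auto
  from measurable_borel_of_continuous[OF this]
  show "(\<lambda>k. inv\<^bsub>G\<^esub> k) \<in> m \<rightarrow>\<^sub>M m" using measurable_cong_sets[OF sm sm] by blast
  from measurable_borel_of_continuous[OF continuous_map_from_subtopology[OF G'(2)]]
  show "(\<lambda>k. inv\<^bsub>G\<^esub> k) \<in> m \<rightarrow>\<^sub>M borel_of \<tau>\<^sub>G" using measurable_cong_sets[OF sm refl] by blast
qed

text \<open>Integrate the indicator of \<open>inv k l \<in> A\<close> over both variables. Integrating first over \<open>l\<close>, left
  invariance gives the measure of \<open>A\<close>. Integrating first over \<open>k\<close>, left invariance applied to
  \<open>inv k l = inv (inv l k)\<close> gives the measure of the inverse of \<open>A\<close>.\<close>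

lemma haar_inverse_invariant:
  assumes G: "polish_group G \<tau>\<^sub>G" and K: "subgroup K G"
    and m: "normalized_haar_measure G \<tau>\<^sub>G K m" and A: "A \<in> sets m"
  shows "emeasure m {k \<in> K. inv\<^bsub>G\<^esub> k \<in> A} = emeasure m A"
proof -
  interpret group G using G by (simp add: polish_group_def)
  interpret K: subgroup K G by fact
  have sp: "space m = K" using m by (simp add: normalized_haar_measure_def)
  interpret m: prob_space m using m by (simp add: normalized_haar_measure_def)
  interpret mm: pair_prob_space m m ..
  note meas = haar_measurable[OF G K m]
  let ?Q = "{p \<in> space (m \<Otimes>\<^sub>M m). inv\<^bsub>G\<^esub> (fst p) \<otimes>\<^bsub>G\<^esub> snd p \<in> A}"
  have "(\<lambda>p. (inv\<^bsub>G\<^esub> (fst p), snd p)) \<in> m \<Otimes>\<^sub>M m \<rightarrow>\<^sub>M m \<Otimes>\<^sub>M m"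
    using meas(2) by measurable
  from measurable_compose[OF this meas(1)]
  have "(\<lambda>p. inv\<^bsub>G\<^esub> (fst p) \<otimes>\<^bsub>G\<^esub> snd p) \<in> m \<Otimes>\<^sub>M m \<rightarrow>\<^sub>M m" by simp
  from measurable_sets[OF this A]
  have Q: "?Q \<in> sets (m \<Otimes>\<^sub>M m)" by (simp add: vimage_def Int_def conj_commute)
  have "emeasure (m \<Otimes>\<^sub>M m) ?Q = (\<integral>\<^sup>+k. emeasure m (Pair k -` ?Q) \<partial>m)"
    by (rule m.emeasure_pair_measure_alt[OF Q])
  also have "\<dots> = (\<integral>\<^sup>+k. emeasure m A \<partial>m)"
  proof (rule nn_integral_cong)
    fix k assume k: "k \<in> space m"
    then have "Pair k -` ?Q = {l \<in> K. inv\<^bsub>G\<^esub> k \<otimes>\<^bsub>G\<^esub> l \<in> A}" by (auto simp: space_pair_measure sp)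
    then show "emeasure m (Pair k -` ?Q) = emeasure m A"
      using haar_left_invariant[OF G K m _ A] k sp by simp
  qed
  also have "\<dots> = emeasure m A" by (simp add: m.emeasure_space_1)
  finally have 1: "emeasure (m \<Otimes>\<^sub>M m) ?Q = emeasure m A" .
  let ?A' = "{k \<in> K. inv\<^bsub>G\<^esub> k \<in> A}"
  have A': "?A' \<in> sets m"
    using measurable_sets[OF meas(2) A] by (simp add: vimage_def Int_def conj_commute sp)
  have "emeasure (m \<Otimes>\<^sub>M m) ?Q = (\<integral>\<^sup>+l. emeasure m ((\<lambda>k. (k, l)) -` ?Q) \<partial>m)"
    by (rule mm.emeasure_pair_measure_alt2[OF Q])
  also have "\<dots> = (\<integral>\<^sup>+l. emeasure m ?A' \<partial>m)"
  proof (rule nn_integral_cong)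
    fix l assume l: "l \<in> space m"
    have lK: "l \<in> K" using l sp by simp
    have "k \<in> (\<lambda>k. (k, l)) -` ?Q \<longleftrightarrow> k \<in> {k \<in> K. inv\<^bsub>G\<^esub> l \<otimes>\<^bsub>G\<^esub> k \<in> ?A'}" for k
    proof (cases "k \<in> K")
      case True
      have "inv\<^bsub>G\<^esub> (inv\<^bsub>G\<^esub> l \<otimes>\<^bsub>G\<^esub> k) = inv\<^bsub>G\<^esub> k \<otimes>\<^bsub>G\<^esub> l"
        using lK True K.mem_carrier by (simp add: inv_mult_group)
      moreover have "inv\<^bsub>G\<^esub> l \<otimes>\<^bsub>G\<^esub> k \<in> K" using lK True by simp
      ultimately show ?thesis using lK True by (simp add: space_pair_measure sp)
    qed (simp add: space_pair_measure sp)
    then have "(\<lambda>k. (k, l)) -` ?Q = {k \<in> K. inv\<^bsub>G\<^esub> l \<otimes>\<^bsub>G\<^esub> k \<in> ?A'}" by blast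
    then show "emeasure m ((\<lambda>k. (k, l)) -` ?Q) = emeasure m ?A'"
      using haar_left_invariant[OF G K m _ A'] l sp by simp
  qed
  also have "\<dots> = emeasure m ?A'" by (simp add: m.emeasure_space_1)
  finally show ?thesis using 1 by simp
qed

text \<open>Inversion exchanges left and right translations.\<close>

lemma haar_right_invariant:
  assumes G: "polish_group G \<tau>\<^sub>G" and K: "subgroup K G"
    and m: "normalized_haar_measure G \<tau>\<^sub>G K m" and k: "k \<in> K" and A: "A \<in> sets m"
  shows "emeasure m {l \<in> K. l \<otimes>\<^bsub>G\<^esub> k \<in> A} = emeasure m A"
proof -
  interpret group G using G by (simp add: polish_group_def)
  interpret K: subgroup K G by fact
  have sp: "space m = K" using m by (simp add: normalized_haar_measure_def)
  note meas = haar_measurable[OF G K m]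
  have "(\<lambda>l. (l, k)) \<in> m \<rightarrow>\<^sub>M m \<Otimes>\<^sub>M m"
    using k by (intro measurable_Pair measurable_ident measurable_const) (simp_all add: sp)
  from measurable_compose[OF this meas(1)] have "(\<lambda>l. l \<otimes>\<^bsub>G\<^esub> k) \<in> m \<rightarrow>\<^sub>M m" by simp
  from measurable_sets[OF this A]
  have B: "{l \<in> K. l \<otimes>\<^bsub>G\<^esub> k \<in> A} \<in> sets m" by (simp add: vimage_def Int_def conj_commute sp)
  let ?A' = "{k \<in> K. inv\<^bsub>G\<^esub> k \<in> A}"
  have A': "?A' \<in> sets m"
    using measurable_sets[OF meas(2) A] by (simp add: vimage_def Int_def conj_commute sp)
  have "l \<in> {l \<in> K. inv\<^bsub>G\<^esub> l \<in> {l \<in> K. l \<otimes>\<^bsub>G\<^esub> k \<in> A}} \<longleftrightarrow>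
      l \<in> {l \<in> K. inv\<^bsub>G\<^esub> k \<otimes>\<^bsub>G\<^esub> l \<in> ?A'}" for l
  proof (cases "l \<in> K")
    case True
    have "inv\<^bsub>G\<^esub> (inv\<^bsub>G\<^esub> k \<otimes>\<^bsub>G\<^esub> l) = inv\<^bsub>G\<^esub> l \<otimes>\<^bsub>G\<^esub> k"
      using True k K.mem_carrier by (simp add: inv_mult_group)
    then show ?thesis using k True by simp
  qed simp
  then have "{l \<in> K. inv\<^bsub>G\<^esub> l \<in> {l \<in> K. l \<otimes>\<^bsub>G\<^esub> k \<in> A}} = {l \<in> K. inv\<^bsub>G\<^esub> k \<otimes>\<^bsub>G\<^esub> l \<in> ?A'}"
    by blast
  then have "emeasure m {l \<in> K. l \<otimes>\<^bsub>G\<^esub> k \<in> A} = emeasure m {l \<in> K. inv\<^bsub>G\<^esub> k \<otimes>\<^bsub>G\<^esub> l \<in> ?A'}"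
    using haar_inverse_invariant[OF G K m B] by simp
  also have "\<dots> = emeasure m ?A'" using k by (intro haar_left_invariant[OF G K m _ A']) simp
  also have "\<dots> = emeasure m A" by (rule haar_inverse_invariant[OF G K m A])
  finally show ?thesis .
qed

text \<open>Write \<open>a\<^sub>n x\<close> and \<open>b\<^sub>n x\<close> for the Haar measures of the \<open>k \<in> K n\<close> with \<open>T (inv k) x\<close> in \<open>A\<close> and in \<open>B\<close>. If
  both stayed above some \<open>e > 0\<close> for infinitely many \<open>n\<close>, concentration would spread the first set of
  \<open>k\<close> by \<open>U\<close> to nearly all of \<open>K n\<close>, while separation keeps it disjoint from the second. Hence
  \<open>min a\<^sub>n b\<^sub>n\<close> tends to \<open>0\<close> pointwise and, being bounded, in mean. On the other hand, by invariance of \<open>P\<close>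
  the measure of \<open>{x \<in> A. T g x \<in> B}\<close> is the mean over \<open>k\<close> and \<open>x\<close> of the event that \<open>T (inv k) x \<in> A\<close> and
  \<open>T (inv (k (inv g))) x \<in> B\<close>, which right invariance bounds by the mean of \<open>min a\<^sub>n b\<^sub>n\<close>.\<close>

theorem concentration_prevents_separation:
  assumes G: "polish_group G \<tau>\<^sub>G" and K: "\<And>n. subgroup (K n) G" "incseq K"
    and m: "\<And>n. normalized_haar_measure G \<tau>\<^sub>G (K n) (m n)"
    and conc: "\<And>A. (\<And>n. A n \<in> sets (m n)) \<Longrightarrow> liminf (\<lambda>n. emeasure (m n) (A n)) > 0 \<Longrightarrow>
      (\<lambda>n. emeasure (m n) (K n \<inter> (A n <#>\<^bsub>G\<^esub> U))) \<longlonglongrightarrow> 1"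
    and P: "prob_space P" and act: "borel_action G \<tau>\<^sub>G P T"
    and pres: "\<And>g. g \<in> carrier G \<Longrightarrow> distr P P (T g) = P"
    and A: "A \<in> sets P" and B: "B \<in> sets P" and UG: "U \<subseteq> carrier G"
    and sep: "\<And>u x. u \<in> U \<Longrightarrow> x \<in> A \<Longrightarrow> T (inv\<^bsub>G\<^esub> u) x \<notin> B"
    and g: "g \<in> K N"
  shows "emeasure P (A \<inter> {x \<in> space P. T g x \<in> B}) = 0"
proof -
  interpret group G using G by (simp add: polish_group_def)
  have tsG: "topspace \<tau>\<^sub>G = carrier G" using G by (simp add: polish_group_def)
  interpret P: prob_space P by fact
  have KG: "K n \<subseteq> carrier G" for n using K(1) by (rule subgroup.subset)
  have spm: "space (m n) = K n" for n using m[of n] by (simp add: normalized_haar_measure_def)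
  have pm: "prob_space (m n)" for n using m[of n] by (simp add: normalized_haar_measure_def)
  have Tm: "(\<lambda>(g, x). T g x) \<in> borel_of \<tau>\<^sub>G \<Otimes>\<^sub>M P \<rightarrow>\<^sub>M P"
    and Tmult: "\<And>g h x. g \<in> carrier G \<Longrightarrow> h \<in> carrier G \<Longrightarrow> x \<in> space P \<Longrightarrow> T g (T h x) = T (g \<otimes>\<^bsub>G\<^esub> h) x"
    using act by (auto simp: borel_action_def)
  have Tm1: "T g \<in> P \<rightarrow>\<^sub>M P" if "g \<in> carrier G" for g
    using measurable_compose[OF measurable_Pair1' Tm, of g] that tsG by simp
  have Tin: "T g x \<in> space P" if "g \<in> carrier G" "x \<in> space P" for g x
    using measurable_space[OF Tm1] that by blast
  have Tinv: "(\<lambda>(x, k). T (inv\<^bsub>G\<^esub> k) x) \<in> P \<Otimes>\<^sub>M m n \<rightarrow>\<^sub>M P" for n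
  proof -
    have "(\<lambda>p. (inv\<^bsub>G\<^esub> (snd p), fst p)) \<in> P \<Otimes>\<^sub>M m n \<rightarrow>\<^sub>M borel_of \<tau>\<^sub>G \<Otimes>\<^sub>M P"
      using haar_measurable(3)[OF G K(1) m] by measurable
    from measurable_compose[OF this Tm] show ?thesis by (simp add: split_def)
  qed
  define Q where "Q S n = {p \<in> space (P \<Otimes>\<^sub>M m n). T (inv\<^bsub>G\<^esub> (snd p)) (fst p) \<in> S}" for S n
  define R where "R S n x = {k \<in> K n. T (inv\<^bsub>G\<^esub> k) x \<in> S}" for S n x
  have Q: "Q S n \<in> sets (P \<Otimes>\<^sub>M m n)" if "S \<in> sets P" for S n
    using measurable_sets[OF Tinv that, of n]
    by (simp add: Q_def vimage_def Int_def conj_commute split_def)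
  have slice: "Pair x -` Q S n = R S n x" if "x \<in> space P" for x S n
    using that by (auto simp: Q_def R_def space_pair_measure spm)
  have R: "R S n x \<in> sets (m n)" if "S \<in> sets P" "x \<in> space P" for S n x
    using sets_Pair1[OF Q[OF that(1)]] slice[OF that(2)] by metis
  define a where "a S n x = emeasure (m n) (R S n x)" for S n x
  have a1: "a S n x \<le> 1" for S n x
    using prob_space.emeasure_le_1[OF pm] by (simp add: a_def)
  have am: "a S n \<in> borel_measurable P" if "S \<in> sets P" for S n
  proof -
    have "(\<lambda>x. emeasure (m n) (Pair x -` Q S n)) \<in> borel_measurable P"
      using sigma_finite_measure.measurable_emeasure_Pair[OF prob_space_imp_sigma_finite[OF pm] Q[OF that]] .
    then show ?thesis by (rule measurable_cong[THEN iffD1, rotated]) (simp add: slice a_def)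
  qed
  have lim: "(\<lambda>n. min (a A n x) (a B n x)) \<longlonglongrightarrow> 0" if x: "x \<in> space P" for x
  proof (rule order_tendstoI)
    fix e :: ennreal assume e: "0 < e"
    show "eventually (\<lambda>n. min (a A n x) (a B n x) < e) sequentially"
    proof (rule ccontr)
      let ?bad = "\<lambda>n. e \<le> min (a A n x) (a B n x)"
      assume "\<not> ?thesis"
      then have freq: "frequently ?bad sequentially" by (simp only: frequently_def not_le not_False_eq_True)
      \<comment> \<open>The hypothesis on concentration refers to whole sequences, so the remaining indices are filled up with \<open>K n\<close>.\<close>
      define C where "C n = (if ?bad n then R A n x else K n)" for n
      have C: "C n \<in> sets (m n)" for n
        using R[OF A x] sets.top[of "m n"] by (simp add: C_def spm)
      have "min e 1 \<le> emeasure (m n) (C n)" for n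
        using prob_space.emeasure_space_1[OF pm] by (auto simp: C_def spm a_def min_def)
      then have "min e 1 \<le> liminf (\<lambda>n. emeasure (m n) (C n))" by (intro Liminf_bounded) auto
      moreover have "0 < min e 1" using e by simp
      ultimately have "0 < liminf (\<lambda>n. emeasure (m n) (C n))" by (rule less_le_trans[rotated])
      then have "(\<lambda>n. emeasure (m n) (K n \<inter> (C n <#>\<^bsub>G\<^esub> U))) \<longlonglongrightarrow> 1" by (intro conc C)
      then have "(\<lambda>n. emeasure (m n) (K n \<inter> (C n <#>\<^bsub>G\<^esub> U)) + e) \<longlonglongrightarrow> 1 + e"
        by (intro tendsto_add tendsto_const)
      moreover have "1 < 1 + e" using e ennreal_add_left_cancel_less[of 1 0 e] by simp
      ultimately have "eventually (\<lambda>n. 1 < emeasure (m n) (K n \<inter> (C n <#>\<^bsub>G\<^esub> U)) + e) sequentially"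
        by (rule order_tendstoD)
      with freq have "frequently (\<lambda>n. ?bad n \<and> 1 < emeasure (m n) (K n \<inter> (C n <#>\<^bsub>G\<^esub> U)) + e) sequentially"
        by (rule frequently_eventually_frequently)
      then obtain n where n: "?bad n" "1 < emeasure (m n) (K n \<inter> (C n <#>\<^bsub>G\<^esub> U)) + e"
        using frequently_ex by blast
      let ?S = "K n \<inter> (C n <#>\<^bsub>G\<^esub> U)"
      \<comment> \<open>If \<open>?S\<close> were not measurable its measure would be \<open>0\<close> by convention, and the bound would hold as well.\<close>
      have "emeasure (m n) ?S + e \<le> emeasure (m n) ?S + a B n x" using n(1) by (intro add_left_mono) simp
      also have "\<dots> \<le> 1"
      proof (cases "?S \<in> sets (m n)")
        case False
        then show ?thesis using a1 by (simp add: emeasure_notin_sets)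
      next
        case True
        have "?S \<inter> R B n x = {}"
        proof -
          have "T (inv\<^bsub>G\<^esub> (c \<otimes>\<^bsub>G\<^esub> u)) x \<notin> B" if "c \<in> C n" "u \<in> U" for c u
          proof -
            have c: "c \<in> carrier G" "T (inv\<^bsub>G\<^esub> c) x \<in> A"
              using that(1) n(1) KG[of n] by (auto simp: C_def R_def)
            have u: "u \<in> carrier G" using that(2) UG by blast
            have "T (inv\<^bsub>G\<^esub> (c \<otimes>\<^bsub>G\<^esub> u)) x = T (inv\<^bsub>G\<^esub> u) (T (inv\<^bsub>G\<^esub> c) x)"
              using c u x by (simp add: inv_mult_group Tmult)
            then show ?thesis using sep[OF that(2) c(2)] by simp
          qed
          then show ?thesis by (auto simp: set_mult_def R_def)
        qed
        then have "emeasure (m n) ?S + a B n x = emeasure (m n) (?S \<union> R B n x)"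
          unfolding a_def by (rule plus_emeasure[OF True R[OF B x]])
        then show ?thesis using prob_space.emeasure_le_1[OF pm] by simp
      qed
      finally show False using n(2) by simp
    qed
  qed simp
  define E where "E = A \<inter> {x \<in> space P. T g x \<in> B}"
  have gG: "g \<in> carrier G" using g KG by blast
  have E: "E \<in> sets P"
    using measurable_sets[OF Tm1[OF gG] B] A
    by (simp add: E_def vimage_def Int_def[of _ "space P"] conj_commute sets.Int)
  have le: "emeasure P E \<le> (\<integral>\<^sup>+x. min (a A n x) (a B n x) \<partial>P)" if n: "N \<le> n" for n
  proof -
    have gn: "inv\<^bsub>G\<^esub> g \<in> K n" using g incseqD[OF K(2) n] subgroup.m_inv_closed[OF K(1)] by blast
    interpret mn: prob_space "m n" by (rule pm)
    interpret pair: pair_prob_space P "m n" ..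
    have "emeasure (P \<Otimes>\<^sub>M m n) (Q E n) = (\<integral>\<^sup>+k. emeasure P ((\<lambda>x. (x, k)) -` Q E n) \<partial>m n)"
      by (rule pair.emeasure_pair_measure_alt2[OF Q[OF E]])
    also have "\<dots> = (\<integral>\<^sup>+k. emeasure P E \<partial>m n)"
    proof (rule nn_integral_cong)
      fix k assume k: "k \<in> space (m n)"
      then have kG: "inv\<^bsub>G\<^esub> k \<in> carrier G" using KG spm by auto
      have "(\<lambda>x. (x, k)) -` Q E n = T (inv\<^bsub>G\<^esub> k) -` E \<inter> space P"
        using k by (auto simp: Q_def space_pair_measure)
      then show "emeasure P ((\<lambda>x. (x, k)) -` Q E n) = emeasure P E"
        using emeasure_distr[OF Tm1[OF kG] E] pres[OF kG] by simp
    qed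
    also have "\<dots> = emeasure P E" by (simp add: mn.emeasure_space_1)
    finally have "emeasure P E = emeasure (P \<Otimes>\<^sub>M m n) (Q E n)" ..
    also have "\<dots> = (\<integral>\<^sup>+x. emeasure (m n) (Pair x -` Q E n) \<partial>P)"
      by (rule mn.emeasure_pair_measure_alt[OF Q[OF E]])
    also have "\<dots> \<le> (\<integral>\<^sup>+x. min (a A n x) (a B n x) \<partial>P)"
    proof (rule nn_integral_mono)
      fix x assume x: "x \<in> space P"
      have "a E n x \<le> a A n x"
        unfolding a_def using R[OF A x] by (intro emeasure_mono) (auto simp: R_def E_def)
      moreover have "a E n x \<le> a B n x"
      proof -
        have eq: "T (inv\<^bsub>G\<^esub> (k \<otimes>\<^bsub>G\<^esub> inv\<^bsub>G\<^esub> g)) x = T g (T (inv\<^bsub>G\<^esub> k) x)" if "k \<in> K n" for k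
        proof -
          have "k \<in> carrier G" using that KG by blast
          then show ?thesis using gG x by (simp add: inv_mult_group Tmult)
        qed
        have "R E n x \<subseteq> {k \<in> K n. k \<otimes>\<^bsub>G\<^esub> inv\<^bsub>G\<^esub> g \<in> R B n x}"
        proof
          fix k assume k: "k \<in> R E n x"
          then have "k \<in> K n" "T g (T (inv\<^bsub>G\<^esub> k) x) \<in> B" by (auto simp: R_def E_def)
          then show "k \<in> {k \<in> K n. k \<otimes>\<^bsub>G\<^esub> inv\<^bsub>G\<^esub> g \<in> R B n x}"
            using eq subgroup.m_closed[OF K(1) _ gn] by (simp add: R_def)
        qed
        moreover have "{k \<in> K n. k \<otimes>\<^bsub>G\<^esub> inv\<^bsub>G\<^esub> g \<in> R B n x} \<in> sets (m n)"
        proof -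
          have "(\<lambda>l. (l, inv\<^bsub>G\<^esub> g)) \<in> m n \<rightarrow>\<^sub>M m n \<Otimes>\<^sub>M m n"
            using gn by (intro measurable_Pair measurable_ident measurable_const) (simp_all add: spm)
          from measurable_compose[OF this haar_measurable(1)[OF G K(1) m]]
          have "(\<lambda>l. l \<otimes>\<^bsub>G\<^esub> inv\<^bsub>G\<^esub> g) \<in> m n \<rightarrow>\<^sub>M m n" by simp
          from measurable_sets[OF this R[OF B x]]
          show ?thesis by (simp add: vimage_def Int_def conj_commute spm)
        qed
        ultimately have "a E n x \<le> emeasure (m n) {k \<in> K n. k \<otimes>\<^bsub>G\<^esub> inv\<^bsub>G\<^esub> g \<in> R B n x}"
          unfolding a_def by (rule emeasure_mono)
        then show ?thesis unfolding a_def haar_right_invariant[OF G K(1) m gn R[OF B x]] .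
      qed
      ultimately show "emeasure (m n) (Pair x -` Q E n) \<le> min (a A n x) (a B n x)"
        by (simp add: slice[OF x] a_def)
    qed
    finally show ?thesis .
  qed
  have "(\<lambda>n. \<integral>\<^sup>+x. min (a A n x) (a B n x) \<partial>P) \<longlonglongrightarrow> (\<integral>\<^sup>+x. 0 \<partial>P)"
  proof (rule nn_integral_dominated_convergence[where w="\<lambda>_. 1"])
    show "(\<lambda>x. min (a A n x) (a B n x)) \<in> borel_measurable P" for n
      using am[OF A] am[OF B] by measurable
    show "AE x in P. min (a A n x) (a B n x) \<le> 1" for n using a1 by (auto simp: min_le_iff_disj)
    show "AE x in P. (\<lambda>n. min (a A n x) (a B n x)) \<longlonglongrightarrow> 0" using lim by auto
  qed (auto simp: P.emeasure_space_1)
  then have "(\<lambda>n. \<integral>\<^sup>+x. min (a A n x) (a B n x) \<partial>P) \<longlonglongrightarrow> 0" by simp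
  then have "emeasure P E \<le> 0" using le by (intro LIMSEQ_le_const) auto
  then show ?thesis by (simp add: E_def)
qed

context infinite_polish_action
begin

text \<open>By density a moved point is moved by an element \<open>k\<close> of some \<open>K N\<close>. With \<open>C\<close> a neighbourhood of the point
  disjoint from its preimage under \<open>T k\<close> and \<open>W'\<close> a smaller one that a neighbourhood of the identity keeps
  inside \<open>C\<close>, the events of hitting \<open>W'\<close> and of missing \<open>C\<close> are separated, so that almost no closed set
  hits \<open>W'\<close> and misses the preimage of \<open>C\<close>. But these two sets are disjoint and of finite measure, so
  this has positive probability.\<close>

theorem levy_group_acts_trivially:
  assumes levy: "levy_group G \<tau>\<^sub>G" and g: "g \<in> carrier G" and y: "y \<in> topspace \<tau>"
  shows "T g y = y"
proof (rule ccontr)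
  assume "T g y \<noteq> y"
  from levy obtain K m where KM: "\<forall>n::nat. subgroup (K n) G \<and> compactin \<tau>\<^sub>G (K n)" "incseq K"
      and dense: "\<tau>\<^sub>G closure_of (\<Union>n. K n) = topspace \<tau>\<^sub>G"
      and m': "\<forall>n. normalized_haar_measure G \<tau>\<^sub>G (K n) (m n)"
      and conc': "\<forall>U A. openin \<tau>\<^sub>G U \<and> \<one>\<^bsub>G\<^esub> \<in> U \<and> (\<forall>n. A n \<in> sets (m n)) \<and>
        liminf (\<lambda>n. emeasure (m n) (A n)) > 0 \<longrightarrow>
        (\<lambda>n. emeasure (m n) (K n \<inter> (A n <#>\<^bsub>G\<^esub> U))) \<longlonglongrightarrow> 1"
    unfolding levy_group_def by (elim conjE exE)
  have K: "\<And>n. subgroup (K n) G" "incseq K" using KM by simp_all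
  have m: "\<And>n. normalized_haar_measure G \<tau>\<^sub>G (K n) (m n)" using m' by simp
  have conc: "(\<lambda>n. emeasure (m n) (K n \<inter> (A n <#>\<^bsub>G\<^esub> U))) \<longlonglongrightarrow> 1"
    if "openin \<tau>\<^sub>G U" "\<one>\<^bsub>G\<^esub> \<in> U" "\<And>n. A n \<in> sets (m n)" "liminf (\<lambda>n. emeasure (m n) (A n)) > 0" for U A
    using conc'[rule_format, of U A] that by simp
  obtain P where "poisson_closed_set G \<tau>\<^sub>G \<tau> T \<nu> P" by (rule ex_poisson_closed_set_law)
  then interpret poisson_closed_set G \<tau>\<^sub>G \<tau> T \<nu> P .
  obtain N k where k: "k \<in> K N" "T k y \<noteq> y"
  proof -
    have "closedin \<tau> {y}"
      using polish_topology_Hausdorff[OF polish] y by (simp add: closedin_Hausdorff_singleton)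
    then have "openin \<tau>\<^sub>G {g \<in> topspace \<tau>\<^sub>G. T g y \<in> topspace \<tau> - {y}}"
      by (intro openin_continuous_map_preimage[OF orbit_continuous[OF y]]) auto
    moreover have "g \<in> {g \<in> topspace \<tau>\<^sub>G. T g y \<in> topspace \<tau> - {y}}"
      using g y \<open>T g y \<noteq> y\<close> T_in topspace_G by auto
    ultimately have "{g \<in> topspace \<tau>\<^sub>G. T g y \<in> topspace \<tau> - {y}} \<inter> (\<Union>n. K n) \<noteq> {}"
      using dense g topspace_G by (metis (no_types, lifting) IntI empty_iff openin_Int_closure_of_eq_empty)
    then show thesis using that by blast
  qed
  have kG: "k \<in> carrier G" using k(1) K(1) subgroup.subset by blast
  obtain C where C: "openin \<tau> C" "y \<in> C" "emeasure \<nu> C < \<infinity>" "C \<inter> (T k -` C \<inter> topspace \<tau>) = {}"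
    using kG y k(2) by (rule displaced_neighbourhood)
  have "T \<one>\<^bsub>G\<^esub> y \<in> C" using C(2) T_one[OF y] by simp
  then obtain V W where VW: "openin \<tau>\<^sub>G V" "openin \<tau> W" "\<one>\<^bsub>G\<^esub> \<in> V" "y \<in> W"
    and VWC: "\<And>v w. v \<in> V \<Longrightarrow> w \<in> W \<Longrightarrow> T v w \<in> C"
    using joint_neighbourhoods[OF C(1) _ _ y] G.one_closed by metis
  define W' where "W' = W \<inter> C"
  have W': "openin \<tau> W'" "y \<in> W'" "W' \<subseteq> C" using VW C by (auto simp: W'_def)
  define U where "U = {u \<in> carrier G. inv\<^bsub>G\<^esub> u \<in> V}"
  have "openin \<tau>\<^sub>G U"
    using polish_G openin_continuous_map_preimage[of \<tau>\<^sub>G \<tau>\<^sub>G "\<lambda>g. inv\<^bsub>G\<^esub> g" V] VW(1) topspace_G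
    by (simp add: U_def polish_group_def)
  moreover have "\<one>\<^bsub>G\<^esub> \<in> U" using VW(3) by (simp add: U_def)
  moreover have "U \<subseteq> carrier G" by (auto simp: U_def)
  moreover have "T (inv\<^bsub>G\<^esub> u) ` F \<notin> misses \<tau> C" if u: "u \<in> U" and F: "F \<in> hits \<tau> W'" for u F
  proof -
    obtain z where "z \<in> F" "z \<in> W'" using F by (auto simp: hits_def)
    then have "T (inv\<^bsub>G\<^esub> u) z \<in> T (inv\<^bsub>G\<^esub> u) ` F \<inter> C" using VWC u by (auto simp: U_def W'_def)
    then show ?thesis by (auto simp: misses_def)
  qed
  ultimately have null: "emeasure P (hits \<tau> W' \<inter> {F \<in> space P. T k ` F \<in> misses \<tau> C}) = 0"
    by (intro concentration_prevents_separation[OF polish_G K m conc prob_space_axioms borel_action_image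
          image_preserves hits_in_P[OF W'(1)] misses_in_P[OF C(1)] _ _ k(1)]) auto
  let ?C' = "T k -` C \<inter> topspace \<tau>"
  have "{F \<in> space P. T k ` F \<in> misses \<tau> C} = misses \<tau> ?C'"
    using image_misses_iff[OF kG] space_P misses_def by fastforce
  moreover have "emeasure P (hits \<tau> W' \<inter> misses \<tau> ?C') > 0"
  proof (rule hits_and_misses_pos)
    show "openin \<tau> ?C'" "emeasure \<nu> ?C' < \<infinity>"
      using openin_preimage[OF kG C(1)] invariant[OF kG C(1)] C(3) by auto
    show "emeasure \<nu> W' < \<infinity>"
      using emeasure_mono[OF W'(3) open_sets[OF C(1)]] C(3) by (rule le_less_trans)
  qed (use W' C in auto)
  ultimately show False using null by simp
qed

end

section \<open>Continuity of the Radon--Nikodym cocycle\<close>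

text \<open>\<open>D g\<close> is the continuous density of \<open>\<mu> \<circ> T g\<close>, that is, a version of the Radon--Nikodym derivative for
  \<open>inv g\<close>. With this choice \<open>\<mu>(g A)\<close> is the integral of \<open>D g\<close> over \<open>A\<close>.\<close>

locale continuous_density_action = polish_action G \<tau>\<^sub>G \<tau> T
  for G :: "('g, 'b) monoid_scheme" and \<tau>\<^sub>G :: "'g topology"
    and \<tau> :: "'x topology" and T :: "'g \<Rightarrow> 'x \<Rightarrow> 'x" +
  fixes M :: "'x measure" and D :: "'g \<Rightarrow> 'x \<Rightarrow> real"
  assumes sigma_finite_M: "sigma_finite_measure M"
    and space_M: "space M = topspace \<tau>" and sets_M: "sets M = sets (borel_of \<tau>)"
    and M_locally_finite: "\<And>x. x \<in> topspace \<tau> \<Longrightarrow> \<exists>U. openin \<tau> U \<and> x \<in> U \<and> emeasure M U < \<infinity>"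
    and M_points_null: "\<And>x. x \<in> topspace \<tau> \<Longrightarrow> emeasure M {x} = 0"
    and M_nonzero: "emeasure M (topspace \<tau>) \<noteq> 0"
    and D_cont: "\<And>g. g \<in> carrier G \<Longrightarrow> continuous_map \<tau> euclideanreal (D g)"
    and D_pos: "\<And>g x. g \<in> carrier G \<Longrightarrow> x \<in> topspace \<tau> \<Longrightarrow> 0 < D g x"
    and D_density: "\<And>g. g \<in> carrier G \<Longrightarrow>
      distr M M (T (inv\<^bsub>G\<^esub> g)) = density M (\<lambda>x. ennreal (D g x))"
begin

lemma open_in_M: "openin \<tau> U \<Longrightarrow> U \<in> sets M"
  by (auto simp: sets_M)

lemma T_measurable: "g \<in> carrier G \<Longrightarrow> T g \<in> M \<rightarrow>\<^sub>M M"
  using measurable_borel_of_continuous[OF T_cont_at] measurable_cong_sets[OF sets_M sets_M] by blast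

lemma continuous_real_measurable:
  assumes "continuous_map \<tau> euclideanreal f" shows "f \<in> borel_measurable M"
  using measurable_borel_of_continuous[OF assms]
    measurable_cong_sets[OF sets_M sets_borel_of_euclidean[symmetric]] by blast

lemma D_measurable: "g \<in> carrier G \<Longrightarrow> D g \<in> borel_measurable M"
  by (intro continuous_real_measurable D_cont)

lemma nn_integral_translate:
  assumes g: "g \<in> carrier G" and f: "f \<in> borel_measurable M"
  shows "(\<integral>\<^sup>+x. f (T (inv\<^bsub>G\<^esub> g) x) \<partial>M) = (\<integral>\<^sup>+x. ennreal (D g x) * f x \<partial>M)"
proof -
  have "(\<integral>\<^sup>+x. f (T (inv\<^bsub>G\<^esub> g) x) \<partial>M) = (\<integral>\<^sup>+x. f x \<partial>distr M M (T (inv\<^bsub>G\<^esub> g)))"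
    using T_measurable[of "inv\<^bsub>G\<^esub> g"] f g by (simp add: nn_integral_distr)
  also have "\<dots> = (\<integral>\<^sup>+x. ennreal (D g x) * f x \<partial>M)"
    unfolding D_density[OF g] using D_measurable[OF g] f by (intro nn_integral_density) auto
  finally show ?thesis .
qed

lemma emeasure_translate:
  assumes g: "g \<in> carrier G" and A: "A \<in> sets M"
  shows "emeasure M (T (inv\<^bsub>G\<^esub> g) -` A \<inter> topspace \<tau>) = (\<integral>\<^sup>+x. ennreal (D g x) * indicator A x \<partial>M)"
proof -
  have "emeasure M (T (inv\<^bsub>G\<^esub> g) -` A \<inter> topspace \<tau>) = emeasure (distr M M (T (inv\<^bsub>G\<^esub> g))) A"
    using T_measurable[of "inv\<^bsub>G\<^esub> g"] A g by (simp add: emeasure_distr space_M)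
  also have "\<dots> = (\<integral>\<^sup>+x. ennreal (D g x) * indicator A x \<partial>M)"
    unfolding D_density[OF g] using D_measurable[OF g] A by (intro emeasure_density) auto
  finally show ?thesis .
qed

definition supp :: "'x set" where
  "supp = {x \<in> topspace \<tau>. \<forall>U. openin \<tau> U \<and> x \<in> U \<longrightarrow> emeasure M U \<noteq> 0}"

lemma supp_subset: "supp \<subseteq> topspace \<tau>" by (auto simp: supp_def)

lemma supp_closed_conull: "closedin \<tau> supp" "topspace \<tau> - supp \<in> null_sets M"
proof -
  obtain B where B: "countable_base \<tau> B" using polish by (rule polish_countable_base)
  have eq: "topspace \<tau> - supp = (\<Union>n\<in>{n. emeasure M (B n) = 0}. B n)"
  proof (intro equalityI subsetI)
    fix x assume "x \<in> topspace \<tau> - supp"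
    then obtain U where U: "openin \<tau> U" "x \<in> U" "emeasure M U = 0" by (auto simp: supp_def)
    obtain n where n: "x \<in> B n" "B n \<subseteq> U" using B U(1,2) by (rule countable_baseE)
    have "emeasure M (B n) \<le> emeasure M U" by (intro emeasure_mono n open_in_M U)
    then show "x \<in> (\<Union>n\<in>{n. emeasure M (B n) = 0}. B n)" using n(1) U(3) by auto
  next
    fix x assume "x \<in> (\<Union>n\<in>{n. emeasure M (B n) = 0}. B n)"
    then obtain n where "x \<in> B n" "emeasure M (B n) = 0" by blast
    then show "x \<in> topspace \<tau> - supp"
      using countable_base_openin[OF B, of n] openin_subset[of \<tau> "B n"] by (auto simp: supp_def)
  qed
  have "openin \<tau> (topspace \<tau> - supp)" unfolding eq using countable_base_openin[OF B] by blast
  then show "closedin \<tau> supp" using supp_subset by (simp add: closedin_def)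
  show "topspace \<tau> - supp \<in> null_sets M"
    unfolding eq using countable_base_openin[OF B] open_in_M by (intro null_sets_UN') auto
qed

lemma supp_in_M: "supp \<in> sets M"
  using sets.compl_sets[OF null_setsD2[OF supp_closed_conull(2)]] supp_subset
  by (simp add: space_M double_diff)

lemma AE_supp: "AE x in M. x \<in> supp"
  using AE_not_in[OF supp_closed_conull(2)] AE_space by eventually_elim (auto simp: space_M)

lemma supp_open_pos: "openin \<tau> U \<Longrightarrow> x \<in> U \<Longrightarrow> x \<in> supp \<Longrightarrow> emeasure M U > 0"
  by (auto simp: supp_def zero_less_iff_neq_zero)

lemma supp_small_neighbourhood:
  assumes x: "x \<in> supp" and U: "openin \<tau> U" "x \<in> U"
  obtains W where "openin \<tau> W" "x \<in> W" "W \<subseteq> U" "0 < emeasure M W" "emeasure M W < \<infinity>"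
proof -
  obtain V where V: "openin \<tau> V" "x \<in> V" "emeasure M V < \<infinity>"
    using M_locally_finite x supp_subset by blast
  have "emeasure M (U \<inter> V) \<le> emeasure M V" by (intro emeasure_mono open_in_M V) auto
  then have "emeasure M (U \<inter> V) < \<infinity>" using V(3) by (rule le_less_trans)
  moreover have "openin \<tau> (U \<inter> V)" using U V by blast
  ultimately show thesis using that[of "U \<inter> V"] U V supp_open_pos[of "U \<inter> V" x] x by blast
qed

lemma T_supp:
  assumes g: "g \<in> carrier G" and x: "x \<in> supp" shows "T g x \<in> supp"
proof -
  have xt: "x \<in> topspace \<tau>" using x supp_subset by blast
  have "emeasure M U \<noteq> 0" if U: "openin \<tau> U" "T g x \<in> U" for U
  proof
    assume "emeasure M U = 0"
    then have "AE y in M. y \<notin> U" using open_in_M[OF U(1)] by (intro AE_not_in null_setsI)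
    then have "AE y in M. ennreal (D (inv\<^bsub>G\<^esub> g) y) * indicator U y = 0" by eventually_elim simp
    then have "(\<integral>\<^sup>+y. ennreal (D (inv\<^bsub>G\<^esub> g) y) * indicator U y \<partial>M) = (\<integral>\<^sup>+y. 0 \<partial>M)"
      by (rule nn_integral_cong_AE)
    then have "emeasure M (T g -` U \<inter> topspace \<tau>) = 0"
      using emeasure_translate[of "inv\<^bsub>G\<^esub> g" U] g open_in_M[OF U(1)] by simp
    then show False using supp_open_pos[OF openin_preimage[OF g U(1)] _ x] U(2) xt by simp
  qed
  then show ?thesis using T_in[OF g xt] by (simp add: supp_def)
qed

text \<open>The set where two continuous functions differ is open, so it is either not null or disjoint from the
  support. This turns almost everywhere identities into identities at every point of the support.\<close>

lemma AE_eq_on_supp: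
  assumes f: "continuous_map \<tau> euclideanreal f" and h: "continuous_map \<tau> euclideanreal h"
    and ae: "AE x in M. f x = h x" and x: "x \<in> supp"
  shows "f x = h x"
proof (rule ccontr)
  assume ne: "f x \<noteq> h x"
  let ?U = "{x \<in> topspace \<tau>. f x - h x \<in> - {0}}"
  have "openin \<tau> ?U"
    by (intro openin_continuous_map_preimage[of \<tau> euclideanreal] continuous_intros f h) auto
  moreover have "x \<in> ?U" using ne x supp_subset by auto
  ultimately have "emeasure M ?U > 0" "?U \<in> sets M" using supp_open_pos x open_in_M by auto
  moreover have "AE x in M. x \<notin> ?U" using ae by eventually_elim simp
  ultimately show False using AE_iff_null_sets[of ?U M] null_setsD1 by (metis less_irrefl)
qed

text \<open>Both sides are continuous densities of the measure translated by \<open>g h\<close>.\<close>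

lemma D_cocycle:
  assumes g: "g \<in> carrier G" and h: "h \<in> carrier G" and x: "x \<in> supp"
  shows "D (g \<otimes>\<^bsub>G\<^esub> h) x = D g (T h x) * D h x"
proof -
  have gh: "g \<otimes>\<^bsub>G\<^esub> h \<in> carrier G" using g h by simp
  have c: "continuous_map \<tau> euclideanreal (\<lambda>x. D g (T h x))"
    using continuous_map_compose[OF T_cont_at[OF h] D_cont[OF g]] by (simp add: o_def)
  note m [measurable] = D_measurable[OF g] D_measurable[OF h] D_measurable[OF gh]
    continuous_real_measurable[OF c]
  have "density M (\<lambda>x. ennreal (D (g \<otimes>\<^bsub>G\<^esub> h) x)) = density M (\<lambda>x. ennreal (D g (T h x) * D h x))"
  proof (rule measure_eqI)
    fix A assume "A \<in> sets (density M (\<lambda>x. ennreal (D (g \<otimes>\<^bsub>G\<^esub> h) x)))"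
    then have A [measurable]: "A \<in> sets M" by simp
    have Th: "T (inv\<^bsub>G\<^esub> h) \<in> M \<rightarrow>\<^sub>M M" using h by (intro T_measurable) simp
    have i: "(\<lambda>x. indicator A (T (inv\<^bsub>G\<^esub> h) x) :: ennreal) \<in> borel_measurable M"
      using measurable_compose[OF Th borel_measurable_indicator[OF A]] .
    have "emeasure (density M (\<lambda>x. ennreal (D (g \<otimes>\<^bsub>G\<^esub> h) x))) A
        = (\<integral>\<^sup>+x. ennreal (D (g \<otimes>\<^bsub>G\<^esub> h) x) * indicator A x \<partial>M)"
      by (simp add: emeasure_density)
    also have "\<dots> = (\<integral>\<^sup>+x. indicator A (T (inv\<^bsub>G\<^esub> (g \<otimes>\<^bsub>G\<^esub> h)) x) \<partial>M)"
      by (rule nn_integral_translate[OF gh, symmetric]) simp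
    also have "\<dots> = (\<integral>\<^sup>+x. indicator A (T (inv\<^bsub>G\<^esub> h) (T (inv\<^bsub>G\<^esub> g) x)) \<partial>M)"
      using g h by (intro nn_integral_cong) (simp add: T_mult space_M G.inv_mult_group)
    also have "\<dots> = (\<integral>\<^sup>+x. ennreal (D g x) * indicator A (T (inv\<^bsub>G\<^esub> h) x) \<partial>M)"
      by (rule nn_integral_translate[OF g i])
    also have "\<dots> = (\<integral>\<^sup>+x. ennreal (D g (T h (T (inv\<^bsub>G\<^esub> h) x))) * indicator A (T (inv\<^bsub>G\<^esub> h) x) \<partial>M)"
      using h by (intro nn_integral_cong) (simp add: space_M)
    also have "\<dots> = (\<integral>\<^sup>+x. ennreal (D h x) * (ennreal (D g (T h x)) * indicator A x) \<partial>M)"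
      by (rule nn_integral_translate[OF h, of "\<lambda>x. ennreal (D g (T h x)) * indicator A x"]) measurable
    also have "\<dots> = (\<integral>\<^sup>+x. ennreal (D g (T h x) * D h x) * indicator A x \<partial>M)"
      using D_pos[OF h] D_pos[OF g] T_in[OF h]
      by (intro nn_integral_cong) (simp add: space_M ennreal_mult less_imp_le mult_ac)
    also have "\<dots> = emeasure (density M (\<lambda>x. ennreal (D g (T h x) * D h x))) A"
      by (simp add: emeasure_density)
    finally show "emeasure (density M (\<lambda>x. ennreal (D (g \<otimes>\<^bsub>G\<^esub> h) x))) A
      = emeasure (density M (\<lambda>x. ennreal (D g (T h x) * D h x))) A" .
  qed simp
  then have "AE x in M. ennreal (D (g \<otimes>\<^bsub>G\<^esub> h) x) = ennreal (D g (T h x) * D h x)"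
    by (intro sigma_finite_measure.density_unique[OF sigma_finite_M]) auto
  then have "AE x in M. D (g \<otimes>\<^bsub>G\<^esub> h) x = D g (T h x) * D h x"
    using AE_space
  proof eventually_elim
    case (elim x)
    then show ?case
      using D_pos[OF gh] D_pos[OF h] D_pos[OF g] T_in[OF h] by (simp add: space_M less_imp_le)
  qed
  then show ?thesis
    by (intro AE_eq_on_supp[OF D_cont[OF gh] continuous_map_real_mult[OF c D_cont[OF h]] _ x])
qed

lemma D_one: assumes x: "x \<in> supp" shows "D \<one>\<^bsub>G\<^esub> x = 1"
  using D_cocycle[OF G.one_closed G.one_closed x] D_pos[OF G.one_closed, of x] T_one[of x] x supp_subset
  by auto

lemma D_inverse:
  assumes g: "g \<in> carrier G" and x: "x \<in> supp"
  shows "D (inv\<^bsub>G\<^esub> g) (T g x) = 1 / D g x"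
  using D_cocycle[OF G.inv_closed[OF g] g x] D_one[OF x] D_pos[OF g, of x] g x supp_subset
  by (auto simp: field_simps)

text \<open>By joint continuity the preimage of \<open>W\<close> under \<open>T g\<close> is the union of the open sets that a whole
  neighbourhood of \<open>g\<close> maps into \<open>W\<close>. Finitely many neighbourhoods of \<open>g\<close> already account for more than
  measure \<open>r\<close>, and then the measure exceeds \<open>r\<close> on their intersection.\<close>

lemma emeasure_preimage_lsc:
  assumes W: "openin \<tau> W"
  shows "openin \<tau>\<^sub>G {g \<in> carrier G. r < emeasure M (T g -` W \<inter> topspace \<tau>)}"
proof (subst openin_subopen, intro ballI)
  fix g assume "g \<in> {g \<in> carrier G. r < emeasure M (T g -` W \<inter> topspace \<tau>)}"
  then have g: "g \<in> carrier G" "r < emeasure M (T g -` W \<inter> topspace \<tau>)" by auto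
  obtain BG where BG: "countable_base \<tau>\<^sub>G BG"
    using polish_G polish_countable_base unfolding polish_group_def by metis
  define V where "V i = (if g \<in> BG i then BG i else carrier G)" for i
  define A where "A i = \<Union>{U. openin \<tau> U \<and> (\<forall>v\<in>V i. \<forall>y\<in>U. T v y \<in> W)}" for i
  define C where "C k = (\<Union>i\<le>k. A i)" for k :: nat
  have V: "openin \<tau>\<^sub>G (V i)" "g \<in> V i" for i
    using countable_base_openin[OF BG] g(1) openin_topspace[of \<tau>\<^sub>G] by (auto simp: V_def topspace_G)
  have A: "openin \<tau> (A i)" for i unfolding A_def by (rule openin_Union) simp
  then have C: "openin \<tau> (C k)" for k unfolding C_def by auto
  have CW: "(\<Union>k. C k) = T g -` W \<inter> topspace \<tau>"
  proof (intro equalityI subsetI)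
    fix y assume "y \<in> (\<Union>k. C k)"
    then obtain i where i: "y \<in> A i" by (auto simp: C_def)
    then have "T g y \<in> W" using V(2)[of i] unfolding A_def by blast
    then show "y \<in> T g -` W \<inter> topspace \<tau>" using i openin_subset[OF A] by blast
  next
    fix y assume y: "y \<in> T g -` W \<inter> topspace \<tau>"
    then obtain V' U where VU: "openin \<tau>\<^sub>G V'" "openin \<tau> U" "g \<in> V'" "y \<in> U"
      "\<And>v u. v \<in> V' \<Longrightarrow> u \<in> U \<Longrightarrow> T v u \<in> W"
      using joint_neighbourhoods[OF W _ g(1), of y] by blast
    obtain i where i: "g \<in> BG i" "BG i \<subseteq> V'" using BG VU(1,3) by (rule countable_baseE)
    have "U \<subseteq> A i" unfolding A_def V_def using i VU(2,5) by auto
    then show "y \<in> (\<Union>k. C k)" using VU(4) by (auto simp: C_def)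
  qed
  have "(\<lambda>k. emeasure M (C k)) \<longlonglongrightarrow> emeasure M (\<Union>k. C k)"
    using open_in_M[OF C] by (intro Lim_emeasure_incseq) (auto simp: incseq_def C_def, fastforce)
  then have "eventually (\<lambda>k. r < emeasure M (C k)) sequentially"
    using g(2) unfolding CW by (rule order_tendstoD)
  then obtain k where k: "r < emeasure M (C k)" using eventually_happens by fastforce
  let ?N = "\<Inter>(V ` {..k})"
  have "openin \<tau>\<^sub>G ?N" using V by (intro openin_Inter) auto
  moreover have "g \<in> ?N" using V by auto
  moreover have "?N \<subseteq> {g \<in> carrier G. r < emeasure M (T g -` W \<inter> topspace \<tau>)}"
  proof
    fix v assume v: "v \<in> ?N"
    then have vG: "v \<in> carrier G" using openin_subset[OF V(1)[of 0]] topspace_G by auto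
    have "C k \<subseteq> T v -` W \<inter> topspace \<tau>"
      using v openin_subset[OF C] unfolding C_def A_def by fastforce
    then have "emeasure M (C k) \<le> emeasure M (T v -` W \<inter> topspace \<tau>)"
      by (intro emeasure_mono open_in_M openin_preimage[OF vG W])
    then show "v \<in> {g \<in> carrier G. r < emeasure M (T g -` W \<inter> topspace \<tau>)}" using vG k by auto
  qed
  ultimately show "\<exists>S. openin \<tau>\<^sub>G S \<and> g \<in> S \<and> S \<subseteq> {g \<in> carrier G. r < emeasure M (T g -` W \<inter> topspace \<tau>)}"
    by blast
qed

lemma openin_inv_preimage: "openin \<tau>\<^sub>G V \<Longrightarrow> openin \<tau>\<^sub>G {g \<in> carrier G. inv\<^bsub>G\<^esub> g \<in> V}"
  using polish_G openin_continuous_map_preimage[of \<tau>\<^sub>G \<tau>\<^sub>G "\<lambda>g. inv\<^bsub>G\<^esub> g" V] topspace_G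
  by (simp add: polish_group_def)

lemma left_translation_continuous:
  assumes h: "h \<in> carrier G" shows "continuous_map \<tau>\<^sub>G \<tau>\<^sub>G (\<lambda>v. h \<otimes>\<^bsub>G\<^esub> v)"
proof -
  have "continuous_map \<tau>\<^sub>G (prod_topology \<tau>\<^sub>G \<tau>\<^sub>G) (\<lambda>v. (h, v))"
    using h topspace_G by (intro continuous_map_pairedI) auto
  moreover have "continuous_map (prod_topology \<tau>\<^sub>G \<tau>\<^sub>G) \<tau>\<^sub>G (\<lambda>(g, h). g \<otimes>\<^bsub>G\<^esub> h)"
    using polish_G by (simp add: polish_group_def)
  ultimately have "continuous_map \<tau>\<^sub>G \<tau>\<^sub>G ((\<lambda>(g, h). g \<otimes>\<^bsub>G\<^esub> h) \<circ> (\<lambda>v. (h, v)))"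
    by (rule continuous_map_compose)
  then show ?thesis by (simp add: o_def)
qed

text \<open>If \<open>D g\<close> exceeds \<open>q\<close> somewhere on \<open>W \<inter> supp\<close>, then \<open>\<mu>(g U) > q \<mu>(U)\<close> for a small open \<open>U \<subseteq> W\<close> of
  positive finite measure. By lower semicontinuity this persists for nearby group elements, whose
  densities therefore cannot be bounded by \<open>q\<close> on \<open>W \<inter> supp\<close>.\<close>

lemma closedin_D_bound:
  assumes W: "openin \<tau> W" and q: "0 < q"
  shows "closedin \<tau>\<^sub>G {g \<in> carrier G. \<forall>x\<in>W \<inter> supp. D g x \<le> q}"
proof -
  let ?E = "{g \<in> carrier G. \<forall>x\<in>W \<inter> supp. D g x \<le> q}"
  have "openin \<tau>\<^sub>G (carrier G - ?E)"
  proof (subst openin_subopen, intro ballI)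
    fix g assume "g \<in> carrier G - ?E"
    then obtain x where g: "g \<in> carrier G" and x: "x \<in> W" "x \<in> supp" "q < D g x" by force
    define q' where "q' = (q + D g x) / 2"
    have q': "q < q'" "q' < D g x" using x(3) by (auto simp: q'_def)
    have "openin \<tau> {y \<in> topspace \<tau>. D g y \<in> {q'<..}}"
      by (rule openin_continuous_map_preimage[OF D_cont[OF g]]) auto
    then have "openin \<tau> (W \<inter> {y \<in> topspace \<tau>. D g y \<in> {q'<..}})" using W by blast
    moreover have "x \<in> W \<inter> {y \<in> topspace \<tau>. D g y \<in> {q'<..}}" using x q' supp_subset by auto
    ultimately obtain U where U: "openin \<tau> U" "x \<in> U" "U \<subseteq> W \<inter> {y \<in> topspace \<tau>. D g y \<in> {q'<..}}"
      "0 < emeasure M U" "emeasure M U < \<infinity>"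
      by (rule supp_small_neighbourhood[OF x(2)])
    note Um [measurable] = open_in_M[OF U(1)]
    have "ennreal q' * emeasure M U = (\<integral>\<^sup>+y. ennreal q' * indicator U y \<partial>M)"
      by (simp add: nn_integral_cmult_indicator)
    also have "\<dots> \<le> (\<integral>\<^sup>+y. ennreal (D g y) * indicator U y \<partial>M)"
    proof (rule nn_integral_mono)
      fix y show "ennreal q' * indicator U y \<le> ennreal (D g y) * indicator U y"
      proof (cases "y \<in> U")
        case True
        then have "q' \<le> D g y" using U(3) by fastforce
        then show ?thesis using True by (simp add: ennreal_leI)
      qed simp
    qed
    also have "\<dots> = emeasure M (T (inv\<^bsub>G\<^esub> g) -` U \<inter> topspace \<tau>)"
      by (rule emeasure_translate[OF g Um, symmetric])
    finally have "ennreal q' * emeasure M U \<le> emeasure M (T (inv\<^bsub>G\<^esub> g) -` U \<inter> topspace \<tau>)" .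
    moreover have "ennreal q * emeasure M U < ennreal q' * emeasure M U"
      using U(4,5) q q' by (intro ennreal_mult_strict_right_mono) (auto simp: ennreal_less_iff)
    ultimately have lt: "ennreal q * emeasure M U < emeasure M (T (inv\<^bsub>G\<^esub> g) -` U \<inter> topspace \<tau>)"
      by (rule less_le_trans[rotated])
    let ?N = "{h \<in> carrier G. inv\<^bsub>G\<^esub> h \<in> {h \<in> carrier G. ennreal q * emeasure M U < emeasure M (T h -` U \<inter> topspace \<tau>)}}"
    have "openin \<tau>\<^sub>G ?N" by (intro openin_inv_preimage emeasure_preimage_lsc U(1))
    moreover have "g \<in> ?N" using g lt by simp
    moreover have "?N \<subseteq> carrier G - ?E"
    proof
      fix h assume h: "h \<in> ?N"
      then have hG: "h \<in> carrier G" by simp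
      have "h \<notin> ?E"
      proof
        assume "h \<in> ?E"
        have "emeasure M (T (inv\<^bsub>G\<^esub> h) -` U \<inter> topspace \<tau>) = (\<integral>\<^sup>+y. ennreal (D h y) * indicator U y \<partial>M)"
          by (rule emeasure_translate[OF hG Um])
        also have "\<dots> \<le> (\<integral>\<^sup>+y. ennreal q * indicator U y \<partial>M)"
        proof (rule nn_integral_mono_AE)
          show "AE y in M. ennreal (D h y) * indicator U y \<le> ennreal q * indicator U y"
            using AE_supp
          proof eventually_elim
            case (elim y)
            have "D h y \<le> q" if "y \<in> U" using that elim \<open>h \<in> ?E\<close> U(3) by blast
            then show ?case by (cases "y \<in> U") (simp_all add: ennreal_leI)
          qed
        qed
        also have "\<dots> = ennreal q * emeasure M U" by (simp add: nn_integral_cmult_indicator)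
        finally show False using h by auto
      qed
      then show "h \<in> carrier G - ?E" using hG by blast
    qed
    ultimately show "\<exists>S. openin \<tau>\<^sub>G S \<and> g \<in> S \<and> S \<subseteq> carrier G - ?E" by blast
  qed
  then show ?thesis by (simp add: closedin_def topspace_G)
qed

text \<open>For every \<open>g\<close> there are a rational \<open>q\<close> and basic sets \<open>B n\<close> around \<open>x\<close> and \<open>B k\<close> around \<open>T g x\<close> such that
  \<open>D g \<le> c q\<close> on \<open>B n\<close> and \<open>D (inv g) \<le> 1 / q\<close> on \<open>B k\<close>; the latter bounds \<open>D g\<close> from below by \<open>q\<close> at points
  that \<open>T g\<close> maps into \<open>B k\<close>, and both are closed conditions on \<open>g\<close>. As these countably many cases cover
  the Baire space \<open>G\<close>, the closed conditions of one case hold on a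
  nonempty open set \<open>N\<close> containing some \<open>h\<close> with \<open>T h x \<in> B k\<close>. For \<open>v\<close> close to the
  identity also \<open>h v \<in> N\<close>, and in \<open>D v y = D (h v) y / D h (T v y)\<close> numerator and denominator both lie in
  \<open>{q..c * q}\<close>.\<close>

lemma D_near_one:
  assumes x: "x \<in> supp" and c: "1 < c"
  obtains V W where "openin \<tau>\<^sub>G V" "\<one>\<^bsub>G\<^esub> \<in> V" "openin \<tau> W" "x \<in> W"
    "\<And>v y. v \<in> V \<Longrightarrow> y \<in> W \<inter> supp \<Longrightarrow> 1 / c \<le> D v y \<and> D v y \<le> c"
proof -
  have xt: "x \<in> topspace \<tau>" using x supp_subset by blast
  obtain B where B: "countable_base \<tau> B" using polish by (rule polish_countable_base)
  define E where "E q n = {g \<in> carrier G. \<forall>y\<in>B n \<inter> supp. D g y \<le> q}" for q n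
  \<comment> \<open>\<open>F\<close> collects the closed conditions of a case and \<open>O'\<close> the open one.\<close>
  define F where "F = (\<lambda>(n, k, q). E (c * q) n \<inter> {g \<in> carrier G. inv\<^bsub>G\<^esub> g \<in> E (1 / q) k})"
  define O' where "O' = (\<lambda>(n::nat, k, q::real). {g \<in> carrier G. T g x \<in> B k})"
  define I where "I = {n. x \<in> B n} \<times> (UNIV :: nat set) \<times> {q::real. q \<in> \<rat> \<and> 0 < q}"
  have Ecl: "closedin \<tau>\<^sub>G (E q n)" if "0 < q" for q n
    unfolding E_def by (rule closedin_D_bound[OF countable_base_openin[OF B] that])
  have Fcl: "closedin \<tau>\<^sub>G (F p)" if p: "p \<in> I" for p
  proof -
    obtain n k q where pq: "p = (n, k, q)" "0 < q" using p by (auto simp: I_def)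
    have "closedin \<tau>\<^sub>G {g \<in> topspace \<tau>\<^sub>G. inv\<^bsub>G\<^esub> g \<in> E (1 / q) k}"
      using pq polish_G Ecl[of "1 / q" k]
      by (intro closedin_continuous_map_preimage[of \<tau>\<^sub>G \<tau>\<^sub>G]) (auto simp: polish_group_def)
    then show ?thesis using Ecl[of "c * q" n] pq c by (simp add: F_def topspace_G closedin_Int)
  qed
  have Oop: "openin \<tau>\<^sub>G (O' p)" for p
  proof -
    obtain n k q where p: "p = (n, k, q)" by (cases p)
    from openin_continuous_map_preimage[OF orbit_continuous[OF xt] countable_base_openin[OF B]]
    show ?thesis by (simp add: p O'_def topspace_G)
  qed
  have cover: "\<exists>p\<in>I. g \<in> F p \<inter> O' p" if g: "g \<in> carrier G" for g
  proof -
    let ?d = "D g x"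
    have d: "?d > 0" using D_pos g xt by blast
    have "?d / c < ?d" using d c by (simp add: field_simps)
    then obtain q where q: "q \<in> \<rat>" "?d / c < q" "q < ?d" using Rats_dense_in_real by blast
    have q0: "q > 0" using q(2) d c by (meson divide_pos_pos less_trans zero_less_one)
    have "openin \<tau> {y \<in> topspace \<tau>. D g y \<in> {..<c * q}}"
      by (rule openin_continuous_map_preimage[OF D_cont[OF g]]) auto
    moreover have "x \<in> {y \<in> topspace \<tau>. D g y \<in> {..<c * q}}" using q xt c by (simp add: field_simps)
    ultimately obtain n where n: "x \<in> B n" "B n \<subseteq> {y \<in> topspace \<tau>. D g y \<in> {..<c * q}}"
      using B by (auto elim: countable_baseE)
    have gi: "inv\<^bsub>G\<^esub> g \<in> carrier G" using g by simp
    have "openin \<tau> {y \<in> topspace \<tau>. D (inv\<^bsub>G\<^esub> g) y \<in> {..<1 / q}}"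
      by (rule openin_continuous_map_preimage[OF D_cont[OF gi]]) auto
    moreover have "T g x \<in> {y \<in> topspace \<tau>. D (inv\<^bsub>G\<^esub> g) y \<in> {..<1 / q}}"
      using D_inverse[OF g x] T_in[OF g xt] q(3) q0 d by (simp add: frac_less2)
    ultimately obtain k where k: "T g x \<in> B k" "B k \<subseteq> {y \<in> topspace \<tau>. D (inv\<^bsub>G\<^esub> g) y \<in> {..<1 / q}}"
      using B by (auto elim: countable_baseE)
    have "g \<in> F (n, k, q)" using g n(2) k(2) by (force simp: F_def E_def)
    moreover have "g \<in> O' (n, k, q)" using g k(1) by (simp add: O'_def)
    moreover have "(n, k, q) \<in> I" using n(1) q(1) q0 by (simp add: I_def)
    ultimately show ?thesis by blast
  qed
  have "\<exists>p\<in>I. \<tau>\<^sub>G interior_of (\<tau>\<^sub>G closure_of (F p \<inter> O' p)) \<noteq> {}"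
  proof (rule ccontr)
    assume none: "\<not> ?thesis"
    let ?\<G> = "(\<lambda>p. \<tau>\<^sub>G closure_of (F p \<inter> O' p)) ` I"
    have "countable I" unfolding I_def using countable_rat by (intro countable_SIGMA) (auto intro: countable_subset)
    then have "countable ?\<G>" by simp
    moreover have "completely_metrizable_space \<tau>\<^sub>G"
      using polish_G by (simp add: polish_group_def polish_topology_def)
    moreover have "closedin \<tau>\<^sub>G S \<and> \<tau>\<^sub>G interior_of S = {}" if "S \<in> ?\<G>" for S
      using that none by auto
    ultimately have "\<tau>\<^sub>G interior_of \<Union>?\<G> = {}" by (intro Baire_category_alt) auto
    moreover have "\<Union>?\<G> = topspace \<tau>\<^sub>G"
    proof (intro equalityI subsetI)
      fix g assume "g \<in> topspace \<tau>\<^sub>G"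
      then obtain p where "p \<in> I" "g \<in> F p \<inter> O' p" using cover topspace_G by blast
      moreover from this have "g \<in> \<tau>\<^sub>G closure_of (F p \<inter> O' p)"
        using closure_of_subset[of "F p \<inter> O' p" \<tau>\<^sub>G] openin_subset[OF Oop[of p]] by blast
      ultimately show "g \<in> \<Union>?\<G>" by blast
    qed (auto dest: in_closure_of[THEN iffD1])
    ultimately show False using topspace_G G.one_closed interior_of_topspace[of \<tau>\<^sub>G] by auto
  qed
  then obtain p where p: "p \<in> I" "\<tau>\<^sub>G interior_of (\<tau>\<^sub>G closure_of (F p \<inter> O' p)) \<noteq> {}" by blast
  obtain n k q where pq: "p = (n, k, q)" "x \<in> B n" "0 < q" using p(1) by (auto simp: I_def)
  define N where "N = \<tau>\<^sub>G interior_of (\<tau>\<^sub>G closure_of (F p \<inter> O' p))"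
  have N: "openin \<tau>\<^sub>G N" "N \<noteq> {}" "N \<subseteq> \<tau>\<^sub>G closure_of (F p \<inter> O' p)"
    using p(2) by (auto simp: N_def interior_of_subset)
  have "\<tau>\<^sub>G closure_of (F p \<inter> O' p) \<subseteq> F p" using Fcl[OF p(1)] by (intro closure_of_minimal) auto
  then have NF: "N \<subseteq> F p" using N(3) by blast
  have "N \<inter> (F p \<inter> O' p) \<noteq> {}"
  proof
    assume "N \<inter> (F p \<inter> O' p) = {}"
    then have "N \<inter> \<tau>\<^sub>G closure_of (F p \<inter> O' p) = {}" by (simp add: openin_Int_closure_of_eq_empty[OF N(1)])
    then show False using N(2,3) by blast
  qed
  then obtain h where h: "h \<in> N" "h \<in> O' p" by blast
  have hG: "h \<in> carrier G" and hx: "T h x \<in> B k" using h(2) by (simp_all add: pq O'_def)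
  have bounds: "q \<le> D g y \<and> D g y \<le> c * q"
    if g: "g \<in> N" and y: "y \<in> supp" "y \<in> B n" "T g y \<in> B k" for g y
  proof -
    have gG: "g \<in> carrier G" and "g \<in> E (c * q) n" "inv\<^bsub>G\<^esub> g \<in> E (1 / q) k"
      using g NF by (auto simp: pq F_def)
    then have "D g y \<le> c * q" "D (inv\<^bsub>G\<^esub> g) (T g y) \<le> 1 / q"
      using y T_supp[OF gG y(1)] by (auto simp: E_def)
    moreover have "D g y > 0" using D_pos[OF gG] y(1) supp_subset by blast
    ultimately show ?thesis
      using D_inverse[OF gG y(1)] pq(3) by (simp add: field_simps)
  qed
  define A where "A = B n \<inter> (T h -` B k \<inter> topspace \<tau>)"
  have A: "openin \<tau> A" "x \<in> A"
    using countable_base_openin[OF B] openin_preimage[OF hG] pq(2) hx xt by (auto simp: A_def)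
  have "T \<one>\<^bsub>G\<^esub> x \<in> A" using A(2) T_one[OF xt] by simp
  then obtain V1 W where VW: "openin \<tau>\<^sub>G V1" "openin \<tau> W" "\<one>\<^bsub>G\<^esub> \<in> V1" "x \<in> W"
    "\<And>v w. v \<in> V1 \<Longrightarrow> w \<in> W \<Longrightarrow> T v w \<in> A"
    using joint_neighbourhoods[OF A(1) _ G.one_closed xt] by metis
  define V where "V = V1 \<inter> {v \<in> carrier G. h \<otimes>\<^bsub>G\<^esub> v \<in> N}"
  from openin_continuous_map_preimage[OF left_translation_continuous[OF hG] N(1)]
  have V: "openin \<tau>\<^sub>G V" "\<one>\<^bsub>G\<^esub> \<in> V" using VW(1,3) h(1) hG by (auto simp: V_def topspace_G)
  have "1 / c \<le> D v y \<and> D v y \<le> c" if v: "v \<in> V" and y: "y \<in> (W \<inter> B n) \<inter> supp" for v y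
  proof -
    have vG: "v \<in> carrier G" "h \<otimes>\<^bsub>G\<^esub> v \<in> N" "v \<in> V1" using v by (auto simp: V_def)
    have yt: "y \<in> topspace \<tau>" using y supp_subset by blast
    have Tv: "T v y \<in> B n" "T h (T v y) \<in> B k" using VW(5)[OF vG(3)] y by (auto simp: A_def)
    have 1: "q \<le> D (h \<otimes>\<^bsub>G\<^esub> v) y \<and> D (h \<otimes>\<^bsub>G\<^esub> v) y \<le> c * q"
      using y Tv T_mult[OF hG vG(1) yt] vG by (intro bounds) auto
    have 2: "q \<le> D h (T v y) \<and> D h (T v y) \<le> c * q"
      using y Tv T_supp[OF vG(1)] h by (intro bounds) auto
    have "D (h \<otimes>\<^bsub>G\<^esub> v) y = D h (T v y) * D v y" using D_cocycle[OF hG vG(1)] y by blast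
    then have eq: "D v y = D (h \<otimes>\<^bsub>G\<^esub> v) y / D h (T v y)" using 2 pq(3) by (simp add: field_simps)
    have "q / (c * q) \<le> D (h \<otimes>\<^bsub>G\<^esub> v) y / D h (T v y)" using 1 2 pq(3) c by (intro frac_le) auto
    moreover have "D (h \<otimes>\<^bsub>G\<^esub> v) y / D h (T v y) \<le> c * q / q" using 1 2 pq(3) c by (intro frac_le) auto
    ultimately show ?thesis using pq(3) c by (simp add: eq)
  qed
  then show thesis
    using that[OF V, of "W \<inter> B n"] VW(2,4) pq(2) countable_base_openin[OF B] by blast
qed

text \<open>Write a group element close to \<open>g\<close> as \<open>g v\<close> with \<open>v\<close> close to the identity. In
  \<open>D (g v) y = D g (T v y) * D v y\<close> the first factor is close to \<open>D g x\<close> by continuity of \<open>D g\<close> and the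
  second is close to \<open>1\<close>.\<close>

theorem D_jointly_continuous:
  "continuous_map (prod_topology \<tau>\<^sub>G (subtopology \<tau> supp)) euclideanreal (\<lambda>(g, x). D g x)"
  unfolding continuous_map_def
proof (intro conjI allI impI)
  let ?Z = "prod_topology \<tau>\<^sub>G (subtopology \<tau> supp)"
  have Z: "topspace ?Z = carrier G \<times> supp" using supp_subset by (auto simp: topspace_G)
  fix O' :: "real set" assume "openin euclideanreal O'"
  then have O': "open O'" by simp
  show "openin ?Z {p \<in> topspace ?Z. (\<lambda>(g, x). D g x) p \<in> O'}"
  proof (subst openin_subopen, intro ballI)
    fix p assume p: "p \<in> {p \<in> topspace ?Z. (\<lambda>(g, x). D g x) p \<in> O'}"
    obtain g x where gx: "p = (g, x)" "g \<in> carrier G" "x \<in> supp" "D g x \<in> O'" using p Z by auto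
    have xt: "x \<in> topspace \<tau>" using gx(3) supp_subset by blast
    let ?a = "D g x"
    have a: "?a > 0" using D_pos[OF gx(2) xt] .
    obtain e where e: "e > 0" "ball ?a e \<subseteq> O'" using O' gx(4) open_contains_ball by blast
    \<comment> \<open>Each factor is controlled up to \<open>c\<close>, so the product up to \<open>c * c\<close>, which moves \<open>?a\<close> by less than \<open>e\<close>.\<close>
    define c where "c = sqrt (1 + e / (2 * ?a))"
    have c1: "1 < c" using a e(1) by (simp add: c_def)
    have cc: "c * c = 1 + e / (2 * ?a)" using a e(1) by (simp add: c_def)
    obtain V W where VW: "openin \<tau>\<^sub>G V" "\<one>\<^bsub>G\<^esub> \<in> V" "openin \<tau> W" "x \<in> W"
      "\<And>v y. v \<in> V \<Longrightarrow> y \<in> W \<inter> supp \<Longrightarrow> 1 / c \<le> D v y \<and> D v y \<le> c"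
      using gx(3) c1 by (rule D_near_one) blast
    let ?U = "{y \<in> topspace \<tau>. D g y \<in> {?a / c<..<c * ?a}}"
    have U: "openin \<tau> ?U" by (rule openin_continuous_map_preimage[OF D_cont[OF gx(2)]]) auto
    have "x \<in> ?U" using xt a c1 by (simp add: field_simps)
    then have "T \<one>\<^bsub>G\<^esub> x \<in> ?U" using T_one[OF xt] by simp
    then obtain V1 W1 where VW1: "openin \<tau>\<^sub>G V1" "openin \<tau> W1" "\<one>\<^bsub>G\<^esub> \<in> V1" "x \<in> W1"
      "\<And>v y. v \<in> V1 \<Longrightarrow> y \<in> W1 \<Longrightarrow> T v y \<in> ?U"
      using joint_neighbourhoods[OF U _ G.one_closed xt] by blast
    define V2 where "V2 = {h \<in> carrier G. inv\<^bsub>G\<^esub> g \<otimes>\<^bsub>G\<^esub> h \<in> V \<inter> V1}"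
    have "openin \<tau>\<^sub>G V2"
      using openin_continuous_map_preimage[OF left_translation_continuous[OF G.inv_closed[OF gx(2)]], of "V \<inter> V1"]
        VW(1) VW1(1) by (simp add: V2_def topspace_G openin_Int)
    moreover have "openin (subtopology \<tau> supp) ((W \<inter> W1) \<inter> supp)"
      using VW(3) VW1(2) by (auto simp: openin_subtopology)
    ultimately have op: "openin ?Z (V2 \<times> ((W \<inter> W1) \<inter> supp))" by (simp add: openin_prod_Times_iff)
    have mem: "p \<in> V2 \<times> ((W \<inter> W1) \<inter> supp)" using gx VW VW1 by (simp add: V2_def)
    have sub: "V2 \<times> ((W \<inter> W1) \<inter> supp) \<subseteq> {p \<in> topspace ?Z. (\<lambda>(g, x). D g x) p \<in> O'}"
    proof
      fix r assume "r \<in> V2 \<times> ((W \<inter> W1) \<inter> supp)"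
      then obtain h y where r: "r = (h, y)" "h \<in> V2" "y \<in> W" "y \<in> W1" "y \<in> supp" by blast
      let ?v = "inv\<^bsub>G\<^esub> g \<otimes>\<^bsub>G\<^esub> h"
      have hG: "h \<in> carrier G" "?v \<in> V" "?v \<in> V1" using r(2) by (simp_all add: V2_def)
      then have vG: "?v \<in> carrier G" using gx(2) by simp
      have "g \<otimes>\<^bsub>G\<^esub> ?v = h" using gx(2) hG(1) by (simp add: G.m_assoc[symmetric])
      then have D: "D h y = D g (T ?v y) * D ?v y" using D_cocycle[OF gx(2) vG r(5)] by simp
      have 1: "1 / c \<le> D ?v y" "D ?v y \<le> c" using VW(5)[OF hG(2), of y] r by auto
      have 2: "?a / c < D g (T ?v y)" "D g (T ?v y) < c * ?a" using VW1(5)[OF hG(3) r(4)] by auto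
      have pos: "0 < ?a / c" "0 < 1 / c" "0 < D ?v y"
        using a c1 D_pos[OF vG, of y] r(5) supp_subset by auto
      have "D h y \<le> (c * ?a) * c" unfolding D using 1 2 pos by (intro mult_mono) auto
      also have "(c * ?a) * c = (c * c) * ?a" by simp
      also have "\<dots> = ?a + e / 2" unfolding cc using a by (simp add: field_simps)
      finally have up: "D h y < ?a + e" using e(1) by simp
      have "?a - e < ?a / (1 + e / (2 * ?a))"
        using a e(1) by (simp add: field_simps) (smt (verit) mult_pos_pos)
      also have "\<dots> = (?a / c) * (1 / c)" using cc by simp
      also have "\<dots> \<le> D h y" unfolding D using 1 2 pos by (intro mult_mono) auto
      finally have "D h y \<in> ball ?a e" using up by (simp add: dist_real_def abs_less_iff)
      then show "r \<in> {p \<in> topspace ?Z. (\<lambda>(g, x). D g x) p \<in> O'}"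
        using e(2) r hG Z by auto
    qed
    show "\<exists>S. openin ?Z S \<and> p \<in> S \<and> S \<subseteq> {p \<in> topspace ?Z. (\<lambda>(g, x). D g x) p \<in> O'}"
      using op mem sub by blast
  qed
qed simp

end

section \<open>The Maharam extension\<close>

lemma emeasure_lborel_scale:
  assumes d: "0 < d" and A: "A \<in> sets borel"
  shows "emeasure lborel {t. t / d \<in> A} = ennreal d * emeasure lborel A"
proof -
  have "distr lborel borel ((*) (1 / d)) = density lborel (\<lambda>_. inverse \<bar>1 / d\<bar>)"
    using d by (intro lborel_distr_mult) simp
  then have "emeasure (distr lborel borel ((*) (1 / d))) A = emeasure (density lborel (\<lambda>_. ennreal d)) A"
    using d by simp
  moreover have "emeasure (distr lborel borel ((*) (1 / d))) A = emeasure lborel {t. t / d \<in> A}"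
    using A by (subst emeasure_distr) (auto simp: vimage_def)
  moreover have "emeasure (density lborel (\<lambda>_. ennreal d)) A = ennreal d * emeasure lborel A"
    using A by (simp add: emeasure_density_const)
  ultimately show ?thesis by simp
qed

context continuous_density_action
begin

text \<open>Only the support of \<open>\<mu>\<close> is kept: there the cocycle identity holds at every point, and every nonempty
  open set has positive measure. The fibre is the multiplicative half-line with Lebesgue measure, so
  that dividing by \<open>D g x\<close> compensates the density.\<close>

definition maharam_topology :: "('x \<times> real) topology" where
  "maharam_topology = prod_topology (subtopology \<tau> supp) (top_of_set {0<..})"

definition maharam_map :: "'g \<Rightarrow> 'x \<times> real \<Rightarrow> 'x \<times> real" where
  "maharam_map g = (\<lambda>(x, t). (T g x, t / D g x))"

definition maharam_measure :: "('x \<times> real) measure" where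
  "maharam_measure = restrict_space (M \<Otimes>\<^sub>M lborel) (supp \<times> {0<..})"

lemma topspace_maharam: "topspace maharam_topology = supp \<times> {0<..}"
  using supp_subset by (auto simp: maharam_topology_def)

lemma emeasure_supp_Int: "A \<in> sets M \<Longrightarrow> emeasure M (A \<inter> supp) = emeasure M A"
  using AE_supp supp_in_M by (intro emeasure_eq_AE) auto

lemma maharam_domain: "supp \<times> {0<..} \<in> sets (M \<Otimes>\<^sub>M (lborel :: real measure))"
  using supp_in_M by (intro pair_measureI) auto

lemma maharam_open:
  assumes "openin maharam_topology U"
  shows "U \<in> sets (M \<Otimes>\<^sub>M lborel)" "U \<subseteq> supp \<times> {0<..}"
proof -
  have "maharam_topology = subtopology (prod_topology \<tau> euclideanreal) (supp \<times> {0<..})"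
    unfolding maharam_topology_def by (simp add: subtopology_Times)
  then obtain W where W: "openin (prod_topology \<tau> euclideanreal) W" "U = W \<inter> (supp \<times> {0<..})"
    using assms by (auto simp: openin_subtopology)
  have "W \<in> sets (borel_of \<tau> \<Otimes>\<^sub>M borel_of euclideanreal)"
    by (intro openin_prod_in_sets_pair W polish_topology_second_countable polish polish_topology_euclidean)
  also have "sets (borel_of \<tau> \<Otimes>\<^sub>M borel_of euclideanreal) = sets (M \<Otimes>\<^sub>M lborel)"
    using sets_M sets_borel_of_euclidean by (intro sets_pair_measure_cong) auto
  finally show "U \<in> sets (M \<Otimes>\<^sub>M lborel)" using W(2) maharam_domain by auto
  show "U \<subseteq> supp \<times> {0<..}" using W(2) by blast
qed

lemma emeasure_maharam:
  assumes "A \<in> sets (M \<Otimes>\<^sub>M lborel)" "A \<subseteq> supp \<times> {0<..}"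
  shows "emeasure maharam_measure A = emeasure (M \<Otimes>\<^sub>M lborel) A"
  unfolding maharam_measure_def using assms maharam_domain sets.sets_into_space[OF maharam_domain]
  by (intro emeasure_restrict_space) (auto simp: Int_absorb2)

lemma emeasure_maharam_Times:
  assumes "A \<in> sets M" "I \<in> sets borel" "I \<subseteq> {0<..}"
  shows "emeasure maharam_measure ((A \<inter> supp) \<times> I) = emeasure M A * emeasure lborel I"
proof -
  have AS: "A \<inter> supp \<in> sets M" using assms(1) supp_in_M by blast
  have "emeasure maharam_measure ((A \<inter> supp) \<times> I) = emeasure (M \<Otimes>\<^sub>M lborel) ((A \<inter> supp) \<times> I)"
    using assms AS by (intro emeasure_maharam pair_measureI) auto
  also have "\<dots> = emeasure M (A \<inter> supp) * emeasure lborel I"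
    using AS assms(2) by (intro lborel.emeasure_pair_measure_Times) auto
  finally show ?thesis using emeasure_supp_Int[OF assms(1)] by simp
qed

lemma openin_maharam_rectangle:
  assumes "openin \<tau> V" "open I" "I \<subseteq> {0<..}"
  shows "openin maharam_topology ((V \<inter> supp) \<times> I)"
  unfolding maharam_topology_def openin_prod_Times_iff
  using assms by (auto simp: openin_subtopology)

lemma maharam_continuous:
  "continuous_map (prod_topology \<tau>\<^sub>G maharam_topology) maharam_topology (\<lambda>(g, p). maharam_map g p)"
proof -
  let ?Z = "prod_topology \<tau>\<^sub>G maharam_topology" and ?S = "subtopology \<tau> supp"
  have Z: "topspace ?Z = carrier G \<times> (supp \<times> {0<..})"
    by (simp only: topspace_prod_topology topspace_maharam topspace_G)
  have fstS: "continuous_map ?Z ?S (\<lambda>z. fst (snd z))"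
    using continuous_map_compose[OF continuous_map_snd continuous_map_fst, of \<tau>\<^sub>G ?S "top_of_set {0<..}"]
    by (simp add: maharam_topology_def o_def)
  have sndR: "continuous_map ?Z euclideanreal (\<lambda>z. snd (snd z))"
    using continuous_map_compose[OF continuous_map_snd continuous_map_snd, of \<tau>\<^sub>G ?S "top_of_set {0<..}"]
    unfolding maharam_topology_def o_def continuous_map_in_subtopology by blast
  have pair: "continuous_map ?Z (prod_topology \<tau>\<^sub>G ?S) (\<lambda>z. (fst z, fst (snd z)))"
    by (intro continuous_map_pairedI fstS) (rule continuous_map_fst)
  then have pair': "continuous_map ?Z (prod_topology \<tau>\<^sub>G \<tau>) (\<lambda>z. (fst z, fst (snd z)))"
    by (auto simp: continuous_map_pairwise o_def continuous_map_in_subtopology)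
  have "continuous_map ?Z \<tau> (\<lambda>z. T (fst z) (fst (snd z)))"
    using continuous_map_compose[OF pair' T_cont] by (simp add: o_def)
  then have 1: "continuous_map ?Z ?S (\<lambda>z. T (fst z) (fst (snd z)))"
    unfolding continuous_map_in_subtopology using Z T_supp by auto
  have "continuous_map ?Z euclideanreal (\<lambda>z. D (fst z) (fst (snd z)))"
    using continuous_map_compose[OF pair D_jointly_continuous] by (simp add: o_def)
  then have "continuous_map ?Z euclideanreal (\<lambda>z. snd (snd z) / D (fst z) (fst (snd z)))"
    using Z D_pos supp_subset
    by (intro continuous_map_real_divide sndR) (auto simp: less_imp_neq[symmetric] subset_iff)
  then have 2: "continuous_map ?Z (top_of_set {0<..}) (\<lambda>z. snd (snd z) / D (fst z) (fst (snd z)))"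
    unfolding continuous_map_in_subtopology using Z D_pos supp_subset by auto
  have "continuous_map ?Z maharam_topology
      (\<lambda>z. (T (fst z) (fst (snd z)), snd (snd z) / D (fst z) (fst (snd z))))"
    unfolding maharam_topology_def[of ] using 1 2
    by (intro continuous_map_pairedI) (simp_all add: maharam_topology_def)
  then show ?thesis by (simp add: maharam_map_def split_def)
qed

text \<open>The fibre of the preimage of \<open>U\<close> over \<open>x\<close> is the fibre of \<open>U\<close> over \<open>T g x\<close> scaled by \<open>D g x\<close>. Integrating over
  \<open>x\<close>, the factor \<open>D g x\<close> turns the integral into one with respect to the translated measure, which
  undoes the translation by \<open>g\<close>.\<close>

lemma maharam_invariant:
  assumes g: "g \<in> carrier G" and U: "openin maharam_topology U"
  shows "emeasure maharam_measure (maharam_map g -` U \<inter> topspace maharam_topology)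
    = emeasure maharam_measure U"
proof -
  note Um = maharam_open[OF U]
  let ?\<phi> = "\<lambda>x. emeasure lborel (Pair x -` U)"
  let ?V = "maharam_map g -` U \<inter> topspace maharam_topology"
  have \<phi>: "?\<phi> \<in> borel_measurable M" by (rule lborel.measurable_emeasure_Pair[OF Um(1)])
  have Tg: "(\<lambda>x. ?\<phi> (T g x)) \<in> borel_measurable M"
    using measurable_compose[OF T_measurable[OF g] \<phi>] .
  have "continuous_map maharam_topology (prod_topology \<tau>\<^sub>G maharam_topology) (\<lambda>p. (g, p))"
    using g topspace_G by (intro continuous_map_pairedI) auto
  from continuous_map_compose[OF this maharam_continuous]
  have "continuous_map maharam_topology maharam_topology (maharam_map g)" by (simp add: o_def)
  from openin_continuous_map_preimage[OF this U]
  have V: "openin maharam_topology ?V" by (simp add: vimage_def Int_def conj_commute)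
  note Vm = maharam_open[OF V]
  have "emeasure maharam_measure ?V = (\<integral>\<^sup>+x. emeasure lborel (Pair x -` ?V) \<partial>M)"
    by (simp add: emeasure_maharam[OF Vm] lborel.emeasure_pair_measure_alt[OF Vm(1)])
  also have "\<dots> = (\<integral>\<^sup>+x. ennreal (D g x) * ?\<phi> (T g x) \<partial>M)"
  proof (rule nn_integral_cong_AE)
    show "AE x in M. emeasure lborel (Pair x -` ?V) = ennreal (D g x) * ?\<phi> (T g x)"
      using AE_supp
    proof eventually_elim
      case (elim x)
      have d: "0 < D g x" using D_pos[OF g] elim supp_subset by blast
      have "Pair x -` ?V = {t. t / D g x \<in> Pair (T g x) -` U}"
        using elim d Um(2) by (auto simp: topspace_maharam maharam_map_def zero_less_divide_iff)
      moreover have "Pair (T g x) -` U \<in> sets borel" using sets_Pair1[OF Um(1)] by simp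
      ultimately show ?case using emeasure_lborel_scale[OF d, of "Pair (T g x) -` U"] by (simp only:)
    qed
  qed
  also have "\<dots> = (\<integral>\<^sup>+x. ?\<phi> (T g (T (inv\<^bsub>G\<^esub> g) x)) \<partial>M)"
    by (rule nn_integral_translate[OF g Tg, symmetric])
  also have "\<dots> = (\<integral>\<^sup>+x. ?\<phi> x \<partial>M)" using g by (intro nn_integral_cong) (simp add: space_M)
  also have "\<dots> = emeasure maharam_measure U"
    by (simp add: emeasure_maharam[OF Um] lborel.emeasure_pair_measure_alt[OF Um(1)])
  finally show ?thesis .
qed

theorem maharam_extension:
  "infinite_polish_action G \<tau>\<^sub>G maharam_topology maharam_map maharam_measure"
proof (intro infinite_polish_action.intro polish_action.intro infinite_polish_action_axioms.intro)
  show "polish_group G \<tau>\<^sub>G" by (rule polish_G)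
  show "polish_topology maharam_topology"
    unfolding maharam_topology_def
    by (intro polish_topology_prod polish_topology_subtopology_closed[OF polish supp_closed_conull(1)]
        polish_topology_subtopology_open[OF polish_topology_euclidean]) auto
  show "maharam_map \<one>\<^bsub>G\<^esub> p = p" if "p \<in> topspace maharam_topology" for p
    using that T_one D_one supp_subset by (auto simp: topspace_maharam maharam_map_def)
  show "maharam_map g (maharam_map h p) = maharam_map (g \<otimes>\<^bsub>G\<^esub> h) p"
    if "g \<in> carrier G" "h \<in> carrier G" "p \<in> topspace maharam_topology" for g h p
    using that T_mult D_cocycle supp_subset
    by (auto simp: topspace_maharam maharam_map_def subset_iff mult.commute)
  show "continuous_map (prod_topology \<tau>\<^sub>G maharam_topology) maharam_topology (\<lambda>(g, p). maharam_map g p)"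
    by (rule maharam_continuous)
  interpret pair_sigma_finite M "lborel :: real measure"
    unfolding pair_sigma_finite_def using sigma_finite_M lborel.sigma_finite_measure_axioms by blast
  show "sigma_finite_measure maharam_measure"
    unfolding maharam_measure_def
    by (intro sigma_finite_measure_restrict_space maharam_domain) unfold_locales
  show "space maharam_measure = topspace maharam_topology"
    using sets.sets_into_space[OF maharam_domain]
    by (auto simp: maharam_measure_def space_restrict_space topspace_maharam)
  show "U \<in> sets maharam_measure" if "openin maharam_topology U" for U
    using maharam_open[OF that] maharam_domain by (auto simp: maharam_measure_def sets_restrict_space_iff)
  show "\<exists>U. openin maharam_topology U \<and> p \<in> U \<and> emeasure maharam_measure U < \<infinity>"
    if p: "p \<in> topspace maharam_topology" for p
  proof -
    obtain x t where xt: "p = (x, t)" "x \<in> supp" "0 < t" using p topspace_maharam by auto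
    obtain V where V: "openin \<tau> V" "x \<in> V" "emeasure M V < \<infinity>"
      using M_locally_finite xt(2) supp_subset by blast
    let ?U = "(V \<inter> supp) \<times> {0<..<t + 1}"
    have "emeasure maharam_measure ?U = emeasure M V * ennreal (t + 1)"
      using xt(3) open_in_M[OF V(1)] by (subst emeasure_maharam_Times) auto
    then have "emeasure maharam_measure ?U < \<infinity>" using V(3) by (simp add: ennreal_mult_less_top)
    moreover have "openin maharam_topology ?U" using V(1) by (intro openin_maharam_rectangle) auto
    moreover have "p \<in> ?U" using xt V(2) by simp
    ultimately show ?thesis by blast
  qed
  show "emeasure maharam_measure {p} = 0" if p: "p \<in> topspace maharam_topology" for p
  proof -
    obtain x t where xt: "p = (x, t)" "x \<in> supp" "0 < t" using p topspace_maharam by auto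
    have x: "x \<in> topspace \<tau>" using xt(2) supp_subset by blast
    have "closedin \<tau> {x}"
      using polish_topology_Hausdorff[OF polish] x by (simp add: closedin_Hausdorff_singleton)
    then have "{x} \<in> sets M"
      using open_in_M[of "topspace \<tau> - {x}"] sets.compl_sets[of "topspace \<tau> - {x}" M] x
      by (simp add: closedin_def space_M double_diff)
    then have "emeasure maharam_measure (({x} \<inter> supp) \<times> {t}) = emeasure M {x} * emeasure lborel {t}"
      using xt(3) by (intro emeasure_maharam_Times) auto
    then show ?thesis using M_points_null[OF x] xt by simp
  qed
  show "emeasure maharam_measure U \<noteq> 0" if U: "openin maharam_topology U" "U \<noteq> {}" for U
  proof -
    obtain x t where p: "(x, t) \<in> U" using U(2) by auto
    obtain V I where VI: "openin (subtopology \<tau> supp) V" "openin (top_of_set {0<..}) I"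
      "x \<in> V" "t \<in> I" "V \<times> I \<subseteq> U"
      using U(1) p unfolding maharam_topology_def openin_prod_topology_alt by meson
    obtain V' where V': "openin \<tau> V'" "V = V' \<inter> supp" using VI(1) by (auto simp: openin_subtopology)
    have I: "open I" "I \<subseteq> {0<..}" using VI(2) by (auto simp: openin_open_eq)
    have "emeasure maharam_measure (V \<times> I) = emeasure M V' * emeasure lborel I"
      unfolding V'(2) using I open_in_M[OF V'(1)] by (intro emeasure_maharam_Times) auto
    moreover have "emeasure M V' \<noteq> 0" using supp_open_pos[OF V'(1), of x] VI(3) V'(2) by auto
    moreover have "emeasure lborel I \<noteq> 0"
    proof -
      obtain e where e: "e > 0" "cball t e \<subseteq> I" using I(1) VI(4) open_contains_cball by blast
      have "emeasure lborel (cball t e) \<le> emeasure lborel I" using e(2) I(1) by (intro emeasure_mono) auto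
      then show ?thesis using e(1) by (auto simp: cball_eq_atLeastAtMost)
    qed
    ultimately have "emeasure maharam_measure (V \<times> I) \<noteq> 0" by simp
    moreover have "emeasure maharam_measure (V \<times> I) \<le> emeasure maharam_measure U"
      using VI(5) maharam_open[OF U(1)] maharam_domain
      by (intro emeasure_mono) (auto simp: maharam_measure_def sets_restrict_space_iff)
    ultimately show ?thesis by auto
  qed
  show "emeasure maharam_measure (topspace maharam_topology) = \<infinity>"
  proof -
    have le: "ennreal (real n) \<le> emeasure lborel {0::real<..}" for n
    proof -
      have "emeasure lborel {0<..<real n} \<le> emeasure lborel {0::real<..}" by (intro emeasure_mono) auto
      then show ?thesis by simp
    qed
    have "emeasure lborel {0::real<..} = \<infinity>"
    proof (rule ccontr)
      assume "emeasure lborel {0::real<..} \<noteq> \<infinity>"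
      then obtain r where r: "emeasure lborel {0::real<..} = ennreal r" "0 \<le> r"
        by (cases "emeasure lborel {0::real<..}") auto
      obtain n where "r < real n" using reals_Archimedean2 by blast
      then show False using le[of n] r by simp
    qed
    then have "emeasure maharam_measure ((topspace \<tau> \<inter> supp) \<times> {0<..}) = emeasure M (topspace \<tau>) * \<infinity>"
      using open_in_M[of "topspace \<tau>"] by (subst emeasure_maharam_Times) auto
    moreover have "(topspace \<tau> \<inter> supp) \<times> {0::real<..} = topspace maharam_topology"
      using supp_subset by (auto simp: topspace_maharam)
    ultimately show ?thesis using M_nonzero by (simp add: ennreal_mult_eq_top_iff)
  qed
  show "emeasure maharam_measure (maharam_map g -` U \<inter> topspace maharam_topology)
      = emeasure maharam_measure U"
    if "g \<in> carrier G" "openin maharam_topology U" for g U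
    using that by (rule maharam_invariant)
qed

lemma nontrivial_moves_supp:
  assumes "\<not> trivial_action G M T"
  obtains g x where "g \<in> carrier G" "x \<in> supp" "T g x \<noteq> x"
proof -
  have "\<not> (\<forall>x\<in>supp. \<forall>g\<in>carrier G. T g x = x)"
  proof
    assume all: "\<forall>x\<in>supp. \<forall>g\<in>carrier G. T g x = x"
    have "AE x in M. x \<in> fixed_points G M T"
      using AE_supp by eventually_elim (use all supp_subset in \<open>auto simp: fixed_points_def space_M\<close>)
    then show False using assms by (simp add: trivial_action_def)
  qed
  then show thesis using that by blast
qed

end

section \<open>Consequences for Polish groups and Levy groups\<close>

lemma ex_continuous_density_action:
  assumes G: "polish_group G \<tau>\<^sub>G"
    and act: "locally_finite_polish_nonsingular_action G \<tau>\<^sub>G M \<tau> T"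
    and rn: "continuous_rn_cocycle G M \<tau> T"
  obtains D where "continuous_density_action G \<tau>\<^sub>G \<tau> T M D"
proof -
  have std: "standard_measure_space M" and bor: "borel_action G \<tau>\<^sub>G M T"
    and ac: "\<And>g. g \<in> carrier G \<Longrightarrow> absolutely_continuous M (distr M M (T g))"
    and lf: "polish_topology \<tau>" "topspace \<tau> = space M" "sets M = sets (borel_of \<tau>)"
      "continuous_map (prod_topology \<tau>\<^sub>G \<tau>) \<tau> (\<lambda>(g, x). T g x)"
      "\<And>x. x \<in> space M \<Longrightarrow> \<exists>U. openin \<tau> U \<and> x \<in> U \<and> emeasure M U < \<infinity>"
    using act unfolding locally_finite_polish_nonsingular_action_def nonsingular_spatial_action_def
      locally_finite_polish_def by auto
  interpret G: group G using G by (simp add: polish_group_def)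
  have sf: "sigma_finite_measure M"
    using std prob_space_imp_sigma_finite unfolding standard_measure_space_def by blast
  have pa: "polish_action G \<tau>\<^sub>G \<tau> T"
    using G lf bor by unfold_locales (auto simp: borel_action_def)
  have ex: "\<exists>f. continuous_map \<tau> (top_of_set {0<..}) f \<and>
      (AE x in M. rn_cocycle M T (inv\<^bsub>G\<^esub> g) x = ennreal (f x))" if "g \<in> carrier G" for g
    using rn that unfolding continuous_rn_cocycle_def by auto
  define D where "D g = (SOME f. continuous_map \<tau> (top_of_set {0<..}) f \<and>
      (AE x in M. rn_cocycle M T (inv\<^bsub>G\<^esub> g) x = ennreal (f x)))" for g
  have D: "continuous_map \<tau> (top_of_set {0<..}) (D g)"
      "AE x in M. rn_cocycle M T (inv\<^bsub>G\<^esub> g) x = ennreal (D g x)" if "g \<in> carrier G" for g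
    using someI_ex[OF ex[OF that]] unfolding D_def[symmetric] by auto
  have "continuous_density_action G \<tau>\<^sub>G \<tau> T M D"
  proof (intro continuous_density_action.intro pa continuous_density_action_axioms.intro)
    show "sigma_finite_measure M" by (rule sf)
    show "space M = topspace \<tau>" "sets M = sets (borel_of \<tau>)" using lf by simp_all
    show "\<exists>U. openin \<tau> U \<and> x \<in> U \<and> emeasure M U < \<infinity>" if "x \<in> topspace \<tau>" for x
      using lf that by simp
    show "emeasure M {x} = 0" if x: "x \<in> topspace \<tau>" for x
    proof (rule ccontr)
      assume pos: "emeasure M {x} \<noteq> 0"
      then have "{x} \<in> sets M" using emeasure_notin_sets by blast
      moreover have "B = {} \<or> {x} - B = {}" if "B \<subseteq> {x}" for B using that by blast
      ultimately have "is_atom M {x}" using pos unfolding is_atom_def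
        by (metis emeasure_empty zero_less_iff_neq_zero)
      then show False using std by (auto simp: standard_measure_space_def)
    qed
    show "emeasure M (topspace \<tau>) \<noteq> 0"
      using std lf(2) prob_space.emeasure_space_1[of M] unfolding standard_measure_space_def by auto
    fix g assume g: "g \<in> carrier G"
    show "continuous_map \<tau> euclideanreal (D g)"
      using D(1)[OF g] by (simp add: continuous_map_in_subtopology)
    show "0 < D g x" if "x \<in> topspace \<tau>" for x
      using continuous_map_image_subset_topspace[OF D(1)[OF g]] that by auto
    have "distr M M (T (inv\<^bsub>G\<^esub> g)) = density M (RN_deriv M (distr M M (T (inv\<^bsub>G\<^esub> g))))"
      using ac[of "inv\<^bsub>G\<^esub> g"] g
      by (intro sigma_finite_measure.density_RN_deriv[OF sf, symmetric]) auto
    also have "\<dots> = density M (\<lambda>x. ennreal (D g x))"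
    proof (rule density_cong)
      have "D g \<in> borel_of \<tau> \<rightarrow>\<^sub>M borel_of euclideanreal"
        using D(1)[OF g] by (intro measurable_borel_of_continuous) (simp add: continuous_map_in_subtopology)
      then have "D g \<in> borel_measurable M"
        using measurable_cong_sets[OF lf(3) sets_borel_of_euclidean[symmetric]] by blast
      then show "(\<lambda>x. ennreal (D g x)) \<in> borel_measurable M" by simp
      show "AE x in M. RN_deriv M (distr M M (T (inv\<^bsub>G\<^esub> g))) x = ennreal (D g x)"
        using D(2)[OF g] by (simp add: rn_cocycle_def)
    qed simp
    finally show "distr M M (T (inv\<^bsub>G\<^esub> g)) = density M (\<lambda>x. ennreal (D g x))" .
  qed
  then show thesis by (rule that)
qed

text \<open>Both conclusions are statements about the Maharam extension, which moves the point \<open>(x, 1)\<close> whenever the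
  given action moves a point \<open>x\<close> of the support.\<close>

theorem continuous_rn_action_consequences:
  assumes G: "polish_group G \<tau>\<^sub>G"
    and adm: "admits_nontrivial_lf_polish_nonsingular_action_continuous_rn TYPE('x) G \<tau>\<^sub>G"
  shows "admits_nontrivial_probability_preserving_action TYPE(real) G \<tau>\<^sub>G \<and> \<not> levy_group G \<tau>\<^sub>G"
proof -
  obtain M :: "'x measure" and \<tau> T where
    act: "locally_finite_polish_nonsingular_action G \<tau>\<^sub>G M \<tau> T" "continuous_rn_cocycle G M \<tau> T"
    and nontriv: "\<not> trivial_action G M T"
    using adm unfolding admits_nontrivial_lf_polish_nonsingular_action_continuous_rn_def by blast
  obtain D where "continuous_density_action G \<tau>\<^sub>G \<tau> T M D"
    using G act by (rule ex_continuous_density_action)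
  then interpret continuous_density_action G \<tau>\<^sub>G \<tau> T M D .
  interpret maharam: infinite_polish_action G \<tau>\<^sub>G maharam_topology maharam_map maharam_measure
    by (rule maharam_extension)
  obtain g x where gx: "g \<in> carrier G" "x \<in> supp" "T g x \<noteq> x"
    using nontriv by (rule nontrivial_moves_supp)
  have moved: "(x, 1) \<in> topspace maharam_topology" "maharam_map g (x, 1) \<noteq> (x, 1)"
    using gx by (simp_all add: topspace_maharam maharam_map_def)
  show ?thesis
    using maharam.admits_probability_preserving_action[OF gx(1) moved]
      maharam.levy_group_acts_trivially[OF _ gx(1) moved(1)] moved(2) by blast
qed

lemma measure_preserving_imp_continuous_rn:
  assumes adm: "admits_nontrivial_lf_polish_action TYPE('x) G \<tau>\<^sub>G"
  shows "admits_nontrivial_lf_polish_nonsingular_action_continuous_rn TYPE('x) G \<tau>\<^sub>G"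
proof -
  obtain M :: "'x measure" and \<tau> T where sp: "spatial_action G \<tau>\<^sub>G M T"
    and lf: "locally_finite_polish \<tau>\<^sub>G M \<tau> T" and nt: "\<not> trivial_action G M T"
    using adm unfolding admits_nontrivial_lf_polish_action_def locally_finite_polish_action_def by blast
  have std: "standard_measure_space M" and pres: "\<And>g. g \<in> carrier G \<Longrightarrow> distr M M (T g) = M"
    using sp by (auto simp: spatial_action_def)
  have "locally_finite_polish_nonsingular_action G \<tau>\<^sub>G M \<tau> T"
    using sp lf unfolding locally_finite_polish_nonsingular_action_def nonsingular_spatial_action_def
      spatial_action_def by (simp add: absolutely_continuous_def)
  moreover have "continuous_rn_cocycle G M \<tau> T"
    unfolding continuous_rn_cocycle_def
  proof (intro ballI exI conjI)
    fix g assume g: "g \<in> carrier G"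
    show "continuous_map \<tau> (top_of_set {0<..}) (\<lambda>_. 1::real)" by simp
    interpret sigma_finite_measure M
      using std prob_space_imp_sigma_finite unfolding standard_measure_space_def by blast
    have "AE x in M. 1 = RN_deriv M M x"
      by (intro RN_deriv_unique) (auto simp: density_1)
    then show "AE x in M. rn_cocycle M T g x = ennreal 1"
      unfolding rn_cocycle_def pres[OF g] by eventually_elim simp
  qed
  ultimately show ?thesis
    using nt unfolding admits_nontrivial_lf_polish_nonsingular_action_continuous_rn_def by blast
qed

theorem theorem5:
  fixes G :: "('g, 'b) monoid_scheme" and \<tau>\<^sub>G :: "'g topology"
  assumes "polish_group G \<tau>\<^sub>G"
  shows "(admits_nontrivial_lf_polish_action TYPE('x) G \<tau>\<^sub>G \<or>
          admits_nontrivial_lf_polish_nonsingular_action_continuous_rn TYPE('x) G \<tau>\<^sub>G \<longrightarrow>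
            admits_nontrivial_probability_preserving_action TYPE(real) G \<tau>\<^sub>G) \<and>
         (levy_group G \<tau>\<^sub>G \<longrightarrow>
            \<not> admits_nontrivial_lf_polish_action TYPE('x) G \<tau>\<^sub>G \<and>
            \<not> admits_nontrivial_lf_polish_nonsingular_action_continuous_rn TYPE('x) G \<tau>\<^sub>G)"
  using continuous_rn_action_consequences[OF assms, where ?'x = 'x]
    measure_preserving_imp_continuous_rn[of G \<tau>\<^sub>G, where ?'x = 'x] by blast

end
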